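(* Let $G$ be a finite group and $K$ an algebraically closed field of characteristic $0$. There is a bijection $$\{\text{irreducible }(K\subseteq K[G])\text{-gliders of length }1\}/\!\cong\ \ \longleftrightarrow\ \ \{(A,B)\in \mathcal{P}(G/G')\times \mathcal{S}_G\},$$ where $G'=[G,G]$ is the commutator subgroup of $G$, $\mathcal{P}(G/G')$ is the power set of $G/G'$, and $\mathcal{S}_G$ is the set defined in the context.
   Context: A $(K\subseteq K[G])$-glider of length $1$ consists of a left $K[G]$-module $\Omega$ and finite-dimensional $K$-subspaces $0\neq M_{-1}\subseteq M_0\subseteq\Omega$ with $K[G]M_{-1}\subseteq M_0$. A morphism $(M_{-1}\subseteq M_0)\to(N_{-1}\subseteq N_0)$ is a $K$-linear map $f:M_0\to N_0$ with $f(M_{-1})\subseteq N_{-1}$ and $f(xm)=xf(m)$ for all $x\in K[G]$, $m\in M_{-1}$ (the ambient module $\Omega$ does not affect the isomorphism type). A subglider is given by subspaces $N_{-1}\subseteq M_{-1}$, $N_0\subseteq M_0$ with $N_{-1}\subseteq N_0$ and $K[G]N_{-1}\subseteq N_0$. A glider of length $1$ is irreducible if every proper subglider has strictly smaller length, i.e. has $N_{-1}=0$; equivalently, $\dim_K M_{-1}=1$ and $M_0=K[G]M_{-1}$. $\mathrm{Irr}(G)$ is the set of isomorphism classes of irreducible $K[G]$-modules. For $U\in\mathrm{Irr}(G)$ put $\mathrm{Gr}(U)=\bigsqcup_{j=1}^{\dim U}\mathrm{Gr}(j,U)$, where $\mathrm{Gr}(j,U)$ is the Grassmannian of $j$-dimensional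 subspaces of $U$. $\mathcal{S}_G$ is the set of all subsets $B\subseteq\bigsqcup_{U\in\mathrm{Irr}(G),\ \dim U>1}\mathrm{Gr}(U)$ such that for every $U$ the intersection $B\cap \mathrm{Gr}(j,U)$ is non-empty for at most one $1\le j\le\dim U$, and for this $j$ it is a singleton.
   Formalization: For abelian G the claim fails (G = 1: one irreducible glider, but two pairs), as M_{-1} ≠ 0 excludes the pair (∅,∅); the theorem gives a bijection onto all pairs except (∅,∅) for every finite G, and onto all pairs when G is non-abelian. *)

theory Defs
  imports "Jordan_Normal_Form.VS_Connect" "HOL-Algebra.Generated_Groups"
begin

section \<open>The group algebra and its left modules\<close>

text \<open>Elements of \<open>K[G]\<close> are coefficient functions vanishing outside the carrier of \<open>G\<close>;
  only finite \<open>G\<close> is intended.\<close>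

definition group_algebra :: "('g, 'm) monoid_scheme \<Rightarrow> ('g \<Rightarrow> 'k::field) ring"
  where "group_algebra G =
    \<lparr>carrier = {a. \<forall>g. g \<notin> carrier G \<longrightarrow> a g = 0},
     mult = (\<lambda>a b g. if g \<in> carrier G
        then (\<Sum>h\<in>carrier G. a h * b (inv\<^bsub>G\<^esub> h \<otimes>\<^bsub>G\<^esub> g)) else 0),
     one = (\<lambda>g. if g = \<one>\<^bsub>G\<^esub> then 1 else 0),
     zero = (\<lambda>g. 0),
     add = (\<lambda>a b g. a g + b g)\<rparr>"

definition scalar :: "('g, 'm) monoid_scheme \<Rightarrow> 'k::field \<Rightarrow> 'g \<Rightarrow> 'k"
  where "scalar G c = (\<lambda>g. if g = \<one>\<^bsub>G\<^esub> then c else 0)"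

text \<open>The locale \<open>module\<close> of HOL-Algebra, with the same axioms, but without commutativity of
  the ring.\<close>

locale left_module = R?: ring R + M?: abelian_group M
  for R :: "('a, 'r) ring_scheme" (structure) and M :: "('a, 'v, 'n) module_scheme" (structure) +
  assumes smult_closed: "\<lbrakk>a \<in> carrier R; x \<in> carrier M\<rbrakk> \<Longrightarrow> a \<odot>\<^bsub>M\<^esub> x \<in> carrier M"
    and smult_l_distr: "\<lbrakk>a \<in> carrier R; b \<in> carrier R; x \<in> carrier M\<rbrakk> \<Longrightarrow>
      (a \<oplus>\<^bsub>R\<^esub> b) \<odot>\<^bsub>M\<^esub> x = a \<odot>\<^bsub>M\<^esub> x \<oplus>\<^bsub>M\<^esub> b \<odot>\<^bsub>M\<^esub> x"
    and smult_r_distr: "\<lbrakk>a \<in> carrier R; x \<in> carrier M; y \<in> carrier M\<rbrakk> \<Longrightarrow>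
      a \<odot>\<^bsub>M\<^esub> (x \<oplus>\<^bsub>M\<^esub> y) = a \<odot>\<^bsub>M\<^esub> x \<oplus>\<^bsub>M\<^esub> a \<odot>\<^bsub>M\<^esub> y"
    and smult_assoc: "\<lbrakk>a \<in> carrier R; b \<in> carrier R; x \<in> carrier M\<rbrakk> \<Longrightarrow>
      (a \<otimes>\<^bsub>R\<^esub> b) \<odot>\<^bsub>M\<^esub> x = a \<odot>\<^bsub>M\<^esub> (b \<odot>\<^bsub>M\<^esub> x)"
    and smult_one: "x \<in> carrier M \<Longrightarrow> \<one>\<^bsub>R\<^esub> \<odot>\<^bsub>M\<^esub> x = x"

type_synonym ('g, 'k, 'v) ga_module = "('g \<Rightarrow> 'k, 'v) module"

text \<open>The \<open>K\<close>-vector space underlying a \<open>K[G]\<close>-module (restriction of scalars along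
  \<open>K \<rightarrow> K[G]\<close>). The fields \<open>mult\<close> and \<open>one\<close> of a module record carry no information.\<close>

definition K_space :: "('g, 'm) monoid_scheme \<Rightarrow> ('g, 'k::field, 'v) ga_module \<Rightarrow> ('k, 'v) module"
  where "K_space G M =
    \<lparr>carrier = carrier M, mult = mult M, one = one M, zero = zero M, add = add M,
     smult = (\<lambda>c v. scalar G c \<odot>\<^bsub>M\<^esub> v)\<rparr>"

abbreviation K_subspace ::
    "('g, 'm) monoid_scheme \<Rightarrow> ('g, 'k::field, 'v) ga_module \<Rightarrow> 'v set \<Rightarrow> bool"
  where "K_subspace G M W \<equiv> VectorSpace.subspace class_ring W (K_space G M)"

abbreviation K_subspace_space ::
    "('g, 'm) monoid_scheme \<Rightarrow> ('g, 'k::field, 'v) ga_module \<Rightarrow> 'v set \<Rightarrow> ('k, 'v) module"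
  where "K_subspace_space G M W \<equiv> (K_space G M)\<lparr>carrier := W\<rparr>"

definition K_fin_dim ::
    "('g, 'm) monoid_scheme \<Rightarrow> ('g, 'k::field, 'v) ga_module \<Rightarrow> 'v set \<Rightarrow> bool"
  where "K_fin_dim G M W \<longleftrightarrow> vectorspace.fin_dim class_ring (K_subspace_space G M W)"

definition K_dim ::
    "('g, 'm) monoid_scheme \<Rightarrow> ('g, 'k::field, 'v) ga_module \<Rightarrow> 'v set \<Rightarrow> nat"
  where "K_dim G M W = vectorspace.dim class_ring (K_subspace_space G M W)"

section \<open>Gliders of length one\<close>

text \<open>All modules have their carrier inside one type \<open>'v\<close>, over which the isomorphism classes below
  are formed. As \<open>K\<close> is infinite, a finite-dimensional \<open>K\<close>-space has at most as many elements as
  \<open>K\<close>; so an injection from \<open>K\<close> into \<open>'v\<close> suffices for every finite-dimensional module, and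
  every glider up to isomorphism, to occur in \<open>'v\<close>.\<close>

record ('g, 'k, 'v) glider =
  ambient :: "('g, 'k, 'v) ga_module"
  lower :: "'v set"  \<comment> \<open>\<open>M\<^sub>-\<^sub>1\<close>\<close>
  upper :: "'v set"  \<comment> \<open>\<open>M\<^sub>0\<close>\<close>

definition glider_chain ::
    "('g, 'm) monoid_scheme \<Rightarrow> ('g, 'k::field, 'v) ga_module \<Rightarrow> 'v set \<Rightarrow> 'v set \<Rightarrow> bool"
  where "glider_chain G M N1 N0 \<longleftrightarrow>
    K_subspace G M N1 \<and> K_subspace G M N0 \<and> N1 \<subseteq> N0 \<and>
    (\<forall>x\<in>carrier (group_algebra G). \<forall>n\<in>N1. x \<odot>\<^bsub>M\<^esub> n \<in> N0)"

definition is_glider :: "('g, 'm) monoid_scheme \<Rightarrow> ('g, 'k::field, 'v) glider \<Rightarrow> bool"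
  where "is_glider G X \<longleftrightarrow>
    left_module (group_algebra G) (ambient X) \<and>
    glider_chain G (ambient X) (lower X) (upper X) \<and>
    K_fin_dim G (ambient X) (lower X) \<and> K_fin_dim G (ambient X) (upper X) \<and>
    lower X \<noteq> {\<zero>\<^bsub>ambient X\<^esub>}"

definition subglider ::
    "('g, 'm) monoid_scheme \<Rightarrow> 'v set \<Rightarrow> 'v set \<Rightarrow> ('g, 'k::field, 'v) glider \<Rightarrow> bool"
  where "subglider G N1 N0 X \<longleftrightarrow>
    glider_chain G (ambient X) N1 N0 \<and> N1 \<subseteq> lower X \<and> N0 \<subseteq> upper X"

text \<open>In length one, a subglider of strictly smaller length is one whose lower term is zero.\<close>

definition irreducible_glider :: "('g, 'm) monoid_scheme \<Rightarrow> ('g, 'k::field, 'v) glider \<Rightarrow> bool"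
  where "irreducible_glider G X \<longleftrightarrow>
    is_glider G X \<and>
    (\<forall>N1 N0. subglider G N1 N0 X \<and> (N1, N0) \<noteq> (lower X, upper X) \<longrightarrow>
       N1 = {\<zero>\<^bsub>ambient X\<^esub>})"

definition glider_hom ::
    "('g, 'm) monoid_scheme \<Rightarrow> ('g, 'k::field, 'v) glider \<Rightarrow> ('g, 'k, 'v) glider \<Rightarrow> ('v \<Rightarrow> 'v) set"
  where "glider_hom G X Y =
    {f \<in> LinearCombinations.module_hom class_ring (K_subspace_space G (ambient X) (upper X))
                                (K_subspace_space G (ambient Y) (upper Y)).
       f ` lower X \<subseteq> lower Y \<and>
       (\<forall>x\<in>carrier (group_algebra G). \<forall>m\<in>lower X.
          f (x \<odot>\<^bsub>ambient X\<^esub> m) = x \<odot>\<^bsub>ambient Y\<^esub> f m)}"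

definition glider_iso ::
    "('g, 'm) monoid_scheme \<Rightarrow> ('g, 'k::field, 'v) glider \<Rightarrow> ('g, 'k, 'v) glider \<Rightarrow> bool"
  where "glider_iso G X Y \<longleftrightarrow>
    (\<exists>f\<in>glider_hom G X Y. \<exists>h\<in>glider_hom G Y X.
       (\<forall>m\<in>upper X. h (f m) = m) \<and> (\<forall>n\<in>upper Y. f (h n) = n))"

definition irreducible_glider_classes ::
    "('g, 'm) monoid_scheme \<Rightarrow> ('g, 'k::field, 'v) glider set set"
  where "irreducible_glider_classes G =
    {X. irreducible_glider G X} //
    {(X, Y). irreducible_glider G X \<and> irreducible_glider G Y \<and> glider_iso G X Y}"

section \<open>Irreducible modules and Grassmannians\<close>

definition irreducible_module :: "('g, 'm) monoid_scheme \<Rightarrow> ('g, 'k::field, 'v) ga_module \<Rightarrow> bool"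
  where "irreducible_module G U \<longleftrightarrow>
    left_module (group_algebra G) U \<and> carrier U \<noteq> {\<zero>\<^bsub>U\<^esub>} \<and>
    (\<forall>H. Module.submodule H (group_algebra G) U \<longrightarrow> H = {\<zero>\<^bsub>U\<^esub>} \<or> H = carrier U)"

definition module_iso ::
    "('g, 'm) monoid_scheme \<Rightarrow> ('g, 'k::field, 'v) ga_module \<Rightarrow> ('g, 'k, 'v) ga_module \<Rightarrow> bool"
  where "module_iso G U V \<longleftrightarrow>
    (\<exists>f\<in>LinearCombinations.module_hom (group_algebra G) U V. bij_betw f (carrier U) (carrier V))"

definition Irr :: "('g, 'm) monoid_scheme \<Rightarrow> ('g, 'k::field, 'v) ga_module set set"
  where "Irr G = {U. irreducible_module G U} //
    {(U, V). irreducible_module G U \<and> irreducible_module G V \<and> module_iso G U V}"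

text \<open>Dimension and Grassmannian of an isomorphism class are taken on a chosen representative.\<close>

definition irr_rep :: "('g, 'k::field, 'v) ga_module set \<Rightarrow> ('g, 'k, 'v) ga_module"
  where "irr_rep C = (SOME U. U \<in> C)"

definition irr_dim :: "('g, 'm) monoid_scheme \<Rightarrow> ('g, 'k::field, 'v) ga_module set \<Rightarrow> nat"
  where "irr_dim G C = K_dim G (irr_rep C) (carrier (irr_rep C))"

definition Gr_dim ::
    "('g, 'm) monoid_scheme \<Rightarrow> nat \<Rightarrow> ('g, 'k::field, 'v) ga_module set \<Rightarrow> 'v set set"
  where "Gr_dim G j C = {W. K_subspace G (irr_rep C) W \<and> K_dim G (irr_rep C) W = j}"

text \<open>The union over \<open>j\<close> is disjoint as it stands, subspaces of different dimension being different.\<close>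

definition Gr :: "('g, 'm) monoid_scheme \<Rightarrow> ('g, 'k::field, 'v) ga_module set \<Rightarrow> 'v set set"
  where "Gr G C = (\<Union>j\<in>{1..irr_dim G C}. Gr_dim G j C)"

text \<open>The disjoint union over \<open>U\<close> is rendered by tagging a subspace with its class; the image of
  \<open>Pair C\<close> embeds \<open>Gr(j, U)\<close> into it.\<close>

definition S_G ::
    "('g, 'm) monoid_scheme \<Rightarrow> (('g, 'k::field, 'v) ga_module set \<times> 'v set) set set"
  where "S_G G =
    {B. B \<subseteq> (SIGMA C:{C \<in> Irr G. irr_dim G C > 1}. Gr G C) \<and>
       (\<forall>C\<in>Irr G. irr_dim G C > 1 \<longrightarrow>
          (\<forall>i\<in>{1..irr_dim G C}. \<forall>j\<in>{1..irr_dim G C}.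
             B \<inter> Pair C ` Gr_dim G i C \<noteq> {} \<and> B \<inter> Pair C ` Gr_dim G j C \<noteq> {} \<longrightarrow> i = j) \<and>
          (\<forall>j\<in>{1..irr_dim G C}.
             B \<inter> Pair C ` Gr_dim G j C \<noteq> {} \<longrightarrow> is_singleton (B \<inter> Pair C ` Gr_dim G j C)))}"

end

theory Submission
  imports Defs "Jordan_Normal_Form.DL_Rank" "HOL-Library.Function_Algebras" "HOL-Library.Equipollence"
begin

text \<open>
  An irreducible glider is generated by one vector: \<open>M\<^sub>-\<^sub>1 = K m\<close> and \<open>M\<^sub>0 = K[G] m\<close>
  (\<open>irreducible_glider_iff\<close>). An isomorphism sends \<open>m\<close> to a nonzero multiple of the other
  generator, so the class of the glider is the same thing as the left ideal
  \<open>I = {x. x m = 0} \<noteq> K[G]\<close> (\<open>glider_iso_iff\<close>). Every proper left ideal occurs: by Maschke's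
  theorem \<open>I\<close> has a right identity \<open>e\<close>, and \<open>I\<close> is the annihilator of \<open>1 - e\<close> in the regular
  module (\<open>glider_ann_surj\<close>).

  Left ideals are classified by the vectors that they kill. For an irreducible module \<open>U\<close> put
  \<open>W\<^sub>U = {u \<in> U. I u = 0}\<close>. The ideal is recovered from the family \<open>W\<close> as the set of all \<open>x\<close> killing
  every \<open>W\<^sub>U\<close>, because for \<open>x \<notin> I\<close> some irreducible module contains a vector that \<open>I\<close> kills and \<open>x\<close>
  does not (\<open>minimal_left_ideal_separates\<close>, a consequence of semisimplicity). Conversely every
  family of subspaces arises, by the density theorem: a vector killed by everything that kills the
  given subspaces already lies in the given subspace of its module (\<open>density\<close>). The density theorem
  rests on Schur's lemma, hence on \<open>K\<close> being algebraically closed.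

  So the gliders are the families \<open>(W\<^sub>U)\<close> in which not all subspaces vanish. If \<open>dim U = 1\<close>, then
  \<open>W\<^sub>U\<close> is \<open>0\<close> or \<open>U\<close>, and these choices form a subset of the set of linear characters of \<open>G\<close>.
  If \<open>dim U > 1\<close>, a nonzero \<open>W\<^sub>U\<close> is a point of \<open>Gr(U)\<close>, and these points form an element of
  \<open>S_G\<close>. There are \<open>|G/G'|\<close> linear characters (\<open>card_characters\<close>: sum all values of all
  characters in two ways). The family of zero subspaces belongs to \<open>I = K[G]\<close> and gives no glider,
  whence the missing pair \<open>({}, {})\<close>. For non-commutative \<open>G\<close> there is an irreducible module of
  dimension greater than one, its lines already make \<open>S_G\<close> infinite (\<open>infinite_S_G\<close>), and removing
  one element from an infinite set does not change its cardinality.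
\<close>

section \<open>The group algebra and its left ideals\<close>

text \<open>Elements of the group algebra are functions; applying the pointwise operations eagerly would
  eta-expand them during simplification.\<close>

declare plus_fun_apply [simp del] zero_fun_apply [simp del] minus_apply [simp del] uminus_apply [simp del]

lemmas fun_apply = plus_fun_apply zero_fun_apply minus_apply uminus_apply

locale finite_group = group G for G :: "('g, 'm) monoid_scheme" (structure) +
  assumes finite_carrier: "finite (carrier G)"
begin

definition alg :: "('g \<Rightarrow> 'k::field) set"
  where "alg = {a. \<forall>g. g \<notin> carrier G \<longrightarrow> a g = 0}"

definition conv :: "('g \<Rightarrow> 'k::field) \<Rightarrow> ('g \<Rightarrow> 'k) \<Rightarrow> 'g \<Rightarrow> 'k" (infixl "\<star>" 70)
  where "x \<star> y = (\<lambda>g. if g \<in> carrier G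
            then (\<Sum>h\<in>carrier G. x h * y (inv h \<otimes> g)) else 0)"

text \<open>The group element \<open>g\<close>, seen in \<open>K[G]\<close>, is \<open>single 1 g\<close>.\<close>

definition single :: "'k::field \<Rightarrow> 'g \<Rightarrow> 'g \<Rightarrow> 'k"
  where "single c g = (\<lambda>h. if h = g then c else 0)"

lemma group_algebra_sel [simp]:
  "carrier (group_algebra G) = alg"
  "mult (group_algebra G) = (\<star>)"
  "one (group_algebra G) = single 1 \<one>"
  "zero (group_algebra G) = 0"
  "add (group_algebra G) = (+)"
  by (simp_all add: group_algebra_def alg_def conv_def single_def fun_eq_iff fun_apply)

lemma scalar_eq_single: "scalar G c = single c \<one>"
  by (simp add: scalar_def single_def)

lemma alg_zero [simp, intro]: "0 \<in> alg"
  and alg_add [simp, intro]: "x \<in> alg \<Longrightarrow> y \<in> alg \<Longrightarrow> x + y \<in> alg"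
  and alg_diff [simp, intro]: "x \<in> alg \<Longrightarrow> y \<in> alg \<Longrightarrow> x - y \<in> alg"
  and alg_uminus [simp, intro]: "x \<in> alg \<Longrightarrow> - x \<in> alg"
  and alg_conv [simp, intro]: "x \<star> y \<in> alg"
  and alg_single [simp, intro]: "g \<in> carrier G \<Longrightarrow> single c g \<in> alg"
  and alg_scalar [simp, intro]: "scalar G c \<in> alg"
  by (auto simp: alg_def fun_apply conv_def single_def scalar_def)

lemma sum_fun_apply: "(sum f I) g = (\<Sum>i\<in>I. f i g)" for f :: "'i \<Rightarrow> 'x \<Rightarrow> 'k::field"
  by (induction I rule: infinite_finite_induct) (auto simp: fun_apply)

lemma alg_sum: "(\<And>i. i \<in> I \<Longrightarrow> f i \<in> alg) \<Longrightarrow> sum f I \<in> alg"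
  by (simp add: alg_def fun_apply sum_fun_apply)

lemma alg_eq_sum_single: "x = (\<Sum>g\<in>carrier G. single (x g) g)" if "x \<in> alg"
  using that finite_carrier by (auto simp: fun_eq_iff fun_apply sum_fun_apply single_def alg_def fun_apply)

text \<open>Every additive property of the group algebra can be checked on monomials.\<close>

lemma alg_induct [consumes 1, case_names zero add single]:
  assumes "x \<in> alg" and "P 0"
    and "\<And>y z. y \<in> alg \<Longrightarrow> z \<in> alg \<Longrightarrow> P y \<Longrightarrow> P z \<Longrightarrow> P (y + z)"
    and "\<And>c g. g \<in> carrier G \<Longrightarrow> P (single c g)"
  shows "P x"
proof -
  have "P (\<Sum>g\<in>I. single (x g) g)" if "finite I" "I \<subseteq> carrier G" for I
    using that
  proof induction
    case empty
    show ?case using assms(2) by (simp add: zero_fun_def)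
  next
    case (insert g I)
    then have "P (\<Sum>g\<in>I. single (x g) g)" and sub: "g \<in> carrier G" "I \<subseteq> carrier G" by auto
    moreover have "(\<Sum>g\<in>I. single (x g) g) \<in> alg" using sub by (intro alg_sum alg_single) blast
    ultimately have "P (single (x g) g + (\<Sum>g\<in>I. single (x g) g))"
      using assms(3,4) alg_single by meson
    then show ?case by (simp only: sum.insert[OF insert.hyps])
  qed
  from this[OF finite_carrier] alg_eq_sum_single[OF assms(1)] show ?thesis by simp
qed

lemma conv_add_left: "(x + y) \<star> z = x \<star> z + y \<star> z"
  and conv_add_right: "x \<star> (y + z) = x \<star> y + x \<star> z"
  and conv_zero_left [simp]: "0 \<star> z = 0"
  and conv_zero_right [simp]: "z \<star> 0 = 0"
  by (auto simp: conv_def fun_eq_iff fun_apply algebra_simps sum.distrib)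

lemma conv_diff_left: "(x - y) \<star> z = x \<star> z - y \<star> z"
  and conv_diff_right: "x \<star> (y - z) = x \<star> y - x \<star> z"
  by (auto simp: conv_def fun_eq_iff fun_apply algebra_simps sum_subtractf)

lemma conv_sum_right: "x \<star> (sum f I) = (\<Sum>i\<in>I. x \<star> f i)"
  by (induction I rule: infinite_finite_induct) (auto simp: conv_add_right)

lemma conv_single_left:
  "g \<in> carrier G \<Longrightarrow> single c g \<star> x = (\<lambda>k. if k \<in> carrier G then c * x (inv g \<otimes> k) else 0)"
  using finite_carrier
  by (auto simp: conv_def single_def fun_eq_iff fun_apply if_distribR if_distrib[of "\<lambda>a. a * _"] cong: if_cong)

lemma single_conv_single:
  assumes "g \<in> carrier G" "h \<in> carrier G"
  shows "single c g \<star> single d h = single (c * d) (g \<otimes> h)"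
proof -
  have "inv g \<otimes> k = h \<longleftrightarrow> k = g \<otimes> h" if "k \<in> carrier G" for k
    using assms that by (metis inv_solve_left' inv_closed)
  then show ?thesis
    using assms by (simp only: conv_single_left) (auto simp: single_def fun_eq_iff fun_apply)
qed

lemma conv_assoc_single:
  assumes "g \<in> carrier G"
  shows "(single c g \<star> x) \<star> y = single c g \<star> (x \<star> y)"
proof
  fix k
  show "((single c g \<star> x) \<star> y) k = (single c g \<star> (x \<star> y)) k"
  proof (cases "k \<in> carrier G")
    case k: True
    have "((single c g \<star> x) \<star> y) k = (\<Sum>h\<in>carrier G. c * x (inv g \<otimes> h) * y (inv h \<otimes> k))"
      using k assms by (simp add: conv_single_left) (simp add: conv_def)
    also have "\<dots> = (\<Sum>h\<in>carrier G. c * x h * y (inv (g \<otimes> h) \<otimes> k))"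
      by (rule sum.reindex_bij_witness[of _ "\<lambda>h. g \<otimes> h" "\<lambda>h. inv g \<otimes> h"])
         (use assms in \<open>auto simp flip: m_assoc\<close>)
    also have "\<dots> = c * (\<Sum>h\<in>carrier G. x h * y (inv h \<otimes> (inv g \<otimes> k)))"
      using k assms by (simp add: sum_distrib_left inv_mult_group m_assoc mult.assoc)
    also have "\<dots> = (single c g \<star> (x \<star> y)) k"
      using k assms by (simp add: conv_single_left) (simp add: conv_def)
    finally show ?thesis .
  qed (simp add: conv_def)
qed

lemma conv_assoc: "x \<in> alg \<Longrightarrow> (x \<star> y) \<star> z = x \<star> (y \<star> z)"
  by (erule alg_induct) (simp_all add: conv_add_left conv_assoc_single)

lemma conv_one_left [simp]: "x \<in> alg \<Longrightarrow> single 1 \<one> \<star> x = x"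
  by (auto simp: conv_single_left fun_eq_iff fun_apply alg_def fun_apply)

lemma conv_one_right [simp]: "x \<in> alg \<Longrightarrow> x \<star> single 1 \<one> = x"
  by (erule alg_induct) (simp_all add: conv_add_left single_conv_single)

lemma scalar_conv: "x \<in> alg \<Longrightarrow> scalar G c \<star> x = (\<lambda>g. c * x g)"
  by (auto simp: conv_single_left fun_eq_iff fun_apply alg_def fun_apply scalar_eq_single)

lemma scalar_conv_scalar: "scalar G c \<star> scalar G d = scalar G (c * d)"
  by (simp add: scalar_eq_single single_conv_single)

lemma scalar_add: "scalar G (c + d) = scalar G c + scalar G d"
  and scalar_zero [simp]: "scalar G 0 = 0"
  and scalar_one: "scalar G 1 = single 1 \<one>"
  by (auto simp: scalar_def fun_eq_iff fun_apply single_def)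

lemma scalar_central: "x \<in> alg \<Longrightarrow> scalar G c \<star> x = x \<star> scalar G c"
  unfolding scalar_eq_single
proof (erule alg_induct)
  fix d g assume g: "g \<in> carrier G"
  show "single c \<one> \<star> single d g = single d g \<star> single c \<one>"
    using g by (simp add: single_conv_single mult.commute[of c])
qed (simp_all only: conv_add_left conv_add_right conv_zero_left conv_zero_right)

lemma single_eq_scalar: "g \<in> carrier G \<Longrightarrow> single c g = scalar G c \<star> single 1 g"
  by (simp add: scalar_eq_single single_conv_single)

lemma ring_group_algebra: "ring (group_algebra G :: ('g \<Rightarrow> 'k::field) ring)"
proof (rule ringI)
  show "abelian_group (group_algebra G :: ('g \<Rightarrow> 'k) ring)"
  proof (rule abelian_groupI)
    fix x :: "'g \<Rightarrow> 'k" assume "x \<in> carrier (group_algebra G)"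
    then show "\<exists>y\<in>carrier (group_algebra G). y \<oplus>\<^bsub>group_algebra G\<^esub> x = \<zero>\<^bsub>group_algebra G\<^esub>"
      by (intro bexI[of _ "- x"]) simp_all
  qed (simp_all add: ac_simps)
  show "monoid (group_algebra G :: ('g \<Rightarrow> 'k) ring)"
    by (rule monoidI) (simp_all add: conv_assoc)
qed (simp_all add: conv_add_left conv_add_right)

text \<open>The pointwise vector space structure on all functions gives access to bases, projections and
  dimension bounds for subspaces of \<open>K[G]\<close>.\<close>

sublocale fs: vector_space "\<lambda>c (x :: 'g \<Rightarrow> 'k::field) g. c * x g"
  by unfold_locales (auto simp: fun_eq_iff fun_apply algebra_simps)

definition left_ideal :: "('g \<Rightarrow> 'k::field) set \<Rightarrow> bool"
  where "left_ideal I \<longleftrightarrow> I \<subseteq> alg \<and> 0 \<in> I \<and> (\<forall>x\<in>I. \<forall>y\<in>I. x + y \<in> I) \<and> (\<forall>x\<in>alg. \<forall>y\<in>I. x \<star> y \<in> I)"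

lemma left_idealD:
  assumes "left_ideal I"
  shows "x \<in> I \<Longrightarrow> x \<in> alg" "0 \<in> I" "x \<in> I \<Longrightarrow> y \<in> I \<Longrightarrow> x + y \<in> I" "a \<in> alg \<Longrightarrow> y \<in> I \<Longrightarrow> a \<star> y \<in> I"
  using assms by (auto simp: left_ideal_def)

lemma left_ideal_scale: "left_ideal I \<Longrightarrow> x \<in> I \<Longrightarrow> (\<lambda>g. c * x g) \<in> I"
  using left_idealD(4)[of I "scalar G c" x] left_idealD(1)[of I x] by (simp add: scalar_conv)

lemma left_ideal_diff:
  assumes "left_ideal I" "x \<in> I" "y \<in> I"
  shows "x - y \<in> I"
proof -
  have "x + (\<lambda>g. (-1) * y g) \<in> I" using assms by (intro left_idealD(3) left_ideal_scale)
  moreover have "x + (\<lambda>g. (-1) * y g) = x - y" by (auto simp: fun_eq_iff fun_apply)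
  ultimately show ?thesis by simp
qed

lemma left_ideal_sum: "left_ideal I \<Longrightarrow> (\<forall>i\<in>A. f i \<in> I) \<Longrightarrow> sum f A \<in> I"
proof (induction A rule: infinite_finite_induct)
  case (insert a A)
  then have "f a + sum f A \<in> I" by (intro left_idealD(3)) auto
  then show ?case using insert.hyps by (simp)
qed (simp_all add: left_idealD(2))

lemma left_ideal_imp_subspace: "left_ideal I \<Longrightarrow> fs.subspace I"
  by (auto simp: fs.subspace_def left_idealD left_ideal_scale)

lemma left_ideal_alg: "left_ideal alg"
  by (auto simp: left_ideal_def)

lemma left_ideal_INT: "(\<And>i. i \<in> A \<Longrightarrow> left_ideal (I i)) \<Longrightarrow> left_ideal (alg \<inter> (\<Inter>i\<in>A. I i))"
  by (auto simp: left_ideal_def)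

lemma alg_subset_span: "alg \<subseteq> fs.span (single 1 ` carrier G :: ('g \<Rightarrow> 'k::field) set)"
proof
  fix x :: "'g \<Rightarrow> 'k" assume "x \<in> alg"
  then show "x \<in> fs.span (single 1 ` carrier G)"
  proof (rule alg_induct)
    fix c :: 'k and g assume "g \<in> carrier G"
    then have "(\<lambda>h. c * single 1 g h) \<in> fs.span (single 1 ` carrier G)"
      by (intro fs.span_scale fs.span_base) auto
    moreover have "(\<lambda>h. c * single 1 g h) = single c g" by (auto simp: single_def)
    ultimately show "single c g \<in> fs.span (single 1 ` carrier G)" by simp
  qed (auto simp: intro: fs.span_add fs.span_zero)
qed

lemma independent_in_alg:
  fixes S :: "('g \<Rightarrow> 'k::field) set"
  assumes "fs.independent S" "S \<subseteq> alg"
  shows "finite S" "card S \<le> card (carrier G)"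
proof -
  have *: "finite S \<and> card S \<le> card (single 1 ` carrier G :: ('g \<Rightarrow> 'k) set)"
    using assms alg_subset_span finite_carrier by (intro fs.independent_span_bound) auto
  then show "finite S" by simp
  show "card S \<le> card (carrier G)" using * card_image_le[OF finite_carrier, of "single 1 :: 'g \<Rightarrow> 'g \<Rightarrow> 'k"] by linarith
qed

end

context finite_group
begin

lemma conv_scale_right: "x \<star> (\<lambda>g. c * y g) = (\<lambda>g. c * (x \<star> y) g)"
  by (auto simp: conv_def fun_eq_iff sum_distrib_left mult_ac)

lemma alg_scale [simp, intro]: "x \<in> alg \<Longrightarrow> (\<lambda>g. c * x g) \<in> alg"
  by (auto simp: alg_def)

section \<open>Maschke's theorem for left ideals\<close>

text \<open>Maschke's theorem. Averaging a linear projection onto \<open>J\<close> over \<open>G\<close> gives a projection that is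
  left \<open>K[G]\<close>-linear, and such a map is right multiplication by the image of \<open>1\<close>. Stating the
  splitting as a right identity \<open>e\<close> of \<open>J\<close> makes the complement explicit: it is the left ideal
  generated by \<open>1 - e\<close>.\<close>

lemma left_ideal_right_identity:
  fixes J :: "('g \<Rightarrow> 'k::field_char_0) set"
  assumes J: "left_ideal J"
  obtains e where "e \<in> J" "\<And>x. x \<in> J \<Longrightarrow> x \<star> e = x"
proof -
  let ?sc = "\<lambda>c (x :: 'g \<Rightarrow> 'k) g. c * x g"
  interpret vp: vector_space_pair ?sc ?sc
    by unfold_locales
  have "\<exists>p. p ` UNIV \<subseteq> J \<and> Vector_Spaces.linear ?sc ?sc p \<and> (\<forall>v\<in>J. p (id v) = v)"
    using left_ideal_imp_subspace[OF J] by (intro vp.linear_exists_left_inverse_on fs.linear_id) auto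
  then obtain p where p: "\<And>x. p x \<in> J" "Vector_Spaces.linear ?sc ?sc p" "\<And>v. v \<in> J \<Longrightarrow> p v = v"
    by auto
  interpret p: Vector_Spaces.linear ?sc ?sc p by fact
  define n where "n = (of_nat (card (carrier G)) :: 'k)"
  have n: "n \<noteq> 0"
    using finite_carrier by (auto simp: n_def)
  define P where "P x = (\<Sum>k\<in>carrier G. single 1 k \<star> p (single 1 (inv k) \<star> x))" for x
  have P_J: "P x \<in> J" for x
    unfolding P_def using J p(1) by (intro left_ideal_sum) (auto intro: left_idealD)
  have P_id: "P x = (\<lambda>g. n * x g)" if "x \<in> J" for x
  proof -
    have "single 1 k \<star> p (single 1 (inv k) \<star> x) = x" if k: "k \<in> carrier G" for k
    proof -
      have "x \<in> alg" and "single 1 (inv k) \<star> x \<in> J"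
        using J \<open>x \<in> J\<close> k by (auto intro: left_idealD)
      then show ?thesis
        using k by (simp add: p(3) single_conv_single flip: conv_assoc)
    qed
    then show ?thesis
      by (simp add: P_def fun_eq_iff n_def sum_fun_apply)
  qed
  \<comment> \<open>The averaged projection is left linear, hence right multiplication by its value at the identity.\<close>
  have P_conv: "P x = x \<star> P (single 1 \<one>)" if "x \<in> alg" for x
    using that
  proof (rule alg_induct)
    show "P 0 = 0 \<star> P (single 1 \<one>)"
      by (simp add: P_def p.zero)
    show "P (y + z) = (y + z) \<star> P (single 1 \<one>)"
      if "P y = y \<star> P (single 1 \<one>)" "P z = z \<star> P (single 1 \<one>)" for y z
    proof -
      have "P (y + z) = P y + P z"
        by (simp add: P_def p.add conv_add_right sum.distrib)
      then show ?thesis by (simp add: that conv_add_left)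
    qed
    fix c h assume h: "h \<in> carrier G"
    have "P (single c h) = (\<Sum>g\<in>carrier G. single 1 (h \<otimes> g) \<star> p (single 1 (inv (h \<otimes> g)) \<star> single c h))"
      unfolding P_def
      by (rule sum.reindex_bij_witness[of _ "\<lambda>g. h \<otimes> g" "\<lambda>k. inv h \<otimes> k"])
         (use h in \<open>auto simp flip: m_assoc\<close>)
    also have "\<dots> = (\<Sum>g\<in>carrier G. single c h \<star> (single 1 g \<star> p (single 1 (inv g) \<star> single 1 \<one>)))"
    proof (rule sum.cong)
      fix g assume g: "g \<in> carrier G"
      have "inv (h \<otimes> g) \<otimes> h = inv g"
        using g h by (simp add: inv_mult_group m_assoc)
      then have "single 1 (inv (h \<otimes> g)) \<star> single c h = (\<lambda>k. c * single 1 (inv g) k)"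
        using g h by (simp add: single_conv_single) (auto simp: single_def)
      then have "p (single 1 (inv (h \<otimes> g)) \<star> single c h) = (\<lambda>k. c * p (single 1 (inv g)) k)"
        by (simp add: p.scale)
      then have "single 1 (h \<otimes> g) \<star> p (single 1 (inv (h \<otimes> g)) \<star> single c h)
          = (\<lambda>k. c * (single 1 (h \<otimes> g) \<star> p (single 1 (inv g))) k)"
        by (simp add: conv_scale_right)
      also have "\<dots> = single c (h \<otimes> g) \<star> p (single 1 (inv g))"
        using g h by (auto simp: conv_single_left fun_eq_iff)
      also have "\<dots> = single c h \<star> (single 1 g \<star> p (single 1 (inv g)))"
        using g h by (simp add: single_conv_single flip: conv_assoc)
      finally show "single 1 (h \<otimes> g) \<star> p (single 1 (inv (h \<otimes> g)) \<star> single c h)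
          = single c h \<star> (single 1 g \<star> p (single 1 (inv g) \<star> single 1 \<one>))"
        using g by simp
    qed simp
    also have "\<dots> = single c h \<star> P (single 1 \<one>)"
      by (simp add: P_def conv_sum_right)
    finally show "P (single c h) = single c h \<star> P (single 1 \<one>)" .
  qed
  show thesis
  proof
    show "(\<lambda>g. (1 / n) * P (single 1 \<one>) g) \<in> J"
      using left_ideal_scale[OF J P_J] .
    fix x assume x: "x \<in> J"
    then have "x \<in> alg" using J by (auto intro: left_idealD)
    then have "x \<star> P (single 1 \<one>) = (\<lambda>g. n * x g)"
      using P_conv[of x] P_id[OF x] by simp
    then show "x \<star> (\<lambda>g. (1 / n) * P (single 1 \<one>) g) = x"
      using n by (simp only: conv_scale_right) simp
  qed
qed

section \<open>Chain conditions\<close>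

text \<open>The dimension of a left ideal, as the largest size of an independent subset. It serves as a
  bounded, strictly monotone measure.\<close>

definition rank :: "('g \<Rightarrow> 'k::field) set \<Rightarrow> nat"
  where "rank I = Max (card ` {B. B \<subseteq> I \<and> fs.independent B})"

lemma independent_cards_bounded:
  assumes "I \<subseteq> alg"
  shows "card ` {B. B \<subseteq> I \<and> fs.independent B} \<subseteq> {..card (carrier G)}"
  using independent_in_alg assms by blast

lemma rank_le: "I \<subseteq> alg \<Longrightarrow> rank I \<le> card (carrier G)"
proof -
  assume I: "I \<subseteq> alg"
  have "{} \<in> {B. B \<subseteq> I \<and> fs.independent B}" by (simp add: fs.independent_empty)
  then have "rank I \<in> card ` {B. B \<subseteq> I \<and> fs.independent B}"
    unfolding rank_def using finite_subset[OF independent_cards_bounded[OF I]] by (intro Max_in) auto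
  then show ?thesis using independent_cards_bounded[OF I] by blast
qed

lemma rank_strict_mono:
  assumes "left_ideal I" "J \<subseteq> alg" "I \<subset> J"
  shows "rank I < rank J"
proof -
  have I: "I \<subseteq> alg" using assms by auto
  have "{} \<in> {B. B \<subseteq> I \<and> fs.independent B}" by (simp add: fs.independent_empty)
  then have "rank I \<in> card ` {B. B \<subseteq> I \<and> fs.independent B}"
    unfolding rank_def using finite_subset[OF independent_cards_bounded[OF I]] by (intro Max_in) auto
  then obtain B where B: "B \<subseteq> I" "fs.independent B" "rank I = card B" by auto
  obtain x where x: "x \<in> J" "x \<notin> I" using assms by auto
  have "fs.span B \<subseteq> I"
    using B left_ideal_imp_subspace[OF assms(1)] by (intro fs.span_minimal)
  then have "x \<notin> fs.span B" "x \<notin> B" using x B by auto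
  then have "fs.independent (insert x B)" "card (insert x B) = Suc (card B)"
    using B independent_in_alg(1)[of B] I fs.independent_insertI[of x B] by auto
  moreover have "insert x B \<subseteq> J" using B x assms by auto
  ultimately have "Suc (card B) \<in> card ` {B. B \<subseteq> J \<and> fs.independent B}"
    by (intro image_eqI[of _ _ "insert x B"]) auto
  then have "Suc (card B) \<le> rank J"
    unfolding rank_def using finite_subset[OF independent_cards_bounded[OF assms(2)]] by (intro Max_ge) auto
  then show ?thesis using B by simp
qed

text \<open>Descending chain condition: take a finite subfamily whose intersection has least rank. It reduces
  the density theorem to finitely many vectors.\<close>

lemma finite_subfamily:
  fixes I :: "'i \<Rightarrow> ('g \<Rightarrow> 'k::field) set"
  assumes "\<And>s. s \<in> S \<Longrightarrow> left_ideal (I s)"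
  obtains F where "finite F" "F \<subseteq> S" "alg \<inter> (\<Inter>s\<in>F. I s) \<subseteq> (\<Inter>s\<in>S. I s)"
proof -
  define R where "R F = rank (alg \<inter> (\<Inter>s\<in>F. I s))" for F
  obtain F where F: "finite F" "F \<subseteq> S" and min: "\<And>F'. finite F' \<Longrightarrow> F' \<subseteq> S \<Longrightarrow> R F \<le> R F'"
    using ex_has_least_nat[of "\<lambda>F. finite F \<and> F \<subseteq> S" "{}" R] by auto
  have "x \<in> I s" if x: "x \<in> alg \<inter> (\<Inter>s\<in>F. I s)" and s: "s \<in> S" for x s
  proof (rule ccontr)
    assume "x \<notin> I s"
    then have "alg \<inter> (\<Inter>s\<in>insert s F. I s) \<subset> alg \<inter> (\<Inter>s\<in>F. I s)" using x by auto
    moreover have "left_ideal (alg \<inter> (\<Inter>s\<in>insert s F. I s))"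
      using assms s F by (intro left_ideal_INT) auto
    ultimately have "R (insert s F) < R F"
      unfolding R_def by (intro rank_strict_mono) auto
    with min[of "insert s F"] F s show False by auto
  qed
  with F show thesis by (intro that) auto
qed

section \<open>Minimal left ideals separate\<close>

definition minimal_left_ideal :: "('g \<Rightarrow> 'k::field) set \<Rightarrow> bool"
  where "minimal_left_ideal L \<longleftrightarrow> left_ideal L \<and> L \<noteq> {0} \<and>
    (\<forall>L'. left_ideal L' \<and> L' \<subseteq> L \<longrightarrow> L' = {0} \<or> L' = L)"

lemma left_ideal_add:
  fixes I J :: "('g \<Rightarrow> 'b::field) set"
  assumes "left_ideal I" "left_ideal J"
  shows "left_ideal {x + y |x y. x \<in> I \<and> y \<in> J}" (is "left_ideal ?S")
  unfolding left_ideal_def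
proof (intro conjI ballI)
  note I = left_idealD[OF assms(1)] and J = left_idealD[OF assms(2)]
  show "?S \<subseteq> alg" using I J by auto
  show "0 \<in> ?S" using I(2) J(2) by force
  fix s t assume "s \<in> ?S" "t \<in> ?S"
  then obtain x y x' y' where "s = x + y" "x \<in> I" "y \<in> J" "t = x' + y'" "x' \<in> I" "y' \<in> J" by auto
  then have "s + t = (x + x') + (y + y')" "x + x' \<in> I" "y + y' \<in> J"
    using I(3) J(3) by (simp_all add: ac_simps)
  then show "s + t \<in> ?S" by blast
next
  note I = left_idealD[OF assms(1)] and J = left_idealD[OF assms(2)]
  fix a :: "'g \<Rightarrow> 'b" and s assume a: "a \<in> alg" and "s \<in> ?S"
  then obtain x y where "s = x + y" "x \<in> I" "y \<in> J" by auto
  then have "a \<star> s = a \<star> x + a \<star> y" "a \<star> x \<in> I" "a \<star> y \<in> J"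
    using I(4) J(4) a by (simp_all add: conv_add_right)
  then show "a \<star> s \<in> ?S" by blast
qed

lemma left_ideal_principal: "u \<in> alg \<Longrightarrow> left_ideal {y \<star> u |y. y \<in> alg}"
  unfolding left_ideal_def
proof (intro conjI ballI)
  let ?S = "{y \<star> u |y. y \<in> alg}"
  show "?S \<subseteq> alg" by auto
  show "0 \<in> ?S" by (auto intro!: exI[of _ 0])
  show "s + t \<in> ?S" if "s \<in> ?S" "t \<in> ?S" for s t
    using that by (auto simp flip: conv_add_left)
  show "a \<star> s \<in> ?S" if "a \<in> alg" "s \<in> ?S" for a s
    using that by (auto simp flip: conv_assoc)
qed

lemma left_ideal_kernel: "left_ideal L \<Longrightarrow> left_ideal {l \<in> L. l \<star> e = 0}"
  by (auto simp: left_ideal_def conv_add_left conv_assoc subset_iff)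

text \<open>Let \<open>J \<supseteq> I\<close> be maximal among the left ideals that avoid \<open>x\<close>, let \<open>e\<close> be its right identity, and
  let \<open>L\<close> be the complement generated by \<open>u = 1 - e\<close>. Then \<open>y u = y - y e\<close> vanishes exactly for
  \<open>y \<in> J\<close>. The left ideal \<open>L\<close> is minimal: a proper nonzero \<open>L' \<subseteq> L\<close> would have a nonzero complement
  \<open>L''\<close> in \<open>L\<close>, and by maximality \<open>x\<close> would lie in both \<open>J + L'\<close> and \<open>J + L''\<close>, hence in their
  intersection \<open>J\<close>.\<close>

theorem minimal_left_ideal_separates:
  fixes I :: "('g \<Rightarrow> 'k::field_char_0) set"
  assumes I: "left_ideal I" and x: "x \<in> alg" "x \<notin> I"
  obtains L u where "minimal_left_ideal L" "u \<in> L" "\<And>y. y \<in> I \<Longrightarrow> y \<star> u = 0" "x \<star> u \<noteq> 0"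
proof -
  let ?P = "\<lambda>J. left_ideal J \<and> I \<subseteq> J \<and> x \<notin> J"
  have "\<exists>J. ?P J \<and> (\<forall>J'. ?P J' \<longrightarrow> rank J' \<le> rank J)"
  proof (rule ex_has_greatest_nat[where b = "Suc (card (carrier G))"])
    show "?P I" using I x by auto
    show "\<forall>J. ?P J \<longrightarrow> rank J < Suc (card (carrier G))"
      by (simp add: less_Suc_eq_le rank_le left_ideal_def)
  qed
  then obtain J where J: "left_ideal J" "I \<subseteq> J" "x \<notin> J" and max: "\<And>J'. ?P J' \<Longrightarrow> rank J' \<le> rank J"
    by blast
  obtain e where e: "e \<in> J" "\<And>y. y \<in> J \<Longrightarrow> y \<star> e = y"
    using left_ideal_right_identity[OF J(1)] by blast
  have e_alg: "e \<in> alg" using J e by (auto dest: left_idealD(1))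
  define u where "u = single 1 \<one> - e"
  have u_alg: "u \<in> alg" using e_alg by (simp add: u_def)
  define L where "L = {y \<star> u |y. y \<in> alg}"
  have L: "left_ideal L"
    unfolding L_def using u_alg by (rule left_ideal_principal)
  have conv_u: "y \<star> u = y - y \<star> e" if "y \<in> alg" for y
    using that by (simp add: u_def conv_diff_right)
  have u_e: "u \<star> e = 0" using e e_alg by (simp add: u_def conv_diff_left)
  have disj: "l = 0" if l: "l \<in> L" "l \<in> J" for l
  proof -
    obtain y where "y \<in> alg" "l = y \<star> u" using l(1) unfolding L_def by blast
    then have "l \<star> e = 0" using u_e by (simp add: conv_assoc)
    then show ?thesis using e(2)[OF l(2)] by simp
  qed
  \<comment> \<open>By maximality of \<open>J\<close>, every nonzero left ideal inside \<open>L\<close> already produces \<open>x\<close> modulo \<open>J\<close>.\<close>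
  have reach: "\<exists>j\<in>J. \<exists>l\<in>L'. x = j + l" if L': "left_ideal L'" "L' \<subseteq> L" "L' \<noteq> {0}" for L'
  proof (rule ccontr)
    define S where "S = {j + l |j l. j \<in> J \<and> l \<in> L'}"
    assume "\<not> ?thesis"
    then have "x \<notin> S" by (auto simp: S_def)
    have S: "left_ideal S" unfolding S_def using J(1) L'(1) by (rule left_ideal_add)
    have "j \<in> S" if "j \<in> J" for j
      unfolding S_def using that left_idealD(2)[OF L'(1)]
      by (intro CollectI exI[of _ j] exI[of _ 0]) simp
    then have "J \<subseteq> S" by blast
    then have "rank S \<le> rank J" using \<open>x \<notin> S\<close> S J(2) max[of S] by blast
    obtain l where l: "l \<in> L'" "l \<noteq> 0" using L'(3) left_idealD(2)[OF L'(1)] by blast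
    then have "l \<notin> J" using disj L'(2) by blast
    moreover have "l \<in> S"
      unfolding S_def using l(1) left_idealD(2)[OF J(1)]
      by (intro CollectI exI[of _ 0] exI[of _ l]) simp
    ultimately have "J \<subset> S" using \<open>J \<subseteq> S\<close> by blast
    then have "rank J < rank S"
      using S J(1) by (intro rank_strict_mono) (auto dest: left_idealD(1))
    with \<open>rank S \<le> rank J\<close> show False by simp
  qed
  have xu: "x \<star> u \<noteq> 0"
  proof
    assume "x \<star> u = 0"
    then have "x = x \<star> e" using conv_u[OF x(1)] by simp
    moreover have "x \<star> e \<in> J" using J(1) x(1) e(1) by (rule left_idealD(4))
    ultimately show False using J(3) by simp
  qed
  have min: "minimal_left_ideal L"
    unfolding minimal_left_ideal_def
  proof (intro conjI allI impI)
    show "left_ideal L" by fact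
    have "x \<star> u \<in> L" using x by (auto simp: L_def)
    then show "L \<noteq> {0}" using xu by auto
    fix L' assume L': "left_ideal L' \<and> L' \<subseteq> L"
    show "L' = {0} \<or> L' = L"
    proof (rule ccontr)
      assume neg: "\<not> (L' = {0} \<or> L' = L)"
      obtain e' where e': "e' \<in> L'" "\<And>y. y \<in> L' \<Longrightarrow> y \<star> e' = y"
        using left_ideal_right_identity L' by blast
      \<comment> \<open>The complement of \<open>L'\<close> in \<open>L\<close>, split off by the right identity of \<open>L'\<close>.\<close>
      define L'' where "L'' = {l \<in> L. l \<star> e' = 0}"
      have L'': "left_ideal L''" unfolding L''_def using L by (rule left_ideal_kernel)
      obtain l where l: "l \<in> L" "l \<notin> L'" using neg L' by auto
      have l_alg: "l \<in> alg" using L l by (auto dest: left_idealD(1))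
      have le: "l \<star> e' \<in> L'" using L' e'(1) l_alg left_idealD(4)[of L' l e'] by blast
      then have "(l \<star> e') \<star> e' = l \<star> e'" by (rule e'(2))
      then have "(l - l \<star> e') \<star> e' = 0" by (simp add: conv_diff_left)
      moreover have "l - l \<star> e' \<in> L" using left_ideal_diff[OF L l(1), of "l \<star> e'"] le L' by blast
      ultimately have "l - l \<star> e' \<in> L''" unfolding L''_def by blast
      moreover have "l - l \<star> e' \<noteq> 0" using l le by auto
      ultimately have "L'' \<noteq> {0}" by auto
      then obtain j2 l2 where 2: "j2 \<in> J" "l2 \<in> L''" "x = j2 + l2"
        using reach[OF L''] unfolding L''_def by blast
      obtain j1 l1 where 1: "j1 \<in> J" "l1 \<in> L'" "x = j1 + l1"
        using reach[of L'] L' neg by blast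
      have "l1 - l2 = j2 - j1" using 1(3) 2(3) by (simp add: algebra_simps)
      moreover have "j2 - j1 \<in> J" using left_ideal_diff[OF J(1) 2(1) 1(1)] .
      moreover have "l1 - l2 \<in> L" using left_ideal_diff[OF L, of l1 l2] L' 1(2) 2(2) unfolding L''_def by blast
      ultimately have "l1 = l2" using disj[of "l1 - l2"] by simp
      then have "l1 = 0" using e'(2)[OF 1(2)] 2(2) by (simp add: L''_def)
      then show False using 1(1,3) J(3) by simp
    qed
  qed
  have uL: "u \<in> L"
    using u_alg unfolding L_def by (intro CollectI exI[of _ "single 1 \<one>"]) simp
  have Iu: "y \<star> u = 0" if "y \<in> I" for y
  proof -
    have "y \<in> J" using that J(2) by blast
    moreover from this have "y \<in> alg" using J(1) by (auto dest: left_idealD(1))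
    ultimately show ?thesis using e(2)[of y] conv_u[of y] by simp
  qed
  show thesis by (rule that[OF min uL Iu xu])
qed

section \<open>Elements of the group algebra are algebraic\<close>

text \<open>A family indexed by numbers rather than a set, since the powers to which this is applied may
  repeat; a repetition is itself a linear relation.\<close>

lemma linearly_dependent_family:
  fixes f :: "nat \<Rightarrow> 'g \<Rightarrow> 'k::field"
  assumes f: "\<And>i. f i \<in> alg" and n: "n = card (carrier G)"
  obtains c where "\<exists>i\<le>n. c i \<noteq> 0" "(\<Sum>i\<le>n. (\<lambda>g. c i * f i g)) = 0"
proof (cases "inj_on f {..n}")
  case True
  have "fs.dependent (f ` {..n})"
  proof (rule ccontr)
    assume "\<not> fs.dependent (f ` {..n})"
    from independent_in_alg(2)[OF this] f True n show False by (auto simp: card_image)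
  qed
  then obtain u where u: "\<exists>v\<in>f ` {..n}. u v \<noteq> 0" "(\<Sum>v\<in>f ` {..n}. (\<lambda>g. u v * v g)) = 0"
    by (subst (asm) fs.dependent_finite) auto
  from u(2) have "(\<Sum>i\<le>n. (\<lambda>g. u (f i) * f i g)) = 0"
    by (simp add: sum.reindex[OF True])
  with u(1) show thesis by (intro that[of "\<lambda>i. u (f i)"]) auto
next
  case False
  then obtain i j where ij: "i \<le> n" "j \<le> n" "i \<noteq> j" "f i = f j" by (auto simp: inj_on_def)
  define c :: "nat \<Rightarrow> 'k" where "c k = (if k = i then 1 else if k = j then - 1 else 0)" for k
  have "(\<Sum>k\<le>n. c k * f k g) = 0" for g
  proof -
    have "(\<Sum>k\<le>n. c k * f k g) = (\<Sum>k\<in>{i, j}. c k * f k g)"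
      using ij by (intro sum.mono_neutral_right) (auto simp: c_def)
    then show ?thesis using ij by (simp add: c_def)
  qed
  then have "(\<Sum>k\<le>n. (\<lambda>g. c k * f k g)) = 0"
    by (simp add: fun_eq_iff sum_fun_apply fun_apply)
  moreover have "\<exists>k\<le>n. c k \<noteq> 0" using ij by (auto simp: c_def intro!: exI[of _ i])
  ultimately show thesis by (intro that)
qed

text \<open>Evaluation of a polynomial at an element of \<open>K[G]\<close>, by the Horner scheme.\<close>

definition poly_alg :: "'k::field poly \<Rightarrow> ('g \<Rightarrow> 'k) \<Rightarrow> 'g \<Rightarrow> 'k"
  where "poly_alg p x = fold_coeffs (\<lambda>a y. scalar G a + x \<star> y) p 0"

lemma poly_alg_0 [simp]: "poly_alg 0 x = 0"
  by (simp add: poly_alg_def)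

lemma poly_alg_pCons: "poly_alg (pCons a p) x = scalar G a + x \<star> poly_alg p x"
  by (cases "p = 0 \<and> a = 0") (auto simp: poly_alg_def)

lemma poly_alg_in_alg: "poly_alg p x \<in> alg"
  by (induction p) (simp_all add: poly_alg_pCons)

lemma poly_alg_add: "poly_alg (p + q) x = poly_alg p x + poly_alg q x"
  by (induction p q rule: poly_induct2)
    (simp_all add: poly_alg_pCons scalar_add conv_add_right ac_simps)

lemma poly_alg_smult: "x \<in> alg \<Longrightarrow> poly_alg (Polynomial.smult c p) x = scalar G c \<star> poly_alg p x"
proof (induction p)
  case (pCons a p)
  have "scalar G c \<star> (x \<star> poly_alg p x) = x \<star> (scalar G c \<star> poly_alg p x)"
    using pCons.prems by (simp add: scalar_central flip: conv_assoc)
  then show ?case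
    using pCons by (simp add: poly_alg_pCons conv_add_right scalar_conv_scalar)
qed simp

lemma poly_alg_sum: "poly_alg (sum f A) x = (\<Sum>i\<in>A. poly_alg (f i) x)"
  by (induction A rule: infinite_finite_induct) (auto simp: poly_alg_add)

lemma poly_alg_commute: "x \<in> alg \<Longrightarrow> x \<star> poly_alg p x = poly_alg p x \<star> x"
proof (induction p)
  case (pCons a p)
  moreover from this have "poly_alg p x \<star> x \<in> alg" by simp
  ultimately show ?case
    using conv_assoc[of x "poly_alg p x" x]
    by (simp add: poly_alg_pCons conv_add_left conv_add_right scalar_central)
qed simp

lemma poly_alg_linear_factor:
  assumes "x \<in> alg"
  shows "poly_alg ([:- c, 1:] * q) x = x \<star> poly_alg q x - scalar G c \<star> poly_alg q x"
proof -
  have "scalar G (- c) = - scalar G c"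
    by (auto simp: scalar_def fun_eq_iff fun_apply)
  moreover have "- y \<star> z = - (y \<star> z)" for y z :: "'g \<Rightarrow> 'a"
    using conv_diff_left[of 0 y z] by simp
  moreover have "[:- c, 1:] * q = pCons 0 q + Polynomial.smult (- c) q"
    by simp
  ultimately show ?thesis
    using assms by (simp only: poly_alg_add poly_alg_smult poly_alg_pCons) simp
qed

text \<open>The eigenvalue argument behind Schur's lemma, phrased inside the group algebra: if \<open>A\<close> is
  the annihilator of a vector, then \<open>y\<close> carries this vector to an eigenvector of \<open>x\<close>. For the proof,
  take a nonzero polynomial \<open>q\<close> of least degree with \<open>q(x) \<in> A\<close>; it exists because the powers of \<open>x\<close>
  are linearly dependent. It has a root \<open>c\<close>, and \<open>y = (q / (X - c))(x)\<close> is outside \<open>A\<close> by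
  minimality. As a polynomial in \<open>x\<close>, it commutes with \<open>x\<close>, which is what transfers
  the eigenvector property to endomorphisms.\<close>

lemma eigenvector_exists:
  fixes A :: "('g \<Rightarrow> 'k::alg_closed_field) set"
  assumes A: "left_ideal A" "single 1 \<one> \<notin> A" and x: "x \<in> alg"
  obtains c y where "y \<in> alg" "y \<notin> A" "x \<star> y - scalar G c \<star> y \<in> A" "x \<star> y = y \<star> x"
proof -
  define pw where "pw i = ((\<star>) x ^^ i) (single 1 \<one>)" for i
  have pw_alg: "pw i \<in> alg" for i by (cases i) (simp_all add: pw_def)
  have poly_monom: "poly_alg (monom c i) x = scalar G c \<star> pw i" for c i
  proof (induction i)
    case 0
    then show ?case by (simp add: pw_def monom_0 poly_alg_pCons)
  next
    case (Suc i)
    then show ?case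
      using x by (simp add: pw_def monom_Suc poly_alg_pCons scalar_central flip: conv_assoc)
  qed
  obtain c where c: "\<exists>i\<le>card (carrier G). c i \<noteq> 0" "(\<Sum>i\<le>card (carrier G). (\<lambda>g. c i * pw i g)) = 0"
    using linearly_dependent_family[of pw, OF pw_alg refl] by blast
  define p where "p = (\<Sum>i\<le>card (carrier G). monom (c i) i)"
  have "coeff p i = c i" if "i \<le> card (carrier G)" for i
    using that by (simp add: p_def coeff_sum)
  then have "p \<noteq> 0" using c(1) by auto
  moreover have "poly_alg p x = 0"
    using c(2) pw_alg by (simp add: p_def poly_alg_sum poly_monom scalar_conv)
  then have "poly_alg p x \<in> A" using A by (simp add: left_idealD(2))
  ultimately obtain q where q: "q \<noteq> 0" "poly_alg q x \<in> A"
    and min: "\<And>r. r \<noteq> 0 \<Longrightarrow> poly_alg r x \<in> A \<Longrightarrow> degree q \<le> degree r"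
    using ex_has_least_nat[of "\<lambda>p. p \<noteq> 0 \<and> poly_alg p x \<in> A" p degree] by blast
  have "degree q > 0"
  proof (rule ccontr)
    assume "\<not> degree q > 0"
    then obtain a where a: "q = [:a:]" "a \<noteq> 0" using q(1) by (auto elim: degree_eq_zeroE)
    then have "scalar G a \<in> A" using q(2) by (simp add: poly_alg_pCons)
    then have "scalar G (inverse a) \<star> scalar G a \<in> A" using A(1) by (intro left_idealD(4)) auto
    then show False using A(2) a by (simp add: scalar_conv_scalar scalar_one)
  qed
  then obtain d where "poly q d = 0" using alg_closed_imp_poly_has_root by blast
  then obtain r where r: "q = [:- d, 1:] * r" by (auto simp: poly_eq_0_iff_dvd)
  then have "r \<noteq> 0" using q by auto
  then have "degree q = Suc (degree r)" unfolding r by (subst degree_mult_eq) auto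
  then have "poly_alg r x \<notin> A" using min[OF \<open>r \<noteq> 0\<close>] by auto
  moreover have "x \<star> poly_alg r x - scalar G d \<star> poly_alg r x \<in> A"
    using q(2) unfolding r poly_alg_linear_factor[OF x] .
  ultimately show thesis
    using x by (intro that[of "poly_alg r x" d] poly_alg_in_alg poly_alg_commute)
qed

end

section \<open>Subspaces of finite-dimensional spaces\<close>

context vectorspace
begin

lemma subspace_lin_indpt:
  assumes "subspace K W V" "A \<subseteq> W" "\<not> LinearCombinations.module.lin_dep K (vs W) A"
  shows "lin_indpt A"
  using span_li_not_depend(2)[of A W] assms by simp

lemma subspace_fin_dim:
  assumes "fin_dim" and W: "subspace K W V"
  shows "vectorspace.fin_dim K (vs W)"
proof -
  interpret W: vectorspace K "vs W"
    using W by (rule subspace_is_vs)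
  have WV: "W \<subseteq> carrier V"
    using W by (simp add: subspace_def submodule_def)
  let ?P = "\<lambda>A. A \<subseteq> W \<and> W.lin_indpt A"
  have "\<exists>A. finite A \<and> maximal A ?P"
  proof (rule maximal_exists)
    show "finite A \<and> card A \<le> dim" if "?P A" for A
      using that WV li_le_dim[OF assms(1), of A] subspace_lin_indpt[OF W, of A] by auto
    show "?P {}" by (simp add: W.lin_dep_def)
  qed
  then obtain A where "finite A" "maximal A ?P" by blast
  then have "W.gen_set A" "A \<subseteq> W"
    using W.max_li_is_gen[of A] by (simp_all add: maximal_def)
  with \<open>finite A\<close> show ?thesis
    unfolding W.fin_dim_def by auto
qed

lemma subspace_dim_eq:
  assumes "fin_dim" and W: "subspace K W V" and "vectorspace.dim K (vs W) = dim"
  shows "W = carrier V"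
proof -
  interpret W: vectorspace K "vs W"
    using W by (rule subspace_is_vs)
  have WV: "W \<subseteq> carrier V"
    using W by (simp add: subspace_def submodule_def)
  obtain B where B: "finite B" "W.basis B"
    using W.finite_basis_exists subspace_fin_dim assms by blast
  then have BW: "B \<subseteq> W" "W.lin_indpt B" "W.span B = W" by (simp_all add: W.basis_def)
  have "basis B"
    using B BW WV assms subspace_lin_indpt[OF W] W.dim_basis[OF B] by (intro dim_li_is_basis) auto
  then have "span B = carrier V" by (simp add: basis_def)
  moreover have "W.span B = span B"
    using span_li_not_depend(1)[OF BW(1)] W by simp
  ultimately show ?thesis using BW(3) by simp
qed

lemma dim_eq_0_iff:
  assumes "fin_dim"
  shows "dim = 0 \<longleftrightarrow> carrier V = {\<zero>\<^bsub>V\<^esub>}"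
proof
  assume "dim = 0"
  obtain B where B: "finite B" "basis B" using finite_basis_exists assms by blast
  then have "B = {}" using dim_basis[OF B] \<open>dim = 0\<close> by simp
  then show "carrier V = {\<zero>\<^bsub>V\<^esub>}" using B by (simp add: basis_def span_empty)
next
  assume "carrier V = {\<zero>\<^bsub>V\<^esub>}"
  then have "gen_set {\<zero>\<^bsub>V\<^esub>}" using span_is_subset2[of "{\<zero>\<^bsub>V\<^esub>}"] in_own_span[of "{\<zero>\<^bsub>V\<^esub>}"] by auto
  then show "dim = 0" by (rule dim0I)
qed

end

section \<open>Modules over the group algebra\<close>

locale ga_module = G?: finite_group G + mod: left_module "group_algebra G :: ('g \<Rightarrow> 'k::field) ring" M
  for G :: "('g, 'm) monoid_scheme" (structure) and M :: "('g, 'k::field, 'v) ga_module"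
begin

abbreviation act :: "('g \<Rightarrow> 'k) \<Rightarrow> 'v \<Rightarrow> 'v" (infixr "\<cdot>" 75) where "a \<cdot> x \<equiv> a \<odot>\<^bsub>M\<^esub> x"

lemma act_closed [simp, intro]: "a \<in> alg \<Longrightarrow> x \<in> carrier M \<Longrightarrow> a \<cdot> x \<in> carrier M"
  using mod.smult_closed by simp

lemma act_add_left: "a \<in> alg \<Longrightarrow> b \<in> alg \<Longrightarrow> x \<in> carrier M \<Longrightarrow> (a + b) \<cdot> x = a \<cdot> x \<oplus>\<^bsub>M\<^esub> b \<cdot> x"
  using mod.smult_l_distr by simp

lemma act_add_right:
  "a \<in> alg \<Longrightarrow> x \<in> carrier M \<Longrightarrow> y \<in> carrier M \<Longrightarrow> a \<cdot> (x \<oplus>\<^bsub>M\<^esub> y) = a \<cdot> x \<oplus>\<^bsub>M\<^esub> a \<cdot> y"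
  using mod.smult_r_distr by simp

lemma act_conv: "a \<in> alg \<Longrightarrow> b \<in> alg \<Longrightarrow> x \<in> carrier M \<Longrightarrow> (a \<star> b) \<cdot> x = a \<cdot> b \<cdot> x"
  using mod.smult_assoc by simp

lemma act_one [simp]: "x \<in> carrier M \<Longrightarrow> single 1 \<one> \<cdot> x = x"
  using mod.smult_one by simp

lemma act_zero_left [simp]: "x \<in> carrier M \<Longrightarrow> 0 \<cdot> x = \<zero>\<^bsub>M\<^esub>"
proof -
  assume x: "x \<in> carrier M"
  then have "0 \<cdot> x = 0 \<cdot> x \<oplus>\<^bsub>M\<^esub> 0 \<cdot> x" using act_add_left[of 0 0 x] by simp
  then show ?thesis
    using x act_closed[of 0 x] mod.M.add.r_cancel_one'[of "0 \<cdot> x" "0 \<cdot> x"] by simp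
qed

lemma act_zero_right [simp]: "a \<in> alg \<Longrightarrow> a \<cdot> \<zero>\<^bsub>M\<^esub> = \<zero>\<^bsub>M\<^esub>"
  using act_conv[of a 0 "\<zero>\<^bsub>M\<^esub>"] by simp

lemma act_uminus: "a \<in> alg \<Longrightarrow> x \<in> carrier M \<Longrightarrow> (- a) \<cdot> x = \<ominus>\<^bsub>M\<^esub> (a \<cdot> x)"
  using act_add_left[of "- a" a x] by (intro mod.M.minus_equality[symmetric]) simp_all

lemma act_minus_right: "a \<in> alg \<Longrightarrow> x \<in> carrier M \<Longrightarrow> a \<cdot> (\<ominus>\<^bsub>M\<^esub> x) = \<ominus>\<^bsub>M\<^esub> (a \<cdot> x)"
  using act_add_right[of a "\<ominus>\<^bsub>M\<^esub> x" x]
  by (intro mod.M.minus_equality[symmetric]) (simp_all add: mod.M.l_neg)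

lemma act_diff_left: "a \<in> alg \<Longrightarrow> b \<in> alg \<Longrightarrow> x \<in> carrier M \<Longrightarrow> (a - b) \<cdot> x = a \<cdot> x \<ominus>\<^bsub>M\<^esub> b \<cdot> x"
  using act_add_left[of a "- b" x] by (simp add: act_uminus a_minus_def)

lemma act_diff_right:
  "a \<in> alg \<Longrightarrow> x \<in> carrier M \<Longrightarrow> y \<in> carrier M \<Longrightarrow> a \<cdot> (x \<ominus>\<^bsub>M\<^esub> y) = a \<cdot> x \<ominus>\<^bsub>M\<^esub> a \<cdot> y"
  by (simp add: a_minus_def act_add_right act_minus_right)

lemma diff_eq_zero_iff:
  "x \<in> carrier M \<Longrightarrow> y \<in> carrier M \<Longrightarrow> x \<ominus>\<^bsub>M\<^esub> y = \<zero>\<^bsub>M\<^esub> \<longleftrightarrow> x = y"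
  using mod.M.minus_equality[of x "\<ominus>\<^bsub>M\<^esub> y"] by (auto simp: a_minus_def mod.M.r_neg)

lemma scalar_act_act:
  "a \<in> alg \<Longrightarrow> x \<in> carrier M \<Longrightarrow> scalar G c \<cdot> a \<cdot> x = a \<cdot> scalar G c \<cdot> x"
  by (simp add: scalar_central flip: act_conv)

lemma scalar_inverse_act:
  "c \<noteq> 0 \<Longrightarrow> x \<in> carrier M \<Longrightarrow> scalar G (inverse c) \<cdot> scalar G c \<cdot> x = x"
  by (simp add: scalar_conv_scalar scalar_one flip: act_conv)

definition ann :: "'v set \<Rightarrow> ('g \<Rightarrow> 'k) set"
  where "ann W = {x \<in> alg. \<forall>w\<in>W. x \<cdot> w = \<zero>\<^bsub>M\<^esub>}"

lemma left_ideal_ann: "W \<subseteq> carrier M \<Longrightarrow> left_ideal (ann W)"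
  by (auto simp: left_ideal_def ann_def act_add_left act_conv subset_iff)

lemma K_space_sel [simp]:
  "carrier (K_space G M) = carrier M" "zero (K_space G M) = \<zero>\<^bsub>M\<^esub>"
  "add (K_space G M) = add M" "c \<odot>\<^bsub>K_space G M\<^esub> x = scalar G c \<cdot> x"
  by (simp_all add: K_space_def)

lemma vectorspace_K_space: "vectorspace class_ring (K_space G M)"
  unfolding vectorspace_def
proof (intro conjI class_field module_criteria)
  show "cring (class_ring :: 'k ring)" by unfold_locales
  show "\<forall>v\<in>carrier (K_space G M). \<exists>neg_v\<in>carrier (K_space G M).
      v \<oplus>\<^bsub>K_space G M\<^esub> neg_v = \<zero>\<^bsub>K_space G M\<^esub>"
    using mod.M.r_neg by (auto intro!: bexI[of _ "\<ominus>\<^bsub>M\<^esub> _"])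
qed (auto simp: scalar_add act_add_left act_add_right scalar_one mod.M.a_ac simp flip: act_conv scalar_conv_scalar)

lemma K_subspace_iff:
  "K_subspace G M W \<longleftrightarrow> W \<subseteq> carrier M \<and> \<zero>\<^bsub>M\<^esub> \<in> W \<and> (\<forall>x\<in>W. \<forall>y\<in>W. x \<oplus>\<^bsub>M\<^esub> y \<in> W) \<and>
     (\<forall>c. \<forall>x\<in>W. scalar G c \<cdot> x \<in> W)"
  using vectorspace_K_space vectorspace.axioms(1)[OF vectorspace_K_space]
  by (auto simp: VectorSpace.subspace_def LinearCombinations.submodule_def)

lemma K_subspace_subset: "K_subspace G M W \<Longrightarrow> W \<subseteq> carrier M"
  by (simp add: K_subspace_iff)

lemma K_subspace_diff: "K_subspace G M W \<Longrightarrow> x \<in> W \<Longrightarrow> y \<in> W \<Longrightarrow> x \<ominus>\<^bsub>M\<^esub> y \<in> W"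
proof -
  assume W: "K_subspace G M W" "x \<in> W" "y \<in> W"
  have y: "y \<in> carrier M" using W by (auto simp: K_subspace_iff)
  have "scalar G (- 1) = (- single 1 \<one> :: 'g \<Rightarrow> 'k)"
    by (auto simp: scalar_def single_def fun_eq_iff fun_apply)
  then have "scalar G (- 1) \<cdot> y = \<ominus>\<^bsub>M\<^esub> y" using y by (simp add: act_uminus)
  then have "\<ominus>\<^bsub>M\<^esub> y \<in> W" using W by (metis K_subspace_iff)
  then show ?thesis using W by (simp add: a_minus_def K_subspace_iff)
qed

definition cyclic :: "'v \<Rightarrow> 'v set"
  where "cyclic m = {x \<cdot> m |x. x \<in> alg}"

definition line :: "'v \<Rightarrow> 'v set"
  where "line m = {scalar G c \<cdot> m |c. True}"

lemma cyclicI: "x \<in> alg \<Longrightarrow> x \<cdot> m \<in> cyclic m"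
  by (auto simp: cyclic_def)

lemma generator_in_cyclic: "m \<in> carrier M \<Longrightarrow> m \<in> cyclic m"
  using cyclicI[of "single 1 \<one>" m] by simp

lemma generator_in_line: "m \<in> carrier M \<Longrightarrow> m \<in> line m"
  unfolding line_def by (intro CollectI exI[of _ 1]) (simp add: scalar_one)

lemma cyclic_closed:
  assumes "m \<in> carrier M"
  shows "cyclic m \<subseteq> carrier M" "\<zero>\<^bsub>M\<^esub> \<in> cyclic m"
    "x \<in> cyclic m \<Longrightarrow> y \<in> cyclic m \<Longrightarrow> x \<oplus>\<^bsub>M\<^esub> y \<in> cyclic m"
    "a \<in> alg \<Longrightarrow> x \<in> cyclic m \<Longrightarrow> a \<cdot> x \<in> cyclic m"
proof -
  show "cyclic m \<subseteq> carrier M" using assms by (auto simp: cyclic_def)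
  show "\<zero>\<^bsub>M\<^esub> \<in> cyclic m" using assms cyclicI[of 0 m] by simp
  show "x \<oplus>\<^bsub>M\<^esub> y \<in> cyclic m" if "x \<in> cyclic m" "y \<in> cyclic m"
    using that assms by (auto simp: cyclic_def simp flip: act_add_left)
  show "a \<cdot> x \<in> cyclic m" if "a \<in> alg" "x \<in> cyclic m"
    using that assms by (auto simp: cyclic_def simp flip: act_conv)
qed

lemma K_subspace_cyclic: "m \<in> carrier M \<Longrightarrow> K_subspace G M (cyclic m)"
  unfolding K_subspace_iff using cyclic_closed[of m] by blast

lemma K_subspace_line: "m \<in> carrier M \<Longrightarrow> K_subspace G M (line m)"
  unfolding K_subspace_iff
proof (intro conjI ballI allI)
  assume m: "m \<in> carrier M"
  show "line m \<subseteq> carrier M" using m by (auto simp: line_def)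
  show "\<zero>\<^bsub>M\<^esub> \<in> line m" unfolding line_def using m by (intro CollectI exI[of _ 0]) simp
  show "x \<oplus>\<^bsub>M\<^esub> y \<in> line m" if "x \<in> line m" "y \<in> line m" for x y
    using that m by (auto simp: line_def simp flip: act_add_left scalar_add)
  show "scalar G c \<cdot> x \<in> line m" if "x \<in> line m" for c x
    using that m by (auto simp: line_def scalar_conv_scalar simp flip: act_conv)
qed

lemma line_subset: "K_subspace G M W \<Longrightarrow> m \<in> W \<Longrightarrow> line m \<subseteq> W"
  by (auto simp: line_def K_subspace_iff)

lemma line_subset_cyclic: "line m \<subseteq> cyclic m"
  by (auto simp: line_def cyclic_def)

text \<open>The translates of \<open>m\<close> by the elements of \<open>G\<close> span.\<close>

lemma K_fin_dim_cyclic: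
  assumes m: "m \<in> carrier M"
  shows "K_fin_dim G M (cyclic m)"
proof -
  interpret V: vectorspace class_ring "K_space G M" by (rule vectorspace_K_space)
  let ?C = "V.vs (cyclic m)"
  interpret C: vectorspace class_ring ?C
    using K_subspace_cyclic[OF m] by (rule V.subspace_is_vs)
  define A where "A = (\<lambda>g. single 1 g \<cdot> m) ` carrier G"
  have A: "finite A" "A \<subseteq> cyclic m"
    using finite_carrier by (auto simp: A_def cyclic_def)
  have sub: "LinearCombinations.submodule class_ring (C.span A) ?C"
    using A by (intro C.span_is_submodule) simp
  have "x \<cdot> m \<in> C.span A" if "x \<in> alg" for x
    using that
  proof (rule alg_induct)
    show "0 \<cdot> m \<in> C.span A"
      using m LinearCombinations.submodule.zero_closed[OF sub] by simp
    show "(y + z) \<cdot> m \<in> C.span A" if "y \<in> alg" "z \<in> alg" "y \<cdot> m \<in> C.span A" "z \<cdot> m \<in> C.span A" for y z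
      using that m LinearCombinations.submodule.m_closed[OF sub] by (simp add: act_add_left)
    fix c g assume g: "g \<in> carrier G"
    then have "single 1 g \<cdot> m \<in> C.span A"
      using C.in_own_span[of A] A by (auto simp: A_def)
    then have "scalar G c \<cdot> single 1 g \<cdot> m \<in> C.span A"
      using LinearCombinations.submodule.smult_closed[OF sub, of c "single 1 g \<cdot> m"] by simp
    then show "single c g \<cdot> m \<in> C.span A"
      using g m by (simp add: single_eq_scalar[of g c] act_conv)
  qed
  then have "C.span A = carrier ?C"
    using sub by (auto simp: cyclic_def LinearCombinations.submodule_def)
  then show ?thesis
    unfolding K_fin_dim_def C.fin_dim_def using A by auto
qed

lemma K_fin_dim_subspace:
  assumes C: "K_subspace G M C" "K_fin_dim G M C" and W: "K_subspace G M W" "W \<subseteq> C"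
  shows "K_fin_dim G M W" "K_dim G M W \<le> K_dim G M C" "K_dim G M W = K_dim G M C \<Longrightarrow> W = C"
proof -
  interpret V: vectorspace class_ring "K_space G M" by (rule vectorspace_K_space)
  let ?C = "V.vs C"
  interpret C: vectorspace class_ring ?C using C(1) by (rule V.subspace_is_vs)
  have sub: "VectorSpace.subspace class_ring W ?C"
    using V.nested_subspaces C(1) W by blast
  have fd: "C.fin_dim" using C(2) by (simp add: K_fin_dim_def)
  have fdW: "vectorspace.fin_dim class_ring (C.vs W)"
    using C.subspace_fin_dim[OF fd sub] .
  then show "K_fin_dim G M W" by (simp add: K_fin_dim_def)
  show "K_dim G M W \<le> K_dim G M C" using C.subspace_dim[OF sub fd fdW] by (simp add: K_dim_def)
  show "W = C" if "K_dim G M W = K_dim G M C"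
    using C.subspace_dim_eq[OF fd sub] that by (simp add: K_dim_def)
qed

lemma K_dim_eq_0_iff:
  assumes "K_subspace G M W" "K_fin_dim G M W"
  shows "K_dim G M W = 0 \<longleftrightarrow> W = {\<zero>\<^bsub>M\<^esub>}"
proof -
  interpret V: vectorspace class_ring "K_space G M" by (rule vectorspace_K_space)
  interpret W: vectorspace class_ring "V.vs W" using assms(1) by (rule V.subspace_is_vs)
  show ?thesis using W.dim_eq_0_iff assms(2) by (simp add: K_fin_dim_def K_dim_def)
qed

lemma K_dim_line_le:
  assumes m: "m \<in> carrier M"
  shows "K_dim G M (line m) \<le> 1"
proof -
  interpret V: vectorspace class_ring "K_space G M" by (rule vectorspace_K_space)
  interpret W: vectorspace class_ring "V.vs (line m)"
    using K_subspace_line[OF m] by (rule V.subspace_is_vs)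
  have sub: "LinearCombinations.submodule class_ring (W.span {m}) (V.vs (line m))"
    using generator_in_line[OF m] by (intro W.span_is_submodule) simp
  have "m \<in> W.span {m}" using W.in_own_span[of "{m}"] generator_in_line[OF m] by simp
  then have "scalar G c \<cdot> m \<in> W.span {m}" for c
    using LinearCombinations.submodule.smult_closed[OF sub, of c m] by simp
  then have "W.span {m} = line m"
    using sub by (auto simp: line_def LinearCombinations.submodule_def)
  then show ?thesis
    using W.dim_le1I[of m] generator_in_line[OF m] by (simp add: K_dim_def)
qed

lemma submodule_iff:
  "Module.submodule H (group_algebra G) M \<longleftrightarrow>
     H \<subseteq> carrier M \<and> \<zero>\<^bsub>M\<^esub> \<in> H \<and> (\<forall>x\<in>H. \<forall>y\<in>H. x \<oplus>\<^bsub>M\<^esub> y \<in> H) \<and> (\<forall>a\<in>alg. \<forall>x\<in>H. a \<cdot> x \<in> H)"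
proof
  assume "Module.submodule H (group_algebra G) M"
  then interpret H: Module.submodule H "group_algebra G" M .
  show "H \<subseteq> carrier M \<and> \<zero>\<^bsub>M\<^esub> \<in> H \<and> (\<forall>x\<in>H. \<forall>y\<in>H. x \<oplus>\<^bsub>M\<^esub> y \<in> H) \<and> (\<forall>a\<in>alg. \<forall>x\<in>H. a \<cdot> x \<in> H)"
    using H.subset H.one_closed H.m_closed H.smult_closed by auto
next
  assume H: "H \<subseteq> carrier M \<and> \<zero>\<^bsub>M\<^esub> \<in> H \<and> (\<forall>x\<in>H. \<forall>y\<in>H. x \<oplus>\<^bsub>M\<^esub> y \<in> H) \<and> (\<forall>a\<in>alg. \<forall>x\<in>H. a \<cdot> x \<in> H)"
  have "\<ominus>\<^bsub>M\<^esub> x \<in> H" if x: "x \<in> H" for x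
  proof -
    have "(- single 1 \<one>) \<cdot> x \<in> H" "x \<in> carrier M" using H x by auto
    then show ?thesis by (simp add: act_uminus)
  qed
  then show "Module.submodule H (group_algebra G) M"
    using H by unfold_locales (auto simp flip: a_inv_def)
qed

lemma submodule_cyclic: "m \<in> carrier M \<Longrightarrow> Module.submodule (cyclic m) (group_algebra G) M"
  unfolding submodule_iff using cyclic_closed[of m] by blast

text \<open>Vectors are compared across modules by their annihilators: \<open>x w \<mapsto> x u\<close> is well defined
  exactly when everything in \<open>J\<close> killing \<open>w\<close> kills \<open>u\<close>.\<close>

lemma transfer_map:
  assumes N: "ga_module G N" and J: "left_ideal J" and w: "w \<in> carrier M" and u: "u \<in> carrier N"
    and ann: "\<And>x. x \<in> J \<Longrightarrow> x \<cdot> w = \<zero>\<^bsub>M\<^esub> \<Longrightarrow> x \<odot>\<^bsub>N\<^esub> u = \<zero>\<^bsub>N\<^esub>"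
  obtains f where "\<And>x. x \<in> J \<Longrightarrow> f (x \<cdot> w) = x \<odot>\<^bsub>N\<^esub> u"
proof -
  interpret N: ga_module G N by fact
  define f where "f y = (SOME x. x \<in> J \<and> x \<cdot> w = y) \<odot>\<^bsub>N\<^esub> u" for y
  have "f (x \<cdot> w) = x \<odot>\<^bsub>N\<^esub> u" if x: "x \<in> J" for x
  proof -
    define x' where "x' = (SOME x'. x' \<in> J \<and> x' \<cdot> w = x \<cdot> w)"
    have x': "x' \<in> J" "x' \<cdot> w = x \<cdot> w"
      using someI[of "\<lambda>x'. x' \<in> J \<and> x' \<cdot> w = x \<cdot> w" x] x by (auto simp: x'_def)
    have alg: "x \<in> alg" "x' \<in> alg" using left_idealD(1)[OF J] x x' by auto
    have "(x' - x) \<cdot> w = \<zero>\<^bsub>M\<^esub>" using alg w x' by (simp add: act_diff_left diff_eq_zero_iff)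
    then have "(x' - x) \<odot>\<^bsub>N\<^esub> u = \<zero>\<^bsub>N\<^esub>" using left_ideal_diff[OF J x'(1) x] ann by blast
    then have "x' \<odot>\<^bsub>N\<^esub> u = x \<odot>\<^bsub>N\<^esub> u" using alg u by (simp add: N.act_diff_left N.diff_eq_zero_iff)
    then show ?thesis by (simp add: f_def x'_def)
  qed
  then show thesis by (rule that)
qed

lemma transfer_hom:
  assumes N: "ga_module G N" and J: "left_ideal J" and w: "w \<in> carrier M" and u: "u \<in> carrier N"
    and ann: "\<And>x. x \<in> J \<Longrightarrow> x \<cdot> w = \<zero>\<^bsub>M\<^esub> \<Longrightarrow> x \<odot>\<^bsub>N\<^esub> u = \<zero>\<^bsub>N\<^esub>"
    and onto: "carrier M = {x \<cdot> w |x. x \<in> J}"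
  obtains f where "f \<in> LinearCombinations.module_hom (group_algebra G) M N"
    "\<And>x. x \<in> J \<Longrightarrow> f (x \<cdot> w) = x \<odot>\<^bsub>N\<^esub> u"
proof -
  interpret N: ga_module G N by fact
  obtain f where f: "\<And>x. x \<in> J \<Longrightarrow> f (x \<cdot> w) = x \<odot>\<^bsub>N\<^esub> u"
    using transfer_map[OF N J w u ann] by blast
  note Jalg = left_idealD(1)[OF J]
  have "f \<in> LinearCombinations.module_hom (group_algebra G) M N"
    unfolding LinearCombinations.module_hom_def
  proof (intro CollectI conjI allI impI Pi_I)
    fix y assume "y \<in> carrier M"
    then obtain x where "x \<in> J" "y = x \<cdot> w" unfolding onto by blast
    then show "f y \<in> carrier N" using f Jalg u by simp
  next
    fix y z assume "y \<in> carrier M \<and> z \<in> carrier M"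
    then obtain a b where *: "a \<in> J" "b \<in> J" "y = a \<cdot> w" "z = b \<cdot> w" unfolding onto by blast
    then have "y \<oplus>\<^bsub>M\<^esub> z = (a + b) \<cdot> w" using Jalg w by (simp add: act_add_left)
    then show "f (y \<oplus>\<^bsub>M\<^esub> z) = f y \<oplus>\<^bsub>N\<^esub> f z"
      using * f f[OF left_idealD(3)[OF J *(1,2)]] Jalg u by (simp add: N.act_add_left)
  next
    fix r :: "'g \<Rightarrow> 'k" and y assume ry: "r \<in> carrier (group_algebra G) \<and> y \<in> carrier M"
    then obtain a where *: "a \<in> J" "y = a \<cdot> w" unfolding onto by blast
    have r: "r \<in> alg" using ry by simp
    have "r \<cdot> y = (r \<star> a) \<cdot> w" using * Jalg w r by (simp add: act_conv)
    then show "f (r \<cdot> y) = r \<odot>\<^bsub>N\<^esub> f y"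
      using * f f[OF left_idealD(4)[OF J r *(1)]] Jalg u r by (simp add: N.act_conv)
  qed
  with f show thesis by (intro that)
qed

end

lemma (in finite_group) ga_moduleI: "left_module (group_algebra G) M \<Longrightarrow> ga_module G M"
  by (simp add: ga_module_def finite_group_axioms)

section \<open>Irreducible modules\<close>

context ga_module
begin

lemma module_homD:
  assumes "f \<in> LinearCombinations.module_hom (group_algebra G) M N"
  shows "x \<in> carrier M \<Longrightarrow> f x \<in> carrier N"
    "x \<in> carrier M \<Longrightarrow> y \<in> carrier M \<Longrightarrow> f (x \<oplus>\<^bsub>M\<^esub> y) = f x \<oplus>\<^bsub>N\<^esub> f y"
    "a \<in> alg \<Longrightarrow> x \<in> carrier M \<Longrightarrow> f (a \<cdot> x) = a \<odot>\<^bsub>N\<^esub> f x"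
  using assms unfolding LinearCombinations.module_hom_def by auto

lemma module_hom_zero:
  assumes N: "ga_module G N" and f: "f \<in> LinearCombinations.module_hom (group_algebra G) M N"
  shows "f \<zero>\<^bsub>M\<^esub> = \<zero>\<^bsub>N\<^esub>"
proof -
  interpret N: ga_module G N by fact
  have "f (0 \<cdot> \<zero>\<^bsub>M\<^esub>) = 0 \<odot>\<^bsub>N\<^esub> f \<zero>\<^bsub>M\<^esub>" by (rule module_homD(3)[OF f]) simp_all
  then show ?thesis using module_homD(1)[OF f, of "\<zero>\<^bsub>M\<^esub>"] by simp
qed

lemma irreducible_cyclic:
  assumes "irreducible_module G M" "u \<in> carrier M" "u \<noteq> \<zero>\<^bsub>M\<^esub>"
  shows "cyclic u = carrier M"
  using assms submodule_cyclic[of u] generator_in_cyclic[of u]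
  unfolding irreducible_module_def by blast

lemma irreducible_nonzero:
  assumes "irreducible_module G M"
  obtains u where "u \<in> carrier M" "u \<noteq> \<zero>\<^bsub>M\<^esub>"
  using assms mod.M.zero_closed unfolding irreducible_module_def by blast

lemma irreducible_K_fin_dim:
  assumes "irreducible_module G M"
  shows "K_fin_dim G M (carrier M)"
  using irreducible_nonzero[OF assms] irreducible_cyclic[OF assms] K_fin_dim_cyclic by metis

lemma K_subspace_carrier: "K_subspace G M (carrier M)"
  by (auto simp: K_subspace_iff)

lemma submodule_kernel:
  assumes N: "ga_module G N" and f: "f \<in> LinearCombinations.module_hom (group_algebra G) M N"
  shows "Module.submodule {x \<in> carrier M. f x = \<zero>\<^bsub>N\<^esub>} (group_algebra G) M"
proof -
  interpret N: ga_module G N by fact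
  show ?thesis
    unfolding submodule_iff using module_homD[OF f] module_hom_zero[OF N f] by auto
qed

lemma submodule_image:
  assumes N: "ga_module G N" and f: "f \<in> LinearCombinations.module_hom (group_algebra G) M N"
  shows "Module.submodule (f ` carrier M) (group_algebra G) N"
proof -
  interpret N: ga_module G N by fact
  show ?thesis
    unfolding N.submodule_iff
  proof (intro conjI ballI)
    show "f ` carrier M \<subseteq> carrier N" using module_homD(1)[OF f] by auto
    show "\<zero>\<^bsub>N\<^esub> \<in> f ` carrier M" using module_hom_zero[OF N f] by (intro image_eqI[of _ _ "\<zero>\<^bsub>M\<^esub>"]) auto
    show "x \<oplus>\<^bsub>N\<^esub> y \<in> f ` carrier M" if "x \<in> f ` carrier M" "y \<in> f ` carrier M" for x y
      using that by (auto simp flip: module_homD(2)[OF f])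
    show "a \<odot>\<^bsub>N\<^esub> x \<in> f ` carrier M" if "a \<in> alg" "x \<in> f ` carrier M" for a x
      using that by (auto simp flip: module_homD(3)[OF f])
  qed
qed

lemma schur_iso:
  assumes N: "ga_module G N" and irr: "irreducible_module G M" "irreducible_module G N"
    and f: "f \<in> LinearCombinations.module_hom (group_algebra G) M N"
    and nz: "x \<in> carrier M" "f x \<noteq> \<zero>\<^bsub>N\<^esub>"
  shows "module_iso G M N"
proof -
  interpret N: ga_module G N by fact
  have "{x \<in> carrier M. f x = \<zero>\<^bsub>N\<^esub>} \<noteq> carrier M" using nz by auto
  then have ker: "{x \<in> carrier M. f x = \<zero>\<^bsub>N\<^esub>} = {\<zero>\<^bsub>M\<^esub>}"
    using irr(1) submodule_kernel[OF N f] unfolding irreducible_module_def by blast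
  have "f ` carrier M \<noteq> {\<zero>\<^bsub>N\<^esub>}" using nz by auto
  then have im: "f ` carrier M = carrier N"
    using irr(2) submodule_image[OF N f] unfolding irreducible_module_def by blast
  have "inj_on f (carrier M)"
  proof (rule inj_onI)
    fix y z assume yz: "y \<in> carrier M" "z \<in> carrier M" "f y = f z"
    have "y \<ominus>\<^bsub>M\<^esub> z = y \<oplus>\<^bsub>M\<^esub> (- single 1 \<one>) \<cdot> z" using yz by (simp add: act_uminus a_minus_def)
    then have "f (y \<ominus>\<^bsub>M\<^esub> z) = f y \<oplus>\<^bsub>N\<^esub> (- single 1 \<one>) \<odot>\<^bsub>N\<^esub> f z"
      using yz module_homD[OF f] by simp
    also have "\<dots> = f y \<ominus>\<^bsub>N\<^esub> f z"
      using yz module_homD(1)[OF f] by (simp add: N.act_uminus a_minus_def)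
    also have "\<dots> = \<zero>\<^bsub>N\<^esub>" using yz module_homD(1)[OF f] by (simp add: N.diff_eq_zero_iff)
    finally have "y \<ominus>\<^bsub>M\<^esub> z \<in> {x \<in> carrier M. f x = \<zero>\<^bsub>N\<^esub>}" using yz by simp
    then show "y = z" using yz unfolding ker by (simp add: diff_eq_zero_iff)
  qed
  then show ?thesis using f im by (auto simp: module_iso_def bij_betw_def)
qed

end


locale ga_module_closed = ga_module G M
  for G :: "('g, 'm) monoid_scheme" (structure)
    and M :: "('g, 'k::{alg_closed_field, field_char_0}, 'v) ga_module"
begin

text \<open>An endomorphism \<open>f\<close> of the cyclic module generated by \<open>u\<close> satisfies \<open>f u = x u\<close> for some \<open>x\<close>.
  If \<open>v = y u\<close> with \<open>x y = y x\<close> is an eigenvector of \<open>x\<close>, then \<open>f v = y x u = x v\<close>, so \<open>f\<close> is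
  a scalar on \<open>v\<close> and therefore on the module generated by \<open>v\<close>.\<close>

lemma schur_scalar:
  assumes irr: "irreducible_module G M"
    and f: "f \<in> LinearCombinations.module_hom (group_algebra G) M M"
  obtains c where "\<And>x. x \<in> carrier M \<Longrightarrow> f x = scalar G c \<cdot> x"
proof -
  obtain u where u: "u \<in> carrier M" "u \<noteq> \<zero>\<^bsub>M\<^esub>"
    using irreducible_nonzero[OF irr] .
  have "f u \<in> cyclic u"
    using irreducible_cyclic[OF irr u] module_homD(1)[OF f u(1)] by simp
  then obtain x where x: "x \<in> alg" "f u = x \<cdot> u" by (auto simp: cyclic_def)
  have A: "left_ideal (ann {u})" "single 1 \<one> \<notin> ann {u}"
    using u left_ideal_ann[of "{u}"] by (auto simp: ann_def)
  obtain c y where y: "y \<in> alg" "y \<notin> ann {u}" "x \<star> y - scalar G c \<star> y \<in> ann {u}" "x \<star> y = y \<star> x"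
    using eigenvector_exists[OF A x(1)] .
  define v where "v = y \<cdot> u"
  have v: "v \<in> carrier M" "v \<noteq> \<zero>\<^bsub>M\<^esub>" using y(1,2) u by (auto simp: v_def ann_def)
  have "f v = y \<cdot> x \<cdot> u" using module_homD(3)[OF f y(1) u(1)] x by (simp add: v_def)
  also have "\<dots> = (x \<star> y) \<cdot> u" using x y(1,4) u by (simp add: act_conv)
  also have "\<dots> = (scalar G c \<star> y) \<cdot> u"
  proof -
    have "(x \<star> y) \<cdot> u \<ominus>\<^bsub>M\<^esub> (scalar G c \<star> y) \<cdot> u = \<zero>\<^bsub>M\<^esub>"
      using y(3) u by (simp add: ann_def act_diff_left)
    then show ?thesis using u by (simp add: diff_eq_zero_iff)
  qed
  finally have fv: "f v = scalar G c \<cdot> v" using y u by (simp add: v_def act_conv)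
  show thesis
  proof (rule that)
    fix z assume "z \<in> carrier M"
    then have "z \<in> cyclic v" using irreducible_cyclic[OF irr v] by simp
    then obtain a where a: "a \<in> alg" "z = a \<cdot> v" by (auto simp: cyclic_def)
    then show "f z = scalar G c \<cdot> z"
      using module_homD(3)[OF f a(1) v(1)] fv v by (simp add: scalar_act_act)
  qed
qed

end

section \<open>The density theorem for pairwise non-isomorphic irreducible modules\<close>

locale irreducible_family = finite_group G
  for G :: "('g, 'm) monoid_scheme" (structure) +
  fixes U :: "'c \<Rightarrow> ('g, 'k::{alg_closed_field, field_char_0}, 'v) ga_module" and \<C> :: "'c set"
  assumes irreducible: "C \<in> \<C> \<Longrightarrow> irreducible_module G (U C)"
    and non_isomorphic: "C \<in> \<C> \<Longrightarrow> D \<in> \<C> \<Longrightarrow> C \<noteq> D \<Longrightarrow> \<not> module_iso G (U C) (U D)"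
begin

lemma ga_module_U: "C \<in> \<C> \<Longrightarrow> ga_module G (U C)"
  using irreducible by (intro ga_moduleI) (auto simp: irreducible_module_def)

lemma ga_module_closed_U: "C \<in> \<C> \<Longrightarrow> ga_module_closed G (U C)"
  using ga_module_U by (simp add: ga_module_closed_def)

definition common_ann :: "('c \<times> 'v) set \<Rightarrow> ('g \<Rightarrow> 'k) set"
  where "common_ann F = {x \<in> alg. \<forall>(C, w)\<in>F. x \<odot>\<^bsub>U C\<^esub> w = \<zero>\<^bsub>U C\<^esub>}"

lemma left_ideal_common_ann:
  assumes "F \<subseteq> (SIGMA C:\<C>. carrier (U C))"
  shows "left_ideal (common_ann F)"
proof -
  have "left_ideal (ga_module.ann G (U C) {w})" if "(C, w) \<in> F" for C w
  proof -
    interpret C: ga_module G "U C" using that assms by (intro ga_module_U) auto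
    show ?thesis using that assms by (intro C.left_ideal_ann) auto
  qed
  then have "left_ideal (alg \<inter> (\<Inter>(C, w)\<in>F. ga_module.ann G (U C) {w}))"
    by (intro left_ideal_INT) auto
  moreover have "alg \<inter> (\<Inter>(C, w)\<in>F. ga_module.ann G (U C) {w}) = common_ann F"
    using assms ga_module_U by (fastforce simp: common_ann_def ga_module.ann_def)
  ultimately show ?thesis by simp
qed

text \<open>Induction on the number of vectors. Let \<open>J\<close> annihilate all vectors but the last one, \<open>w \<in> U C\<close>.
  If \<open>J w = 0\<close>, then \<open>w\<close> is superfluous. Otherwise \<open>J w\<close> is the whole of \<open>U C\<close>, and \<open>x w \<mapsto> x u\<close>
  for \<open>x \<in> J\<close> is a well-defined homomorphism from \<open>U C\<close> to \<open>U D\<close>. For \<open>C \<noteq> D\<close> it vanishes, so \<open>J\<close>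
  kills \<open>u\<close>; for \<open>C = D\<close> it is a scalar \<open>c\<close>, so \<open>J\<close> kills \<open>u - c w\<close>. In both cases the induction
  hypothesis applies.\<close>

lemma density_finite:
  assumes "finite F" "F \<subseteq> (SIGMA C:\<C>. carrier (U C))"
    and D: "D \<in> \<C>" and W: "K_subspace G (U D) W" "\<And>w. (D, w) \<in> F \<Longrightarrow> w \<in> W"
    and u: "u \<in> carrier (U D)" and ann: "\<And>x. x \<in> common_ann F \<Longrightarrow> x \<odot>\<^bsub>U D\<^esub> u = \<zero>\<^bsub>U D\<^esub>"
  shows "u \<in> W"
  using assms(1,2) W(2) u ann
proof (induction F arbitrary: u)
  case empty
  interpret D: ga_module G "U D" by (rule ga_module_U) fact
  have "single 1 \<one> \<in> common_ann {}" by (simp add: common_ann_def)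
  then have "u = \<zero>\<^bsub>U D\<^esub>" using empty by fastforce
  then show ?case using W(1) by (simp add: D.K_subspace_iff)
next
  case (insert p F)
  interpret D: ga_module_closed G "U D" by (rule ga_module_closed_U) fact
  obtain C w where p: "p = (C, w)" by (cases p)
  have C: "C \<in> \<C>" and w: "w \<in> carrier (U C)" using insert.prems p by auto
  interpret C: ga_module G "U C" by (rule ga_module_U) fact
  define J where "J = common_ann F"
  have J: "left_ideal J" unfolding J_def using insert.prems by (intro left_ideal_common_ann) auto
  have J_ins: "x \<in> common_ann (insert p F)" if "x \<in> J" "x \<odot>\<^bsub>U C\<^esub> w = \<zero>\<^bsub>U C\<^esub>" for x
    using that by (auto simp: J_def common_ann_def p)
  have IH: "v \<in> W" if "v \<in> carrier (U D)" "\<And>x. x \<in> J \<Longrightarrow> x \<odot>\<^bsub>U D\<^esub> v = \<zero>\<^bsub>U D\<^esub>" for v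
    using insert.IH[OF _ _ that(1)] insert.prems that by (auto simp: J_def)
  define H where "H = {x \<odot>\<^bsub>U C\<^esub> w |x. x \<in> J}"
  show ?case
  proof (cases "H = {\<zero>\<^bsub>U C\<^esub>}")
    case True
    then have "x \<odot>\<^bsub>U C\<^esub> w = \<zero>\<^bsub>U C\<^esub>" if "x \<in> J" for x using that unfolding H_def by blast
    then show ?thesis using insert.prems J_ins by (intro IH) auto
  next
    case False
    have "Module.submodule H (group_algebra G) (U C)"
      unfolding C.submodule_iff
    proof (intro conjI ballI)
      show "H \<subseteq> carrier (U C)" using left_idealD(1)[OF J] w by (auto simp: H_def)
      show "\<zero>\<^bsub>U C\<^esub> \<in> H" unfolding H_def using left_idealD(2)[OF J] w by (intro CollectI exI[of _ 0]) simp
      show "y \<oplus>\<^bsub>U C\<^esub> z \<in> H" if yz: "y \<in> H" "z \<in> H" for y z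
      proof -
        obtain a b where ab: "a \<in> J" "b \<in> J" "y = a \<odot>\<^bsub>U C\<^esub> w" "z = b \<odot>\<^bsub>U C\<^esub> w"
          using yz unfolding H_def by blast
        then have "y \<oplus>\<^bsub>U C\<^esub> z = (a + b) \<odot>\<^bsub>U C\<^esub> w"
          using left_idealD(1)[OF J] w by (simp add: C.act_add_left)
        then show ?thesis unfolding H_def using left_idealD(3)[OF J ab(1,2)] by blast
      qed
      show "r \<odot>\<^bsub>U C\<^esub> y \<in> H" if r: "r \<in> alg" and y: "y \<in> H" for r y
      proof -
        obtain a where a: "a \<in> J" "y = a \<odot>\<^bsub>U C\<^esub> w" using y unfolding H_def by blast
        then have "r \<odot>\<^bsub>U C\<^esub> y = (r \<star> a) \<odot>\<^bsub>U C\<^esub> w"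
          using left_idealD(1)[OF J] w r by (simp add: C.act_conv)
        then show ?thesis unfolding H_def using left_idealD(4)[OF J r a(1)] by blast
      qed
    qed
    then have onto: "carrier (U C) = {x \<odot>\<^bsub>U C\<^esub> w |x. x \<in> J}"
      using False irreducible[OF C] unfolding irreducible_module_def H_def by blast
    have kills: "x \<odot>\<^bsub>U D\<^esub> u = \<zero>\<^bsub>U D\<^esub>" if "x \<in> J" "x \<odot>\<^bsub>U C\<^esub> w = \<zero>\<^bsub>U C\<^esub>" for x
      using insert.prems(4) J_ins that by blast
    obtain f where f: "f \<in> LinearCombinations.module_hom (group_algebra G) (U C) (U D)"
      "\<And>x. x \<in> J \<Longrightarrow> f (x \<odot>\<^bsub>U C\<^esub> w) = x \<odot>\<^bsub>U D\<^esub> u"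
      using C.transfer_hom[OF D.ga_module_axioms J w insert.prems(3) kills onto] by blast
    show ?thesis
    proof (cases "C = D")
      case True
      have fD: "f \<in> LinearCombinations.module_hom (group_algebra G) (U D) (U D)"
        using f(1) True by simp
      obtain c where c: "\<And>x. x \<in> carrier (U D) \<Longrightarrow> f x = scalar G c \<odot>\<^bsub>U D\<^esub> x"
        using D.schur_scalar[OF irreducible[OF D] fD] by blast
      have wD: "w \<in> carrier (U D)" "w \<in> W" using w insert.prems(2) True p by auto
      let ?cw = "scalar G c \<odot>\<^bsub>U D\<^esub> w"
      have cw: "?cw \<in> W" using W(1) wD by (simp add: D.K_subspace_iff)
      have "u \<ominus>\<^bsub>U D\<^esub> ?cw \<in> W"
      proof (rule IH)
        show "u \<ominus>\<^bsub>U D\<^esub> ?cw \<in> carrier (U D)" using insert.prems(3) wD by simp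
        fix x assume x: "x \<in> J"
        then have xa: "x \<in> alg" using left_idealD(1)[OF J] by simp
        have "x \<odot>\<^bsub>U D\<^esub> u = scalar G c \<odot>\<^bsub>U D\<^esub> (x \<odot>\<^bsub>U D\<^esub> w)"
          using f(2)[OF x] c[of "x \<odot>\<^bsub>U D\<^esub> w"] xa wD True by simp
        then show "x \<odot>\<^bsub>U D\<^esub> (u \<ominus>\<^bsub>U D\<^esub> ?cw) = \<zero>\<^bsub>U D\<^esub>"
          using xa wD insert.prems(3) by (simp add: D.act_diff_right D.scalar_act_act D.diff_eq_zero_iff)
      qed
      then have "(u \<ominus>\<^bsub>U D\<^esub> ?cw) \<oplus>\<^bsub>U D\<^esub> ?cw \<in> W" using cw W(1) by (simp add: D.K_subspace_iff)
      moreover have "(u \<ominus>\<^bsub>U D\<^esub> ?cw) \<oplus>\<^bsub>U D\<^esub> ?cw = u"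
        using insert.prems(3) wD by (simp add: a_minus_def D.mod.M.a_assoc D.mod.M.l_neg)
      ultimately show ?thesis by simp
    next
      case False
      have "f y = \<zero>\<^bsub>U D\<^esub>" if "y \<in> carrier (U C)" for y
        using C.schur_iso[OF D.ga_module_axioms irreducible[OF C] irreducible[OF D] f(1) that]
          non_isomorphic[OF C D False] by blast
      then have "x \<odot>\<^bsub>U D\<^esub> u = \<zero>\<^bsub>U D\<^esub>" if "x \<in> J" for x
        using f(2)[OF that] left_idealD(1)[OF J that] w by simp
      then show ?thesis using insert.prems(3) by (intro IH)
    qed
  qed
qed

theorem density:
  assumes W: "\<And>C. C \<in> \<C> \<Longrightarrow> K_subspace G (U C) (W C)"
    and D: "D \<in> \<C>" and u: "u \<in> carrier (U D)"
    and ann: "\<And>x. x \<in> common_ann (SIGMA C:\<C>. W C) \<Longrightarrow> x \<odot>\<^bsub>U D\<^esub> u = \<zero>\<^bsub>U D\<^esub>"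
  shows "u \<in> W D"
proof -
  let ?S = "SIGMA C:\<C>. W C"
  have S: "?S \<subseteq> (SIGMA C:\<C>. carrier (U C))"
    using W ga_module.K_subspace_subset[OF ga_module_U] by fastforce
  obtain F where F: "finite F" "F \<subseteq> ?S"
    "alg \<inter> (\<Inter>p\<in>F. common_ann {p}) \<subseteq> (\<Inter>p\<in>?S. common_ann {p})"
  proof (rule finite_subfamily)
    show "left_ideal (common_ann {p})" if "p \<in> ?S" for p
      using that S by (intro left_ideal_common_ann) blast
  qed
  show ?thesis
  proof (rule density_finite[OF F(1) _ D W[OF D] _ u])
    show "F \<subseteq> (SIGMA C:\<C>. carrier (U C))" using F S by blast
    show "w \<in> W D" if "(D, w) \<in> F" for w using that F by blast
    show "x \<odot>\<^bsub>U D\<^esub> u = \<zero>\<^bsub>U D\<^esub>" if x: "x \<in> common_ann F" for x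
    proof (rule ann)
      have "x \<in> alg" using x by (simp add: common_ann_def)
      moreover have "x \<in> (\<Inter>p\<in>?S. common_ann {p})"
        using x by (intro subsetD[OF F(3)]) (auto simp: common_ann_def)
      ultimately show "x \<in> common_ann ?S" by (auto simp: common_ann_def)
    qed
  qed
qed

end

section \<open>Left ideals as modules with carrier in a given type\<close>

text \<open>An infinite set has as many elements as its square. Iterating this, a finite-dimensional space over
  an infinite field embeds into the field.\<close>

lemma ex_inj_pair:
  assumes "infinite (UNIV :: 'k set)"
  shows "\<exists>p :: 'k \<times> 'k \<Rightarrow> 'k. inj p"
proof -
  have "(card_of (UNIV :: ('k \<times> 'k) set), card_of (UNIV :: 'k set)) \<in> ordIso"
    using card_of_Times_same_infinite[OF assms] by simp
  then obtain p :: "'k \<times> 'k \<Rightarrow> 'k" where "bij_betw p UNIV UNIV"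
    using card_of_ordIso[of "UNIV :: ('k \<times> 'k) set" "UNIV :: 'k set"] by blast
  then show ?thesis by (auto simp: bij_betw_def)
qed

lemma ex_inj_finite_support:
  fixes S :: "'i set"
  assumes "finite S" "infinite (UNIV :: 'k::zero set)"
  shows "\<exists>j :: ('i \<Rightarrow> 'k) \<Rightarrow> 'k. inj_on j {f. \<forall>i. i \<notin> S \<longrightarrow> f i = 0}"
  using assms(1)
proof induction
  case empty
  then show ?case by (auto simp: inj_on_def fun_eq_iff)
next
  case (insert s S)
  then obtain j :: "('i \<Rightarrow> 'k) \<Rightarrow> 'k" where j: "inj_on j {f. \<forall>i. i \<notin> S \<longrightarrow> f i = 0}" by auto
  obtain p :: "'k \<times> 'k \<Rightarrow> 'k" where p: "inj p" using ex_inj_pair[OF assms(2)] by auto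
  have "inj_on (\<lambda>f. p (f s, j (f(s := 0)))) {f. \<forall>i. i \<notin> insert s S \<longrightarrow> f i = 0}"
  proof (rule inj_onI)
    fix f g :: "'i \<Rightarrow> 'k"
    assume fg: "f \<in> {f. \<forall>i. i \<notin> insert s S \<longrightarrow> f i = 0}" "g \<in> {f. \<forall>i. i \<notin> insert s S \<longrightarrow> f i = 0}"
      "p (f s, j (f(s := 0))) = p (g s, j (g(s := 0)))"
    then have "(f s, j (f(s := 0))) = (g s, j (g(s := 0)))" using injD[OF p] by blast
    then have eq: "f s = g s" "j (f(s := 0)) = j (g(s := 0))" by simp_all
    have "f(s := 0) = g(s := 0)"
    proof (rule inj_onD[OF j])
      show "j (f(s := 0)) = j (g(s := 0))" by (rule eq(2))
    qed (use fg in auto)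
    then have "(f(s := 0)) i = (g(s := 0)) i" for i by simp
    then show "f = g" using eq(1) by (intro ext) (metis fun_upd_other)
  qed
  then show ?case by blast
qed

locale glider_setting = finite_group G for G :: "('g, 'm) monoid_scheme" (structure) +
  fixes \<iota> :: "'k::{alg_closed_field, field_char_0} \<Rightarrow> 'v"
  assumes inj_\<iota>: "inj \<iota>"
begin

text \<open>An embedding of \<open>K[G]\<close> into the type of module elements; it exists because \<open>K\<close> is infinite.\<close>

definition code :: "('g \<Rightarrow> 'k) \<Rightarrow> 'v"
  where "code = (SOME j. inj_on j alg)"

lemma inj_code: "inj_on code alg"
proof -
  obtain j :: "('g \<Rightarrow> 'k) \<Rightarrow> 'k" where "inj_on j alg"
    using ex_inj_finite_support[OF finite_carrier infinite_UNIV_char_0[where ?'a = 'k]] by (auto simp: alg_def)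
  then have "inj_on (\<iota> \<circ> j) alg"
    using inj_\<iota> by (auto intro: comp_inj_on inj_on_subset)
  then show ?thesis unfolding code_def by (rule someI[of "\<lambda>j. inj_on j alg"])
qed

definition decode :: "'v \<Rightarrow> 'g \<Rightarrow> 'k"
  where "decode = inv_into alg code"

lemma decode_code [simp]: "x \<in> alg \<Longrightarrow> decode (code x) = x"
  using inj_code by (simp add: decode_def)

text \<open>The left ideal \<open>L\<close>, as a left module, transported along \<open>code\<close>. All modules needed
  to realise irreducible modules and gliders are of this form, so no quotients have to be formed.\<close>

definition coded :: "('g \<Rightarrow> 'k) set \<Rightarrow> ('g, 'k, 'v) ga_module"
  where "coded L = \<lparr>carrier = code ` L, mult = undefined, one = undefined, zero = code 0,
    add = (\<lambda>x y. code (decode x + decode y)), smult = (\<lambda>a x. code (a \<star> decode x))\<rparr>"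

lemma coded_sel [simp]:
  "carrier (coded L) = code ` L" "\<zero>\<^bsub>coded L\<^esub> = code 0"
  "x \<oplus>\<^bsub>coded L\<^esub> y = code (decode x + decode y)" "a \<odot>\<^bsub>coded L\<^esub> x = code (a \<star> decode x)"
  by (simp_all add: coded_def)

lemma code_eq_iff: "x \<in> alg \<Longrightarrow> y \<in> alg \<Longrightarrow> code x = code y \<longleftrightarrow> x = y"
  using inj_code by (auto dest: inj_onD)

lemma ga_module_coded:
  assumes "left_ideal L"
  shows "ga_module G (coded L)"
proof (rule ga_moduleI)
  note L = left_idealD[OF assms]
  show "left_module (group_algebra G) (coded L)"
    unfolding left_module_def left_module_axioms_def
  proof (intro conjI ring_group_algebra abelian_groupI allI impI)
    show "\<zero>\<^bsub>coded L\<^esub> \<in> carrier (coded L)" using L(2) by simp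
    fix x assume x: "x \<in> carrier (coded L)"
    then obtain a where a: "a \<in> L" "x = code a" by auto
    have "- a \<in> L" using left_ideal_diff[OF assms L(2) a(1)] by simp
    then show "\<exists>y\<in>carrier (coded L). y \<oplus>\<^bsub>coded L\<^esub> x = \<zero>\<^bsub>coded L\<^esub>"
      using a L(1) by (intro bexI[of _ "code (- a)"]) auto
  qed (use L in \<open>auto simp: conv_add_left conv_add_right conv_assoc ac_simps\<close>)
qed

lemma irreducible_coded:
  assumes "minimal_left_ideal L"
  shows "irreducible_module G (coded L)"
proof -
  have L: "left_ideal L" "L \<noteq> {0}"
    and min: "\<And>L'. left_ideal L' \<Longrightarrow> L' \<subseteq> L \<Longrightarrow> L' = {0} \<or> L' = L"
    using assms by (auto simp: minimal_left_ideal_def)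
  note Lalg = left_idealD(1)[OF L(1)]
  interpret L: ga_module G "coded L" using L(1) by (rule ga_module_coded)
  have "H = {\<zero>\<^bsub>coded L\<^esub>} \<or> H = carrier (coded L)"
    if "Module.submodule H (group_algebra G) (coded L)" for H
  proof -
    have H: "H \<subseteq> code ` L" "code 0 \<in> H" "\<And>x y. x \<in> H \<Longrightarrow> y \<in> H \<Longrightarrow> code (decode x + decode y) \<in> H"
      "\<And>a x. a \<in> alg \<Longrightarrow> x \<in> H \<Longrightarrow> code (a \<star> decode x) \<in> H"
      using that unfolding L.submodule_iff by auto
    define L' where "L' = {l \<in> L. code l \<in> H}"
    have "left_ideal L'"
      unfolding left_ideal_def
    proof (intro conjI ballI)
      show "L' \<subseteq> alg" using Lalg by (auto simp: L'_def)
      show "0 \<in> L'" using H left_idealD(2)[OF L(1)] by (simp add: L'_def)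
      show "x + y \<in> L'" if "x \<in> L'" "y \<in> L'" for x y
        using that H(3)[of "code x" "code y"] Lalg left_idealD(3)[OF L(1), of x y] by (auto simp: L'_def)
      show "a \<star> y \<in> L'" if "a \<in> alg" "y \<in> L'" for a y
        using that H(4)[of a "code y"] Lalg left_idealD(4)[OF L(1), of a y] by (auto simp: L'_def)
    qed
    then have "L' = {0} \<or> L' = L" by (intro min) (auto simp: L'_def)
    moreover have "H = code ` L'" using H(1) by (auto simp: L'_def)
    ultimately show ?thesis by auto
  qed
  moreover have "carrier (coded L) \<noteq> {\<zero>\<^bsub>coded L\<^esub>}"
  proof
    assume "carrier (coded L) = {\<zero>\<^bsub>coded L\<^esub>}"
    then have "l = 0" if "l \<in> L" for l
      using that Lalg[OF that] code_eq_iff[of l 0] by auto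
    then show False using L left_idealD(2)[OF L(1)] by blast
  qed
  ultimately show ?thesis
    using L.mod.left_module_axioms by (simp add: irreducible_module_def)
qed

lemma irreducible_module_separates:
  assumes I: "left_ideal I" and x: "x \<in> alg" "x \<notin> I"
  obtains U :: "('g, 'k, 'v) ga_module" and u where "irreducible_module G U" "u \<in> carrier U"
    "\<And>y. y \<in> I \<Longrightarrow> y \<odot>\<^bsub>U\<^esub> u = \<zero>\<^bsub>U\<^esub>" "x \<odot>\<^bsub>U\<^esub> u \<noteq> \<zero>\<^bsub>U\<^esub>"
proof -
  obtain L u where L: "minimal_left_ideal L" "u \<in> L" "\<And>y. y \<in> I \<Longrightarrow> y \<star> u = 0" "x \<star> u \<noteq> 0"
    using minimal_left_ideal_separates[OF I x] by blast
  then have u: "u \<in> alg" by (auto simp: minimal_left_ideal_def dest: left_idealD(1))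
  show thesis
  proof (rule that[OF irreducible_coded[OF L(1)], of "code u"])
    show "code u \<in> carrier (coded L)" using L(2) by simp
    show "y \<odot>\<^bsub>coded L\<^esub> code u = \<zero>\<^bsub>coded L\<^esub>" if "y \<in> I" for y
      using u L(3)[OF that] by simp
    show "x \<odot>\<^bsub>coded L\<^esub> code u \<noteq> \<zero>\<^bsub>coded L\<^esub>"
      using u L(4) by (simp add: code_eq_iff)
  qed
qed

section \<open>Isomorphism classes of irreducible modules\<close>

lemma module_iso_refl: "module_iso G U U"
  unfolding module_iso_def
  by (rule bexI[of _ id]) (auto simp: LinearCombinations.module_hom_def)

lemma module_iso_trans: "module_iso G U V \<Longrightarrow> module_iso G V W \<Longrightarrow> module_iso G U W"
proof -
  assume "module_iso G U V" "module_iso G V W"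
  then obtain f g where "f \<in> LinearCombinations.module_hom (group_algebra G) U V" "bij_betw f (carrier U) (carrier V)"
    "g \<in> LinearCombinations.module_hom (group_algebra G) V W" "bij_betw g (carrier V) (carrier W)"
    by (auto simp: module_iso_def)
  then show "module_iso G U W"
    unfolding module_iso_def
    by (intro bexI[of _ "g \<circ> f"] bij_betw_trans) (auto simp: LinearCombinations.module_hom_def Pi_iff)
qed

lemma module_iso_sym:
  assumes "ga_module G U" "ga_module G V" "module_iso G U V"
  shows "module_iso G V U"
proof -
  interpret U: ga_module G U by fact
  interpret V: ga_module G V by fact
  obtain f where f: "f \<in> LinearCombinations.module_hom (group_algebra G) U V"
    and bij: "bij_betw f (carrier U) (carrier V)"
    using assms(3) by (auto simp: module_iso_def)
  define h where "h = inv_into (carrier U) f"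
  have h: "h y \<in> carrier U" "f (h y) = y" if "y \<in> carrier V" for y
    using bij that by (auto simp: h_def bij_betw_def inv_into_into f_inv_into_f)
  have hf: "h (f x) = x" if "x \<in> carrier U" for x
    using bij that by (auto simp: h_def bij_betw_def)
  note fh = U.module_homD[OF f]
  have "h \<in> LinearCombinations.module_hom (group_algebra G) V U"
    unfolding LinearCombinations.module_hom_def
  proof (intro CollectI conjI allI impI Pi_I)
    show "h y \<in> carrier U" if "y \<in> carrier V" for y using h that by simp
    show "h (y \<oplus>\<^bsub>V\<^esub> z) = h y \<oplus>\<^bsub>U\<^esub> h z" if "y \<in> carrier V \<and> z \<in> carrier V" for y z
      using that h fh(2)[of "h y" "h z"] hf[of "h y \<oplus>\<^bsub>U\<^esub> h z"] by simp
    show "h (r \<odot>\<^bsub>V\<^esub> y) = r \<odot>\<^bsub>U\<^esub> h y" if "r \<in> carrier (group_algebra G) \<and> y \<in> carrier V" for r y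
      using that h fh(3)[of r "h y"] hf[of "r \<odot>\<^bsub>U\<^esub> h y"] by simp
  qed
  moreover have "bij_betw h (carrier V) (carrier U)"
    unfolding h_def using bij by (rule bij_betw_inv_into)
  ultimately show ?thesis by (auto simp: module_iso_def)
qed

abbreviation irr_rel :: "(('g, 'k, 'v) ga_module \<times> ('g, 'k, 'v) ga_module) set"
  where "irr_rel \<equiv> {(U, V). irreducible_module G U \<and> irreducible_module G V \<and> module_iso G U V}"

lemma irreducible_imp_ga_module: "irreducible_module G U \<Longrightarrow> ga_module G U"
  by (intro ga_moduleI) (simp add: irreducible_module_def)

lemma equiv_irr_rel: "equiv {U. irreducible_module G U} irr_rel"
proof (rule equivI)
  show "irr_rel \<subseteq> {U. irreducible_module G U} \<times> {U. irreducible_module G U}" by auto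
  show "refl_on {U. irreducible_module G U} irr_rel"
    by (rule refl_onI) (auto simp: module_iso_refl)
  show "sym irr_rel" by (auto intro!: symI module_iso_sym irreducible_imp_ga_module)
  show "trans irr_rel" by (auto intro!: transI intro: module_iso_trans)
qed

abbreviation Irr_v :: "('g, 'k, 'v) ga_module set set" where "Irr_v \<equiv> Irr G"

lemma irr_rep_in: "C \<in> Irr_v \<Longrightarrow> irr_rep C \<in> C"
  unfolding irr_rep_def Irr_def using in_quotient_imp_non_empty[OF equiv_irr_rel] by (intro some_in_eq[THEN iffD2])

lemma irr_rep_irreducible: "C \<in> Irr_v \<Longrightarrow> irreducible_module G (irr_rep C)"
  using irr_rep_in[of C] in_quotient_imp_subset[OF equiv_irr_rel, of C] by (auto simp: Irr_def)

lemma irr_rep_unique: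
  assumes "C \<in> Irr_v" "D \<in> Irr_v" "module_iso G (irr_rep C) (irr_rep D)"
  shows "C = D"
  using quotient_eqI[OF equiv_irr_rel, of C D "irr_rep C" "irr_rep D"] assms irr_rep_in irr_rep_irreducible
  by (auto simp: Irr_def)

lemma irr_rep_exists:
  assumes "irreducible_module G (U :: ('g, 'k, 'v) ga_module)"
  obtains C where "C \<in> Irr_v" "module_iso G U (irr_rep C)"
proof -
  define C where "C = irr_rel `` {U}"
  have C: "C \<in> Irr_v" unfolding C_def Irr_def using assms by (intro quotientI) simp
  moreover have "module_iso G U (irr_rep C)"
    using irr_rep_in[OF C] unfolding C_def by auto
  ultimately show thesis by (rule that)
qed

sublocale irr: irreducible_family G irr_rep "Irr_v"
  using irr_rep_irreducible irr_rep_unique by unfold_locales auto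

lemma irr_rep_separates:
  assumes I: "left_ideal I" and x: "x \<in> alg" "x \<notin> I"
  obtains C u where "C \<in> Irr_v" "u \<in> carrier (irr_rep C)"
    "\<And>y. y \<in> I \<Longrightarrow> y \<odot>\<^bsub>irr_rep C\<^esub> u = \<zero>\<^bsub>irr_rep C\<^esub>" "x \<odot>\<^bsub>irr_rep C\<^esub> u \<noteq> \<zero>\<^bsub>irr_rep C\<^esub>"
proof -
  obtain U :: "('g, 'k, 'v) ga_module" and u where U: "irreducible_module G U" "u \<in> carrier U"
    "\<And>y. y \<in> I \<Longrightarrow> y \<odot>\<^bsub>U\<^esub> u = \<zero>\<^bsub>U\<^esub>" "x \<odot>\<^bsub>U\<^esub> u \<noteq> \<zero>\<^bsub>U\<^esub>"
    using irreducible_module_separates[OF I x] by blast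
  obtain C where C: "C \<in> Irr_v" "module_iso G U (irr_rep C)" using irr_rep_exists[OF U(1)] .
  interpret U: ga_module G U using U(1) by (rule irreducible_imp_ga_module)
  interpret C: ga_module G "irr_rep C" using C(1) by (rule irr.ga_module_U)
  obtain f where f: "f \<in> LinearCombinations.module_hom (group_algebra G) U (irr_rep C)"
    and bij: "bij_betw f (carrier U) (carrier (irr_rep C))"
    using C(2) by (auto simp: module_iso_def)
  note fh = U.module_homD[OF f] and f0 = U.module_hom_zero[OF C.ga_module_axioms f]
  show thesis
  proof (rule that[OF C(1), of "f u"])
    show "f u \<in> carrier (irr_rep C)" using fh U by simp
    show "y \<odot>\<^bsub>irr_rep C\<^esub> f u = \<zero>\<^bsub>irr_rep C\<^esub>" if "y \<in> I" for y
      using U(2,3) fh(3)[of y u] f0 that left_idealD(1)[OF I] by simp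
    have "f (x \<odot>\<^bsub>U\<^esub> u) \<noteq> f \<zero>\<^bsub>U\<^esub>"
      using bij U(2,4) x by (auto simp: bij_betw_def dest: inj_onD)
    then show "x \<odot>\<^bsub>irr_rep C\<^esub> f u \<noteq> \<zero>\<^bsub>irr_rep C\<^esub>"
      using fh(3)[of x u] f0 x U(2) by simp
  qed
qed

section \<open>Left ideals and families of subspaces\<close>

text \<open>The subspace \<open>W\<^sub>U\<close> of the introduction, for the representative \<open>U\<close> of the class \<open>C\<close>.\<close>

definition killed :: "('g \<Rightarrow> 'k) set \<Rightarrow> ('g, 'k, 'v) ga_module set \<Rightarrow> 'v set"
  where "killed I C = {u \<in> carrier (irr_rep C). \<forall>y\<in>I. y \<odot>\<^bsub>irr_rep C\<^esub> u = \<zero>\<^bsub>irr_rep C\<^esub>}"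

lemma K_subspace_killed:
  assumes "left_ideal I" "C \<in> Irr_v"
  shows "K_subspace G (irr_rep C) (killed I C)"
proof -
  interpret C: ga_module G "irr_rep C" using assms(2) by (rule irr.ga_module_U)
  have "y \<odot>\<^bsub>irr_rep C\<^esub> (scalar G c \<odot>\<^bsub>irr_rep C\<^esub> u) = \<zero>\<^bsub>irr_rep C\<^esub>"
    if "u \<in> killed I C" "y \<in> I" for u y c
  proof -
    have "y \<in> alg" using assms(1) that(2) by (rule left_idealD(1))
    then show ?thesis using that by (auto simp: killed_def C.act_zero_right simp flip: C.scalar_act_act)
  qed
  then show ?thesis
    unfolding C.K_subspace_iff using left_idealD(1)[OF assms(1)]
    by (auto simp: killed_def C.act_add_right)
qed

abbreviation ideal_of :: "(('g, 'k, 'v) ga_module set \<Rightarrow> 'v set) \<Rightarrow> ('g \<Rightarrow> 'k) set"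
  where "ideal_of W \<equiv> irr.common_ann (SIGMA C:Irr_v. W C)"

lemma ideal_of_killed:
  assumes I: "left_ideal I"
  shows "ideal_of (killed I) = I"
proof
  show "I \<subseteq> ideal_of (killed I)"
    using left_idealD(1)[OF I] by (auto simp: irr.common_ann_def killed_def)
  show "ideal_of (killed I) \<subseteq> I"
  proof
    fix x assume x: "x \<in> ideal_of (killed I)"
    show "x \<in> I"
    proof (rule ccontr)
      assume "x \<notin> I"
      moreover have "x \<in> alg" using x by (simp add: irr.common_ann_def)
      ultimately obtain C u where "C \<in> Irr_v" "u \<in> carrier (irr_rep C)"
        "\<And>y. y \<in> I \<Longrightarrow> y \<odot>\<^bsub>irr_rep C\<^esub> u = \<zero>\<^bsub>irr_rep C\<^esub>" "x \<odot>\<^bsub>irr_rep C\<^esub> u \<noteq> \<zero>\<^bsub>irr_rep C\<^esub>"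
        using irr_rep_separates[OF I] by blast
      then show False using x by (auto simp: irr.common_ann_def killed_def)
    qed
  qed
qed

lemma left_ideal_ideal_of:
  assumes "\<And>C. C \<in> Irr_v \<Longrightarrow> K_subspace G (irr_rep C) (W C)"
  shows "left_ideal (ideal_of W)"
  using assms ga_module.K_subspace_subset[OF irr.ga_module_U] by (intro irr.left_ideal_common_ann) fastforce

lemma killed_ideal_of:
  assumes W: "\<And>C. C \<in> Irr_v \<Longrightarrow> K_subspace G (irr_rep C) (W C)" and D: "D \<in> Irr_v"
  shows "killed (ideal_of W) D = W D"
proof
  show "killed (ideal_of W) D \<subseteq> W D"
    using irr.density[OF W D] by (auto simp: killed_def)
  show "W D \<subseteq> killed (ideal_of W) D"
    using D ga_module.K_subspace_subset[OF irr.ga_module_U[OF D] W[OF D]]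
    by (auto simp: killed_def irr.common_ann_def)
qed

section \<open>Dimensions and the combinatorial data\<close>

lemma irr_K_fin_dim: "C \<in> Irr_v \<Longrightarrow> K_fin_dim G (irr_rep C) (carrier (irr_rep C))"
  using ga_module.irreducible_K_fin_dim[OF irr.ga_module_U irr_rep_irreducible] .

text \<open>It lets the Grassmannians be replaced by sets of nonzero subspaces, and the choice of a subspace of a
  one-dimensional module by a yes-or-no decision.\<close>

lemma nonzero_subspace_dim:
  assumes "C \<in> Irr_v" "K_subspace G (irr_rep C) W"
  shows "K_dim G (irr_rep C) W \<in> {1..irr_dim G C} \<longleftrightarrow> W \<noteq> {\<zero>\<^bsub>irr_rep C\<^esub>}"
    and "W \<noteq> {\<zero>\<^bsub>irr_rep C\<^esub>} \<Longrightarrow> irr_dim G C = 1 \<Longrightarrow> W = carrier (irr_rep C)"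
proof -
  interpret C: ga_module G "irr_rep C" using assms(1) by (rule irr.ga_module_U)
  note fd = C.K_fin_dim_subspace[OF C.K_subspace_carrier irr_K_fin_dim[OF assms(1)] assms(2)
      C.K_subspace_subset[OF assms(2)]]
  have zero: "K_dim G (irr_rep C) W = 0 \<longleftrightarrow> W = {\<zero>\<^bsub>irr_rep C\<^esub>}"
    using C.K_dim_eq_0_iff[OF assms(2) fd(1)] .
  then show "K_dim G (irr_rep C) W \<in> {1..irr_dim G C} \<longleftrightarrow> W \<noteq> {\<zero>\<^bsub>irr_rep C\<^esub>}"
    using fd(2) by (auto simp: irr_dim_def)
  show "W = carrier (irr_rep C)" if "W \<noteq> {\<zero>\<^bsub>irr_rep C\<^esub>}" "irr_dim G C = 1"
    using fd(2) zero that by (intro fd(3)) (auto simp: irr_dim_def)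
qed

lemma irr_dim_pos: "C \<in> Irr_v \<Longrightarrow> irr_dim G C \<ge> 1"
  using nonzero_subspace_dim(1)[OF _ ga_module.K_subspace_carrier[OF irr.ga_module_U], of C]
    irr_rep_irreducible[of C] by (auto simp: irreducible_module_def irr_dim_def)

text \<open>The condition on the dimensions \<open>i\<close> and \<open>j\<close> and the singleton condition together say that \<open>B\<close> is a
  partial function from classes to nonzero subspaces.\<close>

lemma S_G_iff:
  "B \<in> S_G G \<longleftrightarrow>
     B \<subseteq> {(C, W). C \<in> Irr_v \<and> irr_dim G C > 1 \<and> K_subspace G (irr_rep C) W \<and> W \<noteq> {\<zero>\<^bsub>irr_rep C\<^esub>}} \<and>
     (\<forall>C W W'. (C, W) \<in> B \<longrightarrow> (C, W') \<in> B \<longrightarrow> W = W')"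
  (is "_ \<longleftrightarrow> B \<subseteq> ?X \<and> ?single")
proof -
  have Gr: "W \<in> Gr G C \<longleftrightarrow> K_subspace G (irr_rep C) W \<and> W \<noteq> {\<zero>\<^bsub>irr_rep C\<^esub>}" if "C \<in> Irr_v" for C W
    using nonzero_subspace_dim(1)[OF that, of W] by (auto simp: Gr_def Gr_dim_def)
  have X: "(SIGMA C:{C \<in> Irr_v. irr_dim G C > 1}. Gr G C) = ?X"
    using Gr by auto
  show ?thesis
  proof
    assume B: "B \<in> S_G G"
    then have sub: "B \<subseteq> ?X" unfolding S_G_def X by simp
    have "W = W'" if CW: "(C, W) \<in> B" and CW': "(C, W') \<in> B" for C W W'
    proof -
      define i j where "i = K_dim G (irr_rep C) W" and "j = K_dim G (irr_rep C) W'"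
      have C: "C \<in> Irr_v" "irr_dim G C > 1" using CW sub by auto
      have i: "i \<in> {1..irr_dim G C}" and j: "j \<in> {1..irr_dim G C}"
        unfolding i_def j_def using CW CW' sub nonzero_subspace_dim(1)[OF C(1)] by blast+
      have mi: "(C, W) \<in> B \<inter> Pair C ` Gr_dim G i C" and mj: "(C, W') \<in> B \<inter> Pair C ` Gr_dim G j C"
        using CW CW' sub by (auto simp: Gr_dim_def i_def j_def)
      then have "i = j" using B C i j unfolding S_G_def by blast
      moreover have "is_singleton (B \<inter> Pair C ` Gr_dim G i C)"
        using B C i mi unfolding S_G_def by blast
      ultimately show "W = W'" using mi mj by (metis is_singletonE prod.inject singletonD)
    qed
    then show "B \<subseteq> ?X \<and> ?single" using sub by blast
  next
    assume B: "B \<subseteq> ?X \<and> ?single"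
    have "i = j" if "(C, W) \<in> B \<inter> Pair C ` Gr_dim G i C" "(C, W') \<in> B \<inter> Pair C ` Gr_dim G j C" for C W W' i j
    proof -
      have "W = W'" using B that by blast
      then show ?thesis using that by (auto simp: Gr_dim_def)
    qed
    moreover have "is_singleton (B \<inter> Pair C ` Gr_dim G j C)" if ne: "B \<inter> Pair C ` Gr_dim G j C \<noteq> {}" for C j
    proof -
      obtain W where W: "(C, W) \<in> B" "W \<in> Gr_dim G j C" using ne by auto
      then have "B \<inter> Pair C ` Gr_dim G j C = {(C, W)}" using B by auto
      then show ?thesis by simp
    qed
    ultimately show "B \<in> S_G G" using B unfolding S_G_def X by blast
  qed
qed

definition linear_classes :: "('g, 'k, 'v) ga_module set set"
  where "linear_classes = {C \<in> Irr_v. irr_dim G C = 1}"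

definition linear_part :: "('g \<Rightarrow> 'k) set \<Rightarrow> ('g, 'k, 'v) ga_module set set"
  where "linear_part I = {C \<in> linear_classes. killed I C \<noteq> {\<zero>\<^bsub>irr_rep C\<^esub>}}"

definition nonlinear_part :: "('g \<Rightarrow> 'k) set \<Rightarrow> (('g, 'k, 'v) ga_module set \<times> 'v set) set"
  where "nonlinear_part I = {(C, killed I C) |C. C \<in> Irr_v \<and> irr_dim G C > 1 \<and> killed I C \<noteq> {\<zero>\<^bsub>irr_rep C\<^esub>}}"

lemma nonlinear_part_iff:
  "(C, V) \<in> nonlinear_part I \<longleftrightarrow>
     C \<in> Irr_v \<and> irr_dim G C > 1 \<and> V = killed I C \<and> V \<noteq> {\<zero>\<^bsub>irr_rep C\<^esub>}"
  by (auto simp: nonlinear_part_def)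

text \<open>The families of subspaces, split according to the dimension of the module. On a
  one-dimensional module a subspace carries only the information whether it is zero.\<close>

lemma bij_betw_left_ideals:
  "bij_betw (\<lambda>I. (linear_part I, nonlinear_part I)) {I. left_ideal I \<and> I \<noteq> alg}
     (Pow linear_classes \<times> S_G G - {({}, {})})"
  unfolding bij_betw_def
proof (intro conjI equalityI subsetI)
  show "inj_on (\<lambda>I. (linear_part I, nonlinear_part I)) {I. left_ideal I \<and> I \<noteq> alg}"
  proof (rule inj_onI)
    fix I J :: "('g \<Rightarrow> 'k) set"
    assume "I \<in> {I. left_ideal I \<and> I \<noteq> alg}" "J \<in> {I. left_ideal I \<and> I \<noteq> alg}"
    then have I: "left_ideal I" and J: "left_ideal J" by auto
    assume eq: "(linear_part I, nonlinear_part I) = (linear_part J, nonlinear_part J)"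
    have "killed I C = killed J C" if C: "C \<in> Irr_v" for C
    proof (cases "irr_dim G C = 1")
      case True
      then have "killed I C \<noteq> {\<zero>\<^bsub>irr_rep C\<^esub>} \<longleftrightarrow> killed J C \<noteq> {\<zero>\<^bsub>irr_rep C\<^esub>}"
        using eq C unfolding linear_part_def linear_classes_def by blast
      then show ?thesis
        using nonzero_subspace_dim(2)[OF C K_subspace_killed[OF I C] _ True]
          nonzero_subspace_dim(2)[OF C K_subspace_killed[OF J C] _ True] by metis
    next
      case False
      then have "irr_dim G C > 1" using irr_dim_pos[OF C] by simp
      moreover have "(C, V) \<in> nonlinear_part I \<longleftrightarrow> (C, V) \<in> nonlinear_part J" for V
        using eq by simp
      ultimately show ?thesis using C unfolding nonlinear_part_iff by metis
    qed
    then have "ideal_of (killed I) = ideal_of (killed J)" by (auto simp: irr.common_ann_def)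
    then show "I = J" using ideal_of_killed I J by simp
  qed
next
  fix p assume "p \<in> (\<lambda>I. (linear_part I, nonlinear_part I)) ` {I. left_ideal I \<and> I \<noteq> alg}"
  then obtain I where I: "left_ideal I" "I \<noteq> alg" "p = (linear_part I, nonlinear_part I)" by auto
  have "linear_part I \<noteq> {} \<or> nonlinear_part I \<noteq> {}"
  proof (rule ccontr)
    assume "\<not> ?thesis"
    then have "killed I C = {\<zero>\<^bsub>irr_rep C\<^esub>}" if "C \<in> Irr_v" for C
      using that irr_dim_pos[OF that] unfolding linear_part_def linear_classes_def nonlinear_part_def
      by (cases "irr_dim G C = 1") auto
    then have "ideal_of (killed I) = alg"
      using ga_module.act_zero_right[OF irr.ga_module_U] by (auto simp: irr.common_ann_def)
    then show False using I ideal_of_killed by simp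
  qed
  moreover have "nonlinear_part I \<in> S_G G"
    unfolding S_G_iff using K_subspace_killed[OF I(1)] by (auto simp: nonlinear_part_def)
  moreover have "linear_part I \<subseteq> linear_classes" by (auto simp: linear_part_def)
  ultimately show "p \<in> Pow linear_classes \<times> S_G G - {({}, {})}" using I(3) by auto
next
  fix p :: "('g, 'k, 'v) ga_module set set \<times> (('g, 'k, 'v) ga_module set \<times> 'v set) set"
  assume p: "p \<in> Pow linear_classes \<times> S_G G - {({}, {})}"
  obtain A B where AB: "p = (A, B)" "A \<subseteq> linear_classes" "B \<in> S_G G" "A \<noteq> {} \<or> B \<noteq> {}"
    using p by auto
  have B: "B \<subseteq> {(C, W). C \<in> Irr_v \<and> irr_dim G C > 1 \<and> K_subspace G (irr_rep C) W \<and> W \<noteq> {\<zero>\<^bsub>irr_rep C\<^esub>}}"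
    and single: "\<And>C W W'. (C, W) \<in> B \<Longrightarrow> (C, W') \<in> B \<Longrightarrow> W = W'"
    using AB(3) unfolding S_G_iff by blast+
  \<comment> \<open>The family with prescribed data: everything on \<open>A\<close>, the chosen point on \<open>B\<close>, zero elsewhere.\<close>
  define W where "W C = (if C \<in> A then carrier (irr_rep C)
    else if \<exists>V. (C, V) \<in> B then THE V. (C, V) \<in> B else {\<zero>\<^bsub>irr_rep C\<^esub>})" for C
  have disj: "(C, V) \<notin> B" if "C \<in> A" for C V
    using that AB(2) B unfolding linear_classes_def by fastforce
  have WB: "W C = V" if CV: "(C, V) \<in> B" for C V
  proof -
    have "(THE V. (C, V) \<in> B) = V" using CV single[OF _ CV] by (rule the_equality)
    then show ?thesis using CV disj by (auto simp: W_def)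
  qed
  have WA: "W C = carrier (irr_rep C)" if "C \<in> A" for C using that by (simp add: W_def)
  have W0: "W C = {\<zero>\<^bsub>irr_rep C\<^esub>}" if "C \<notin> A" "\<And>V. (C, V) \<notin> B" for C using that by (simp add: W_def)
  have sub: "K_subspace G (irr_rep C) (W C)" if C: "C \<in> Irr_v" for C
  proof -
    interpret C: ga_module G "irr_rep C" using C by (rule irr.ga_module_U)
    consider "C \<in> A" | V where "(C, V) \<in> B" | "C \<notin> A" "\<And>V. (C, V) \<notin> B" by blast
    then show ?thesis
    proof cases
      case 1
      then show ?thesis using WA C.K_subspace_carrier by simp
    next
      case 2
      then show ?thesis using WB B by auto
    next
      case 3
      then show ?thesis using W0 by (simp add: C.K_subspace_iff)
    qed
  qed
  have killed: "killed (ideal_of W) C = W C" if "C \<in> Irr_v" for C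
    using killed_ideal_of[of W C] sub that by blast
  have nz: "carrier (irr_rep C) \<noteq> {\<zero>\<^bsub>irr_rep C\<^esub>}" if "C \<in> Irr_v" for C
    using irr_rep_irreducible[OF that] by (simp add: irreducible_module_def)
  have lin: "linear_part (ideal_of W) = A"
  proof (intro equalityI subsetI)
    fix C assume "C \<in> linear_part (ideal_of W)"
    then have C: "C \<in> Irr_v" "irr_dim G C = 1" "W C \<noteq> {\<zero>\<^bsub>irr_rep C\<^esub>}"
      using killed by (auto simp: linear_part_def linear_classes_def)
    have "(C, V) \<notin> B" for V using C(2) B by fastforce
    then show "C \<in> A" using C(3) W0 by blast
  next
    fix C assume C: "C \<in> A"
    then show "C \<in> linear_part (ideal_of W)"
      using AB(2) killed WA nz by (auto simp: linear_part_def linear_classes_def)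
  qed
  have nonlin: "nonlinear_part (ideal_of W) = B"
  proof (intro equalityI subsetI)
    fix q assume "q \<in> nonlinear_part (ideal_of W)"
    then obtain C where C: "C \<in> Irr_v" "irr_dim G C > 1" "W C \<noteq> {\<zero>\<^bsub>irr_rep C\<^esub>}" "q = (C, W C)"
      using killed by (auto simp: nonlinear_part_def)
    have "C \<notin> A" using C(2) AB(2) by (auto simp: linear_classes_def)
    then obtain V where "(C, V) \<in> B" using W0 C(3) by blast
    then show "q \<in> B" using WB C(4) by simp
  next
    fix q assume q: "q \<in> B"
    obtain C V where "q = (C, V)" by (cases q)
    with q have CV: "q = (C, V)" "C \<in> Irr_v" "irr_dim G C > 1" "V \<noteq> {\<zero>\<^bsub>irr_rep C\<^esub>}" using B by auto
    then have "W C = V" using q WB by simp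
    then show "q \<in> nonlinear_part (ideal_of W)"
      using CV killed[OF CV(2)] by (auto simp: nonlinear_part_def)
  qed
  have "ideal_of W \<noteq> alg"
  proof
    assume eq: "ideal_of W = alg"
    have "killed (ideal_of W) C = {\<zero>\<^bsub>irr_rep C\<^esub>}" if C: "C \<in> Irr_v" for C
    proof -
      interpret C: ga_module G "irr_rep C" using C by (rule irr.ga_module_U)
      have "u = \<zero>\<^bsub>irr_rep C\<^esub>" if "u \<in> killed (ideal_of W) C" for u
        using that C.act_one[of u] alg_single[OF one_closed, of 1] unfolding eq killed_def by auto
      then show ?thesis using C.act_zero_right unfolding eq by (auto simp: killed_def)
    qed
    then have "linear_part (ideal_of W) = {}" "nonlinear_part (ideal_of W) = {}"
      by (auto simp: linear_part_def linear_classes_def nonlinear_part_def)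
    then show False using lin nonlin AB(4) by simp
  qed
  then show "p \<in> (\<lambda>I. (linear_part I, nonlinear_part I)) ` {I. left_ideal I \<and> I \<noteq> alg}"
    using left_ideal_ideal_of[of W] sub lin nonlin AB(1) by (intro image_eqI[of _ _ "ideal_of W"]) auto
qed

end

section \<open>Irreducible gliders and left ideals\<close>

text \<open>Any complete invariant \<open>f\<close> of an equivalence relation identifies the classes with the values of
  \<open>f\<close>.\<close>

lemma bij_betw_quotient_kernel:
  assumes "f ` S = T"
  shows "bij_betw (\<lambda>C. f (SOME x. x \<in> C)) (S // {(x, y). x \<in> S \<and> y \<in> S \<and> f x = f y}) T"
proof -
  let ?r = "{(x, y). x \<in> S \<and> y \<in> S \<and> f x = f y}"
  have cls: "?r `` {x} = {y \<in> S. f y = f x}" if "x \<in> S" for x using that by auto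
  have val: "f (SOME y. y \<in> ?r `` {x}) = f x" if "x \<in> S" for x
    unfolding cls[OF that] using someI[of "\<lambda>y. y \<in> {y \<in> S. f y = f x}" x] that by auto
  show ?thesis
    unfolding bij_betw_def
  proof (intro conjI)
    show "inj_on (\<lambda>C. f (SOME x. x \<in> C)) (S // ?r)"
    proof (rule inj_onI)
      fix C D assume "C \<in> S // ?r" "D \<in> S // ?r" and eq: "f (SOME x. x \<in> C) = f (SOME x. x \<in> D)"
      then obtain x y where xy: "x \<in> S" "C = ?r `` {x}" "y \<in> S" "D = ?r `` {y}" by (auto elim!: quotientE)
      then have "f x = f y" using eq val by simp
      then show "C = D" using xy by auto
    qed
    have "(\<lambda>C. f (SOME x. x \<in> C)) ` (S // ?r) = (\<lambda>x. f (SOME y. y \<in> ?r `` {x})) ` S"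
      unfolding quotient_def by blast
    also have "\<dots> = T" using val assms by (metis (no_types, lifting) image_cong)
    finally show "(\<lambda>C. f (SOME x. x \<in> C)) ` (S // ?r) = T" .
  qed
qed

context ga_module
begin

lemma glider_chain_line_cyclic:
  assumes m: "m \<in> carrier M"
  shows "glider_chain G M (line m) (cyclic m)"
  unfolding glider_chain_def
  using m K_subspace_line[OF m] K_subspace_cyclic[OF m] line_subset_cyclic[of m] cyclic_closed(4)[OF m]
  by auto

lemma ann_line: "m \<in> carrier M \<Longrightarrow> ann (line m) = ann {m}"
proof -
  assume m: "m \<in> carrier M"
  have "x \<cdot> scalar G c \<cdot> m = \<zero>\<^bsub>M\<^esub>" if "x \<in> alg" "x \<cdot> m = \<zero>\<^bsub>M\<^esub>" for x c
    using that m scalar_act_act[of x m c] by simp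
  then show ?thesis using generator_in_line[OF m] by (auto simp: ann_def line_def)
qed

end

context finite_group
begin

text \<open>A nonzero vector \<open>m\<close> of the lower term yields the subglider \<open>K m \<subseteq> K[G] m\<close>, which irreducibility
  forces to be everything. Conversely, a nonzero vector in the lower term of a subglider of
  \<open>K m \<subseteq> K[G] m\<close> is a multiple of \<open>m\<close> and so generates both terms.\<close>

lemma irreducible_glider_iff:
  "irreducible_glider G X \<longleftrightarrow> ga_module G (ambient X) \<and>
     (\<exists>m\<in>carrier (ambient X). m \<noteq> \<zero>\<^bsub>ambient X\<^esub> \<and>
        lower X = ga_module.line G (ambient X) m \<and> upper X = ga_module.cyclic G (ambient X) m)"
  (is "_ \<longleftrightarrow> _ \<and> ?gen")
proof
  assume X: "irreducible_glider G X"
  then interpret M: ga_module G "ambient X"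
    by (intro ga_moduleI) (simp add: irreducible_glider_def is_glider_def)
  have chain: "glider_chain G (ambient X) (lower X) (upper X)" and "lower X \<noteq> {\<zero>\<^bsub>ambient X\<^esub>}"
    using X by (auto simp: irreducible_glider_def is_glider_def)
  then have low: "K_subspace G (ambient X) (lower X)" by (simp add: glider_chain_def)
  then obtain m where m: "m \<in> lower X" "m \<noteq> \<zero>\<^bsub>ambient X\<^esub>"
    using \<open>lower X \<noteq> _\<close> unfolding M.K_subspace_iff by blast
  then have mM: "m \<in> carrier (ambient X)" using M.K_subspace_subset[OF low] by blast
  have "M.line m \<subseteq> lower X" using low m(1) by (rule M.line_subset)
  moreover have "M.cyclic m \<subseteq> upper X"
    using chain m(1) by (auto simp: M.cyclic_def glider_chain_def)
  ultimately have "subglider G (M.line m) (M.cyclic m) X"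
    using M.glider_chain_line_cyclic[OF mM] by (simp add: subglider_def)
  moreover have "M.line m \<noteq> {\<zero>\<^bsub>ambient X\<^esub>}" using M.generator_in_line[OF mM] m(2) by auto
  ultimately have "(M.line m, M.cyclic m) = (lower X, upper X)"
    using X unfolding irreducible_glider_def by blast
  then show "ga_module G (ambient X) \<and> ?gen"
    using mM m(2) M.ga_module_axioms by auto
next
  assume *: "ga_module G (ambient X) \<and> ?gen"
  then interpret M: ga_module G "ambient X" by blast
  obtain m where m: "m \<in> carrier (ambient X)" "m \<noteq> \<zero>\<^bsub>ambient X\<^esub>"
    "lower X = M.line m" "upper X = M.cyclic m" using * by blast
  have chain: "glider_chain G (ambient X) (lower X) (upper X)"
    using M.glider_chain_line_cyclic[OF m(1)] m(3,4) by simp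
  have fd: "K_fin_dim G (ambient X) (upper X)" using M.K_fin_dim_cyclic[OF m(1)] m(4) by simp
  have "is_glider G X"
    unfolding is_glider_def
  proof (intro conjI chain fd)
    show "left_module (group_algebra G) (ambient X)" by (rule M.mod.left_module_axioms)
    show "K_fin_dim G (ambient X) (lower X)"
      using M.K_fin_dim_subspace(1)[OF M.K_subspace_cyclic[OF m(1)] M.K_fin_dim_cyclic[OF m(1)]
          M.K_subspace_line[OF m(1)] M.line_subset_cyclic] m(3) by simp
    show "lower X \<noteq> {\<zero>\<^bsub>ambient X\<^esub>}" using M.generator_in_line[OF m(1)] m(2,3) by auto
  qed
  moreover have "N1 = {\<zero>\<^bsub>ambient X\<^esub>}"
    if N: "subglider G N1 N0 X" "(N1, N0) \<noteq> (lower X, upper X)" for N1 N0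
  proof (rule ccontr)
    assume ne: "N1 \<noteq> {\<zero>\<^bsub>ambient X\<^esub>}"
    have ch: "K_subspace G (ambient X) N1" "N1 \<subseteq> M.line m" "N0 \<subseteq> M.cyclic m"
      and act: "\<And>x n. x \<in> alg \<Longrightarrow> n \<in> N1 \<Longrightarrow> x \<odot>\<^bsub>ambient X\<^esub> n \<in> N0"
      using N(1) m(3,4) by (auto simp: subglider_def glider_chain_def)
    obtain n where n: "n \<in> N1" "n \<noteq> \<zero>\<^bsub>ambient X\<^esub>" using ne ch(1) unfolding M.K_subspace_iff by blast
    then obtain c where c: "n = scalar G c \<odot>\<^bsub>ambient X\<^esub> m" using ch(2) by (auto simp: M.line_def)
    then have "c \<noteq> 0" using n(2) m(1) by auto
    have "scalar G (inverse c) \<odot>\<^bsub>ambient X\<^esub> n \<in> N1" using ch(1) n(1) by (simp add: M.K_subspace_iff)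
    then have "m \<in> N1" using c \<open>c \<noteq> 0\<close> m(1) by (simp add: M.scalar_inverse_act)
    then have "M.line m \<subseteq> N1" "M.cyclic m \<subseteq> N0"
      using M.line_subset[OF ch(1)] act by (auto simp: M.cyclic_def)
    then show False using ch(2,3) N(2) m(3,4) by auto
  qed
  ultimately show "irreducible_glider G X" unfolding irreducible_glider_def by blast
qed

definition glider_ann :: "('g, 'k::field, 'v) glider \<Rightarrow> ('g \<Rightarrow> 'k) set"
  where "glider_ann X = {x \<in> alg. \<forall>m\<in>lower X. x \<odot>\<^bsub>ambient X\<^esub> m = \<zero>\<^bsub>ambient X\<^esub>}"

lemma glider_ann_eq: "ga_module G (ambient X) \<Longrightarrow> glider_ann X = ga_module.ann G (ambient X) (lower X)"
  by (simp add: glider_ann_def ga_module.ann_def)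

lemma left_ideal_glider_ann:
  assumes "irreducible_glider G X"
  shows "left_ideal (glider_ann X)" "glider_ann X \<noteq> alg"
proof -
  interpret M: ga_module G "ambient X" using assms by (simp add: irreducible_glider_iff)
  obtain m where m: "m \<in> carrier (ambient X)" "m \<noteq> \<zero>\<^bsub>ambient X\<^esub>" "lower X = M.line m"
    using assms by (auto simp: irreducible_glider_iff)
  have ann: "glider_ann X = M.ann {m}"
    using m M.ann_line by (simp add: glider_ann_eq M.ga_module_axioms)
  show "left_ideal (glider_ann X)" unfolding ann using m by (intro M.left_ideal_ann) simp
  have "single 1 \<one> \<notin> M.ann {m}" using m by (simp add: M.ann_def)
  then show "glider_ann X \<noteq> alg" unfolding ann using alg_single[OF one_closed, of 1] by metis
qed

lemma glider_hom_zero: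
  assumes X: "ga_module G (ambient X)" and Y: "ga_module G (ambient Y)"
    and sub: "K_subspace G (ambient X) (upper X)" "K_subspace G (ambient Y) (upper Y)"
    and f: "f \<in> glider_hom G X Y"
  shows "f \<zero>\<^bsub>ambient X\<^esub> = \<zero>\<^bsub>ambient Y\<^esub>"
proof -
  interpret X: ga_module G "ambient X" by fact
  interpret Y: ga_module G "ambient Y" by fact
  have z: "\<zero>\<^bsub>ambient X\<^esub> \<in> upper X" using sub(1) by (simp add: X.K_subspace_iff)
  then have "f \<zero>\<^bsub>ambient X\<^esub> \<in> upper Y"
    using f by (auto simp: glider_hom_def LinearCombinations.module_hom_def)
  then have "f \<zero>\<^bsub>ambient X\<^esub> \<in> carrier (ambient Y)" using Y.K_subspace_subset[OF sub(2)] by blast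
  moreover have "f (scalar G c \<odot>\<^bsub>ambient X\<^esub> u) = scalar G c \<odot>\<^bsub>ambient Y\<^esub> f u" if "u \<in> upper X" for c u
    using f that unfolding glider_hom_def LinearCombinations.module_hom_def by simp
  from this[OF z, of 0] have "f (0 \<odot>\<^bsub>ambient X\<^esub> \<zero>\<^bsub>ambient X\<^esub>) = 0 \<odot>\<^bsub>ambient Y\<^esub> f \<zero>\<^bsub>ambient X\<^esub>"
    by (simp only: scalar_zero)
  ultimately show ?thesis by simp
qed

lemma glider_iso_imp_ann_subset:
  assumes X: "ga_module G (ambient X)" and Y: "ga_module G (ambient Y)"
    and sub: "K_subspace G (ambient X) (upper X)" "K_subspace G (ambient Y) (upper Y)" "lower Y \<subseteq> upper Y"
    and f: "f \<in> glider_hom G X Y" and h: "h \<in> glider_hom G Y X" and inv: "\<forall>n\<in>upper Y. f (h n) = n"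
  shows "glider_ann X \<subseteq> glider_ann Y"
proof
  fix x assume x: "x \<in> glider_ann X"
  then have xa: "x \<in> alg" by (simp add: glider_ann_def)
  have "x \<odot>\<^bsub>ambient Y\<^esub> n = \<zero>\<^bsub>ambient Y\<^esub>" if n: "n \<in> lower Y" for n
  proof -
    have hn: "h n \<in> lower X" using h n by (auto simp: glider_hom_def)
    have "x \<odot>\<^bsub>ambient Y\<^esub> n = x \<odot>\<^bsub>ambient Y\<^esub> f (h n)" using inv n sub(3) by auto
    also have "\<dots> = f (x \<odot>\<^bsub>ambient X\<^esub> h n)" using f hn xa by (auto simp: glider_hom_def)
    also have "\<dots> = f \<zero>\<^bsub>ambient X\<^esub>" using x hn by (simp add: glider_ann_def)
    also have "\<dots> = \<zero>\<^bsub>ambient Y\<^esub>" using X Y sub(1,2) f by (rule glider_hom_zero)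
    finally show ?thesis .
  qed
  then show "x \<in> glider_ann Y" using xa by (simp add: glider_ann_def)
qed

text \<open>A glider morphism is required to commute with \<open>K[G]\<close> only on the lower term, but since the lower
  term generates, a map prescribed by the generators commutes with \<open>K[G]\<close> everywhere.\<close>

lemma generator_transfer_glider_hom:
  assumes X: "ga_module G (ambient X)" and Y: "ga_module G (ambient Y)"
    and m: "m \<in> carrier (ambient X)" "lower X = ga_module.line G (ambient X) m"
      "upper X = ga_module.cyclic G (ambient X) m"
    and n: "n \<in> carrier (ambient Y)" "lower Y = ga_module.line G (ambient Y) n"
      "upper Y = ga_module.cyclic G (ambient Y) n"
    and f: "\<And>x. x \<in> alg \<Longrightarrow> f (x \<odot>\<^bsub>ambient X\<^esub> m) = x \<odot>\<^bsub>ambient Y\<^esub> n"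
  shows "f \<in> glider_hom G X Y"
proof -
  interpret X: ga_module G "ambient X" by fact
  interpret Y: ga_module G "ambient Y" by fact
  have act: "f (x \<odot>\<^bsub>ambient X\<^esub> p) = x \<odot>\<^bsub>ambient Y\<^esub> f p" if x: "x \<in> alg" and p: "p \<in> X.cyclic m" for x p
  proof -
    obtain a where a: "a \<in> alg" "p = a \<odot>\<^bsub>ambient X\<^esub> m" using p by (auto simp: X.cyclic_def)
    then have "x \<odot>\<^bsub>ambient X\<^esub> p = (x \<star> a) \<odot>\<^bsub>ambient X\<^esub> m" using x m(1) by (simp add: X.act_conv)
    then show ?thesis using f[of "x \<star> a"] f[OF a(1)] a x n(1) by (simp add: Y.act_conv)
  qed
  have add: "f (p \<oplus>\<^bsub>ambient X\<^esub> q) = f p \<oplus>\<^bsub>ambient Y\<^esub> f q" if pq: "p \<in> X.cyclic m" "q \<in> X.cyclic m" for p q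
  proof -
    obtain a b where ab: "a \<in> alg" "p = a \<odot>\<^bsub>ambient X\<^esub> m" "b \<in> alg" "q = b \<odot>\<^bsub>ambient X\<^esub> m"
      using pq by (auto simp: X.cyclic_def)
    then have "p \<oplus>\<^bsub>ambient X\<^esub> q = (a + b) \<odot>\<^bsub>ambient X\<^esub> m" using m(1) by (simp add: X.act_add_left)
    then show ?thesis using f[of "a + b"] f[OF ab(1)] f[OF ab(3)] ab n(1) by (simp add: Y.act_add_left)
  qed
  have maps: "f p \<in> Y.cyclic n" if "p \<in> X.cyclic m" for p
    using that f by (auto simp: X.cyclic_def Y.cyclic_def)
  have "f ` X.line m \<subseteq> Y.line n" using f by (auto simp: X.line_def Y.line_def)
  then show ?thesis
    unfolding glider_hom_def LinearCombinations.module_hom_def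
    using m(2,3) n(2,3) act add maps X.line_subset_cyclic[of m] by auto
qed

lemma glider_iso_iff:
  assumes X: "irreducible_glider G X" and Y: "irreducible_glider G Y"
  shows "glider_iso G X Y \<longleftrightarrow> glider_ann X = glider_ann Y"
proof -
  interpret X: ga_module G "ambient X" using X by (simp add: irreducible_glider_iff)
  interpret Y: ga_module G "ambient Y" using Y by (simp add: irreducible_glider_iff)
  obtain m where m: "m \<in> carrier (ambient X)" "lower X = X.line m" "upper X = X.cyclic m"
    using X by (auto simp: irreducible_glider_iff)
  obtain n where n: "n \<in> carrier (ambient Y)" "lower Y = Y.line n" "upper Y = Y.cyclic n"
    using Y by (auto simp: irreducible_glider_iff)
  note subX = X.K_subspace_cyclic[OF m(1), folded m(3)] X.line_subset_cyclic[of m, folded m(2,3)]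
  note subY = Y.K_subspace_cyclic[OF n(1), folded n(3)] Y.line_subset_cyclic[of n, folded n(2,3)]
  show ?thesis
  proof
    assume "glider_iso G X Y"
    then obtain f h where "f \<in> glider_hom G X Y" "h \<in> glider_hom G Y X"
      "\<forall>m\<in>upper X. h (f m) = m" "\<forall>n\<in>upper Y. f (h n) = n"
      unfolding glider_iso_def by blast
    then show "glider_ann X = glider_ann Y"
      using glider_iso_imp_ann_subset[OF X.ga_module_axioms Y.ga_module_axioms subX(1) subY, of f h]
        glider_iso_imp_ann_subset[OF Y.ga_module_axioms X.ga_module_axioms subY(1) subX, of h f]
      by blast
  next
    assume eq: "glider_ann X = glider_ann Y"
    then have ann: "X.ann {m} = Y.ann {n}"
      using m n X.ann_line Y.ann_line
      by (simp add: glider_ann_eq X.ga_module_axioms Y.ga_module_axioms)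
    obtain f where f: "\<And>x. x \<in> alg \<Longrightarrow> f (x \<odot>\<^bsub>ambient X\<^esub> m) = x \<odot>\<^bsub>ambient Y\<^esub> n"
    proof (rule X.transfer_map[OF Y.ga_module_axioms left_ideal_alg m(1) n(1)])
      show "x \<odot>\<^bsub>ambient Y\<^esub> n = \<zero>\<^bsub>ambient Y\<^esub>" if "x \<in> alg" "x \<odot>\<^bsub>ambient X\<^esub> m = \<zero>\<^bsub>ambient X\<^esub>" for x
        using that ann by (auto simp: X.ann_def Y.ann_def)
    qed blast
    obtain h where h: "\<And>x. x \<in> alg \<Longrightarrow> h (x \<odot>\<^bsub>ambient Y\<^esub> n) = x \<odot>\<^bsub>ambient X\<^esub> m"
    proof (rule Y.transfer_map[OF X.ga_module_axioms left_ideal_alg n(1) m(1)])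
      show "x \<odot>\<^bsub>ambient X\<^esub> m = \<zero>\<^bsub>ambient X\<^esub>" if "x \<in> alg" "x \<odot>\<^bsub>ambient Y\<^esub> n = \<zero>\<^bsub>ambient Y\<^esub>" for x
        using that ann by (auto simp: X.ann_def Y.ann_def)
    qed blast
    have "f \<in> glider_hom G X Y"
      using X.ga_module_axioms Y.ga_module_axioms m n f by (rule generator_transfer_glider_hom)
    moreover have "h \<in> glider_hom G Y X"
      using Y.ga_module_axioms X.ga_module_axioms n m h by (rule generator_transfer_glider_hom)
    moreover have "\<forall>p\<in>upper X. h (f p) = p" "\<forall>q\<in>upper Y. f (h q) = q"
      using m(3) n(3) f h by (auto simp: X.cyclic_def Y.cyclic_def)
    ultimately show "glider_iso G X Y" unfolding glider_iso_def by blast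
  qed
qed

end

context glider_setting
begin

text \<open>With \<open>e\<close> a right identity of \<open>I\<close>, the vector \<open>u = 1 - e\<close> of the regular module has annihilator
  \<open>{x. x = x e} = I\<close>.\<close>

lemma glider_ann_surj:
  assumes I: "left_ideal I" "I \<noteq> alg"
  obtains X :: "('g, 'k, 'v) glider" where "irreducible_glider G X" "glider_ann X = I"
proof -
  obtain e where e: "e \<in> I" "\<And>x. x \<in> I \<Longrightarrow> x \<star> e = x"
    using left_ideal_right_identity[OF I(1)] by blast
  have e_alg: "e \<in> alg" using I(1) e(1) by (rule left_idealD(1))
  define u where "u = single 1 \<one> - e"
  have u: "u \<in> alg" using e_alg by (simp add: u_def)
  have kill: "x \<star> u = 0 \<longleftrightarrow> x \<in> I" if x: "x \<in> alg" for x
  proof -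
    have "x \<star> u = x - x \<star> e" using x by (simp add: u_def conv_diff_right)
    moreover have "x \<star> e \<in> I" using I(1) x e(1) by (rule left_idealD(4))
    ultimately show ?thesis using e(2) by auto
  qed
  have "u \<noteq> 0"
  proof
    assume "u = 0"
    then have "x \<in> I" if "x \<in> alg" for x using kill[OF that] by simp
    then show False using I left_idealD(1)[OF I(1)] by blast
  qed
  interpret R: ga_module G "coded alg" using left_ideal_alg by (rule ga_module_coded)
  define X where "X = \<lparr>ambient = coded alg, lower = R.line (code u), upper = R.cyclic (code u)\<rparr>"
  have cu: "code u \<in> carrier (coded alg)" using u by simp
  have "irreducible_glider G X"
    unfolding irreducible_glider_iff using R.ga_module_axioms cu \<open>u \<noteq> 0\<close> u
    by (intro conjI bexI[of _ "code u"]) (simp_all add: X_def code_eq_iff)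
  moreover have "glider_ann X = R.ann {code u}"
    using R.ann_line[OF cu] R.ga_module_axioms by (simp add: glider_ann_eq X_def)
  moreover have "R.ann {code u} = I"
    using u kill left_idealD(1)[OF I(1)] by (auto simp: R.ann_def code_eq_iff)
  ultimately show thesis by (intro that) simp_all
qed

lemma bij_betw_glider_classes:
  "\<exists>\<Phi>. bij_betw \<Phi> (irreducible_glider_classes G :: ('g, 'k, 'v) glider set set)
    {I :: ('g \<Rightarrow> 'k) set. left_ideal I \<and> I \<noteq> alg}"
proof -
  let ?S = "{X :: ('g, 'k, 'v) glider. irreducible_glider G X}"
  have "glider_ann ` ?S = {I :: ('g \<Rightarrow> 'k) set. left_ideal I \<and> I \<noteq> alg}"
  proof (intro equalityI subsetI)
    fix I :: "('g \<Rightarrow> 'k) set" assume "I \<in> {I. left_ideal I \<and> I \<noteq> alg}"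
    then obtain X :: "('g, 'k, 'v) glider" where "irreducible_glider G X" "glider_ann X = I"
      using glider_ann_surj[of I] by blast
    then show "I \<in> glider_ann ` ?S" by blast
  qed (use left_ideal_glider_ann in auto)
  note bij = bij_betw_quotient_kernel[OF this]
  have "{(X, Y). X \<in> ?S \<and> Y \<in> ?S \<and> glider_ann X = glider_ann Y} =
      {(X, Y). irreducible_glider G X \<and> irreducible_glider G Y \<and> glider_iso G X Y}"
    using glider_iso_iff by blast
  then show ?thesis
    unfolding irreducible_glider_classes_def using bij
    by (intro exI[of _ "\<lambda>C. glider_ann (SOME X. X \<in> C)"]) simp
qed

end

section \<open>Linear characters\<close>

context finite_group
begin

text \<open>Homomorphisms from \<open>G\<close> to the multiplicative group of \<open>K\<close>. The value zero outside \<open>G\<close> makes each of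
  them a single function.\<close>

definition characters :: "('g \<Rightarrow> 'k::field) set"
  where "characters = {\<chi>. (\<forall>g. g \<notin> carrier G \<longrightarrow> \<chi> g = 0) \<and> \<chi> \<one> = 1 \<and>
    (\<forall>g\<in>carrier G. \<forall>h\<in>carrier G. \<chi> (g \<otimes> h) = \<chi> g * \<chi> h)}"

lemma characterD:
  assumes "\<chi> \<in> characters"
  shows "g \<notin> carrier G \<Longrightarrow> \<chi> g = 0" "\<chi> \<one> = 1"
    "g \<in> carrier G \<Longrightarrow> h \<in> carrier G \<Longrightarrow> \<chi> (g \<otimes> h) = \<chi> g * \<chi> h"
  using assms by (auto simp: characters_def)

lemma character_inv: "\<chi> \<in> characters \<Longrightarrow> g \<in> carrier G \<Longrightarrow> \<chi> (inv g) * \<chi> g = 1"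
  using characterD(3)[of \<chi> "inv g" g] characterD(2)[of \<chi>] by simp

lemma character_nonzero: "\<chi> \<in> characters \<Longrightarrow> g \<in> carrier G \<Longrightarrow> \<chi> g \<noteq> 0"
  using character_inv[of \<chi> g] by auto

lemma sum_translate: "g \<in> carrier G \<Longrightarrow> (\<Sum>h\<in>carrier G. f (g \<otimes> h)) = (\<Sum>h\<in>carrier G. f h)"
  by (rule sum.reindex_bij_witness[of _ "\<lambda>h. inv g \<otimes> h" "\<lambda>h. g \<otimes> h"]) (auto simp flip: m_assoc)

lemma prod_translate: "g \<in> carrier G \<Longrightarrow> (\<Prod>h\<in>carrier G. f (g \<otimes> h)) = (\<Prod>h\<in>carrier G. f h)"
  by (rule prod.reindex_bij_witness[of _ "\<lambda>h. inv g \<otimes> h" "\<lambda>h. g \<otimes> h"]) (auto simp flip: m_assoc)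

lemma character_root_of_unity:
  assumes "\<chi> \<in> characters" "g \<in> carrier G"
  shows "\<chi> g ^ card (carrier G) = 1"
proof -
  have "(\<Prod>h\<in>carrier G. \<chi> h) = (\<Prod>h\<in>carrier G. \<chi> g * \<chi> h)"
    using prod_translate[OF assms(2), of \<chi>] characterD(3)[OF assms] by simp
  also have "\<dots> = \<chi> g ^ card (carrier G) * (\<Prod>h\<in>carrier G. \<chi> h)"
    by (simp add: prod.distrib)
  finally show ?thesis
    using character_nonzero[OF assms(1)] finite_carrier by simp
qed

lemma finite_characters: "finite (characters :: ('g \<Rightarrow> 'k::field) set)"
proof -
  define n where "n = card (carrier G)"
  have "n > 0" using finite_carrier by (auto simp: n_def card_gt_0_iff)
  have "monom (1 :: 'k) n - 1 \<noteq> 0"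
  proof
    assume "monom (1 :: 'k) n - 1 = 0"
    then have "coeff (monom (1 :: 'k) n) n = coeff 1 n" by simp
    then show False using \<open>n > 0\<close> by simp
  qed
  then have "finite {z :: 'k. poly (monom 1 n - 1) z = 0}" by (rule poly_roots_finite)
  then have fin: "finite {z :: 'k. z ^ n = 1}" by (simp add: poly_monom)
  have "characters \<subseteq> {\<chi> :: 'g \<Rightarrow> 'k. \<forall>g. (g \<in> carrier G \<longrightarrow> \<chi> g \<in> {z. z ^ n = 1}) \<and> (g \<notin> carrier G \<longrightarrow> \<chi> g = 0)}"
    using character_root_of_unity characterD(1) unfolding n_def by blast
  then show ?thesis
    using finite_set_of_finite_funs[OF finite_carrier fin] by (rule finite_subset)
qed

lemma character_on_derived:
  assumes "\<chi> \<in> characters" "g \<in> derived G (carrier G)"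
  shows "\<chi> g = 1"
proof -
  let ?N = "{g \<in> carrier G. \<chi> g = 1}"
  have "\<chi> (inv h) = 1" if "h \<in> carrier G" "\<chi> h = 1" for h
    using character_inv[OF assms(1) that(1)] that(2) by simp
  then have "subgroup ?N G"
    using characterD[OF assms(1)] by unfold_locales auto
  moreover have "\<chi> (h \<otimes> k \<otimes> inv h \<otimes> inv k) = 1" if "h \<in> carrier G" "k \<in> carrier G" for h k
  proof -
    have "\<chi> (h \<otimes> k \<otimes> inv h \<otimes> inv k) = (\<chi> (inv h) * \<chi> h) * (\<chi> (inv k) * \<chi> k)"
      using that characterD(3)[OF assms(1)] by simp
    then show ?thesis using that character_inv[OF assms(1)] by simp
  qed
  ultimately have "derived G (carrier G) \<subseteq> ?N"
    unfolding derived_def by (intro generate_subgroup_incl) auto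
  then show ?thesis using assms(2) by auto
qed

definition character_eval :: "('g \<Rightarrow> 'k::field) \<Rightarrow> ('g \<Rightarrow> 'k) \<Rightarrow> 'k"
  where "character_eval \<chi> x = (\<Sum>g\<in>carrier G. x g * \<chi> g)"

lemma character_eval_add: "character_eval \<chi> (x + y) = character_eval \<chi> x + character_eval \<chi> y"
  by (simp add: character_eval_def fun_apply algebra_simps sum.distrib)

lemma character_eval_zero [simp]: "character_eval \<chi> 0 = 0"
  by (simp add: character_eval_def fun_apply)

lemma character_eval_single: "g \<in> carrier G \<Longrightarrow> character_eval \<chi> (single c g) = c * \<chi> g"
  using finite_carrier
  by (simp add: character_eval_def single_def if_distrib[of "\<lambda>a. a * _"] cong: if_cong)

lemma character_eval_conv:
  assumes \<chi>: "\<chi> \<in> characters" and x: "x \<in> alg"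
  shows "character_eval \<chi> (x \<star> y) = character_eval \<chi> x * character_eval \<chi> y"
  using x
proof (rule alg_induct)
  fix c g assume g: "g \<in> carrier G"
  have "character_eval \<chi> (single c g \<star> y) = (\<Sum>k\<in>carrier G. c * y (inv g \<otimes> k) * \<chi> k)"
    using g by (simp add: character_eval_def conv_single_left)
  also have "\<dots> = (\<Sum>k\<in>carrier G. c * y k * \<chi> (g \<otimes> k))"
    by (rule sum.reindex_bij_witness[of _ "\<lambda>h. g \<otimes> h" "\<lambda>h. inv g \<otimes> h"])
       (use g in \<open>auto simp flip: m_assoc\<close>)
  also have "\<dots> = c * \<chi> g * character_eval \<chi> y"
    using g characterD(3)[OF \<chi>] by (simp add: character_eval_def sum_distrib_left mult_ac)
  finally show "character_eval \<chi> (single c g \<star> y) = character_eval \<chi> (single c g) * character_eval \<chi> y"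
    using g by (simp add: character_eval_single)
qed (simp_all add: conv_add_left character_eval_add algebra_simps)

lemma left_ideal_character_kernel:
  assumes "\<chi> \<in> characters"
  shows "left_ideal {x \<in> alg. character_eval \<chi> x = 0}"
  using character_eval_conv[OF assms] by (auto simp: left_ideal_def character_eval_add)

text \<open>The kernel of \<open>K[G] \<rightarrow> K[G/G']\<close>, written as the annihilator of the indicator function of \<open>G'\<close>:
  the element \<open>g\<close> carries this function to the indicator function of the coset \<open>g G'\<close>.\<close>

definition derived_kernel :: "('g \<Rightarrow> 'k::field) set"
  where "derived_kernel = {x \<in> alg. x \<star> (\<lambda>g. if g \<in> derived G (carrier G) then 1 else 0) = 0}"

lemma left_ideal_derived_kernel: "left_ideal derived_kernel"
  unfolding derived_kernel_def by (rule left_ideal_kernel[OF left_ideal_alg])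

lemma commutator_in_derived_kernel:
  assumes g: "g \<in> carrier G" and h: "h \<in> carrier G"
  shows "single 1 (g \<otimes> h) - single 1 (h \<otimes> g) \<in> derived_kernel"
proof -
  let ?D = "derived G (carrier G)"
  interpret D: subgroup ?D G by (rule derived_is_subgroup) simp
  have comm: "inv (h \<otimes> g) \<otimes> (g \<otimes> h) \<in> ?D"
  proof -
    have "inv (h \<otimes> g) \<otimes> (g \<otimes> h) = inv g \<otimes> inv h \<otimes> inv (inv g) \<otimes> inv (inv h)"
      using g h by (simp add: inv_mult_group m_assoc)
    then show ?thesis unfolding derived_def using g h by (intro generate.incl) blast
  qed
  have "inv (g \<otimes> h) \<otimes> k \<in> ?D \<longleftrightarrow> inv (h \<otimes> g) \<otimes> k \<in> ?D" if k: "k \<in> carrier G" for k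
  proof -
    let ?d = "inv (h \<otimes> g) \<otimes> (g \<otimes> h)" and ?y = "inv (g \<otimes> h) \<otimes> k"
    have *: "?d \<otimes> (inv (g \<otimes> h) \<otimes> k) = inv (h \<otimes> g) \<otimes> k"
    proof -
      have "?d \<otimes> (inv (g \<otimes> h) \<otimes> k) = inv (h \<otimes> g) \<otimes> ((g \<otimes> h) \<otimes> inv (g \<otimes> h)) \<otimes> k"
        using g h k by (simp only: m_assoc inv_closed m_closed)
      then show ?thesis using g h k by simp
    qed
    have "?d \<in> carrier G" "?y \<in> carrier G" using g h k by simp_all
    then have "inv ?d \<otimes> (?d \<otimes> ?y) = ?y"
      using m_assoc[of "inv ?d" ?d ?y] by simp
    then show ?thesis
      using comm * D.m_closed D.m_inv_closed by metis
  qed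
  then show ?thesis
    using g h by (auto simp: derived_kernel_def conv_diff_left conv_single_left fun_eq_iff fun_apply)
qed

lemma outside_derived_kernel:
  assumes a: "a \<in> carrier G" "a \<notin> derived G (carrier G)"
  shows "(single 1 a - single 1 \<one> :: 'g \<Rightarrow> 'k::field) \<notin> derived_kernel"
proof
  interpret D: subgroup "derived G (carrier G)" G by (rule derived_is_subgroup) simp
  let ?e = "\<lambda>g. if g \<in> derived G (carrier G) then 1 else (0 :: 'k)"
  assume "(single 1 a - single 1 \<one> :: 'g \<Rightarrow> 'k) \<in> derived_kernel"
  then have "(single 1 a \<star> ?e - single 1 \<one> \<star> ?e) \<one> = (0 :: 'g \<Rightarrow> 'k) \<one>"
    by (simp add: derived_kernel_def conv_diff_left)
  then have "?e (inv a) = 1"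
    using a D.one_closed by (simp add: conv_single_left fun_apply)
  then have "inv a \<in> derived G (carrier G)" by (auto split: if_splits)
  then show False using a D.m_inv_closed[of "inv a"] by simp
qed

end

context ga_module
begin

text \<open>A vector on which every group element acts by a scalar spans the module it generates.\<close>

lemma scalar_vector:
  assumes irr: "irreducible_module G M" and u: "u \<in> carrier M" "u \<noteq> \<zero>\<^bsub>M\<^esub>"
    and \<chi>: "\<And>g. g \<in> carrier G \<Longrightarrow> single 1 g \<cdot> u = scalar G (\<chi> g) \<cdot> u"
  shows "carrier M = line u"
    and "x \<in> alg \<Longrightarrow> w \<in> carrier M \<Longrightarrow> x \<cdot> w = scalar G (character_eval \<chi> x) \<cdot> w"
    and "K_dim G M (carrier M) = 1"
proof -
  have eval: "x \<cdot> u = scalar G (character_eval \<chi> x) \<cdot> u" if "x \<in> alg" for x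
    using that
  proof (rule alg_induct)
    fix c g assume g: "g \<in> carrier G"
    have "single c g \<cdot> u = scalar G c \<cdot> single 1 g \<cdot> u"
      unfolding single_eq_scalar[OF g, of c] using g u(1) by (intro act_conv) simp_all
    also have "\<dots> = scalar G c \<cdot> scalar G (\<chi> g) \<cdot> u" using \<chi>[OF g] by (rule arg_cong)
    also have "\<dots> = scalar G (c * \<chi> g) \<cdot> u"
      unfolding scalar_conv_scalar[symmetric] using u(1) by (intro act_conv[symmetric]) simp_all
    finally show "single c g \<cdot> u = scalar G (character_eval \<chi> (single c g)) \<cdot> u"
      using g by (simp add: character_eval_single)
  qed (use u in \<open>simp_all add: act_add_left character_eval_add scalar_add\<close>)
  have "cyclic u \<subseteq> line u" using eval unfolding cyclic_def line_def by blast
  then show line: "carrier M = line u"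
    using irreducible_cyclic[OF irr u] K_subspace_subset[OF K_subspace_line[OF u(1)]] by blast
  show "x \<cdot> w = scalar G (character_eval \<chi> x) \<cdot> w" if x: "x \<in> alg" and w: "w \<in> carrier M" for x w
  proof -
    have "w \<in> line u" using w unfolding line .
    then obtain c where c: "w = scalar G c \<cdot> u" by (auto simp: line_def)
    have "x \<cdot> w = scalar G c \<cdot> x \<cdot> u" unfolding c using x u(1) by (rule scalar_act_act[symmetric])
    also have "\<dots> = scalar G c \<cdot> scalar G (character_eval \<chi> x) \<cdot> u" using eval[OF x] by (rule arg_cong)
    also have "\<dots> = scalar G (character_eval \<chi> x) \<cdot> w" unfolding c by (rule scalar_act_act[OF alg_scalar u(1)])
    finally show ?thesis .
  qed
  have "K_dim G M (carrier M) \<noteq> 0"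
    using K_dim_eq_0_iff[OF K_subspace_carrier irreducible_K_fin_dim[OF irr]] u by auto
  then show "K_dim G M (carrier M) = 1" using K_dim_line_le[OF u(1)] line by simp
qed

lemma add_eq_imp_diff_eq:
  assumes "a \<in> carrier M" "b \<in> carrier M" "x \<in> carrier M" "y \<in> carrier M"
    and eq: "a \<oplus>\<^bsub>M\<^esub> b = x \<oplus>\<^bsub>M\<^esub> y"
  shows "b \<ominus>\<^bsub>M\<^esub> y = x \<ominus>\<^bsub>M\<^esub> a"
proof -
  have "b = \<ominus>\<^bsub>M\<^esub> a \<oplus>\<^bsub>M\<^esub> (x \<oplus>\<^bsub>M\<^esub> y)"
    using assms(1,2) by (simp add: mod.M.r_neg1 flip: eq)
  then have "b = (x \<oplus>\<^bsub>M\<^esub> \<ominus>\<^bsub>M\<^esub> a) \<oplus>\<^bsub>M\<^esub> y"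
    using assms(1-4) by (simp add: mod.M.a_ac)
  then show ?thesis
    using assms(1-4) by (simp add: a_minus_def mod.M.a_assoc mod.M.r_neg)
qed

lemma scalar_act_cancel:
  assumes u: "u \<in> carrier M" "u \<noteq> \<zero>\<^bsub>M\<^esub>" and eq: "scalar G c \<cdot> u = scalar G d \<cdot> u"
  shows "c = d"
proof (rule ccontr)
  assume "c \<noteq> d"
  have "scalar G (c - d) = scalar G c - (scalar G d :: 'g \<Rightarrow> 'k)"
    by (auto simp: scalar_def fun_eq_iff fun_apply)
  then have "scalar G (c - d) \<cdot> u = \<zero>\<^bsub>M\<^esub>"
    using u eq by (simp add: act_diff_left diff_eq_zero_iff)
  then have "scalar G (inverse (c - d)) \<cdot> scalar G (c - d) \<cdot> u = \<zero>\<^bsub>M\<^esub>" by simp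
  then show False using scalar_inverse_act[of "c - d" u] u \<open>c \<noteq> d\<close> by simp
qed

lemma character_of_scalar_vector:
  assumes u: "u \<in> carrier M" "u \<noteq> \<zero>\<^bsub>M\<^esub>"
    and scal: "\<And>g. g \<in> carrier G \<Longrightarrow> single 1 g \<cdot> u \<in> line u"
  obtains \<chi> where "\<chi> \<in> characters" "\<And>g. g \<in> carrier G \<Longrightarrow> single 1 g \<cdot> u = scalar G (\<chi> g) \<cdot> u"
proof -
  have "\<forall>g\<in>carrier G. \<exists>c. single 1 g \<cdot> u = scalar G c \<cdot> u" using scal by (auto simp: line_def)
  then obtain \<phi> where \<phi>: "\<And>g. g \<in> carrier G \<Longrightarrow> single 1 g \<cdot> u = scalar G (\<phi> g) \<cdot> u" by metis
  define \<chi> where "\<chi> g = (if g \<in> carrier G then \<phi> g else 0)" for g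
  have \<chi>: "single 1 g \<cdot> u = scalar G (\<chi> g) \<cdot> u" if "g \<in> carrier G" for g
    using \<phi> that by (simp add: \<chi>_def)
  have "\<chi> (g \<otimes> h) = \<chi> g * \<chi> h" if g: "g \<in> carrier G" and h: "h \<in> carrier G" for g h
  proof (rule scalar_act_cancel[OF u])
    have "single 1 (g \<otimes> h) \<cdot> u = single 1 g \<cdot> single 1 h \<cdot> u"
      using g h u by (simp add: single_conv_single flip: act_conv)
    also have "\<dots> = scalar G (\<chi> h) \<cdot> scalar G (\<chi> g) \<cdot> u"
      using g h u \<chi> scalar_act_act[of "single 1 g" u "\<chi> h"] by simp
    also have "\<dots> = scalar G (\<chi> g * \<chi> h) \<cdot> u"
      using u by (simp add: scalar_conv_scalar mult.commute flip: act_conv)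
    finally show "scalar G (\<chi> (g \<otimes> h)) \<cdot> u = scalar G (\<chi> g * \<chi> h) \<cdot> u"
      using \<chi>[of "g \<otimes> h"] g h by simp
  qed
  moreover have "\<chi> \<one> = 1"
    using \<chi>[of \<one>] u by (intro scalar_act_cancel[OF u]) (simp add: scalar_one)
  ultimately have "\<chi> \<in> characters" by (auto simp: characters_def \<chi>_def)
  then show thesis using \<chi> by (rule that)
qed

end

context ga_module_closed
begin

text \<open>If the elements of \<open>G\<close> commute on a generator, they commute on the whole module, so each of them is
  an endomorphism, and Schur's lemma applies.\<close>

lemma commuting_vector:
  assumes irr: "irreducible_module G M" and u: "u \<in> carrier M" "u \<noteq> \<zero>\<^bsub>M\<^esub>"
    and comm: "\<And>g h. g \<in> carrier G \<Longrightarrow> h \<in> carrier G \<Longrightarrow> single 1 (g \<otimes> h) \<cdot> u = single 1 (h \<otimes> g) \<cdot> u"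
    and g: "g \<in> carrier G"
  shows "single 1 g \<cdot> u \<in> line u"
proof -
  have commute: "single 1 g \<cdot> x \<cdot> u = x \<cdot> single 1 g \<cdot> u" if "x \<in> alg" for x
    using that
  proof (rule alg_induct)
    fix c :: 'k and h assume h: "h \<in> carrier G"
    have "single c h = scalar G c \<star> single 1 h" using h by (rule single_eq_scalar)
    moreover have "single 1 g \<cdot> single 1 h \<cdot> u = single 1 h \<cdot> single 1 g \<cdot> u"
      using comm[OF g h] g h u by (simp add: single_conv_single flip: act_conv)
    ultimately show "single 1 g \<cdot> single c h \<cdot> u = single c h \<cdot> single 1 g \<cdot> u"
      using g h u by (simp add: act_conv flip: scalar_act_act)
  qed (use u g in \<open>simp_all add: act_add_left act_add_right\<close>)
  have "(\<lambda>w. single 1 g \<cdot> w) \<in> LinearCombinations.module_hom (group_algebra G) M M"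
    unfolding LinearCombinations.module_hom_def
  proof (intro CollectI conjI allI impI Pi_I)
    show "single 1 g \<cdot> w \<in> carrier M" if "w \<in> carrier M" for w using that g by simp
    show "single 1 g \<cdot> (v \<oplus>\<^bsub>M\<^esub> w) = single 1 g \<cdot> v \<oplus>\<^bsub>M\<^esub> single 1 g \<cdot> w"
      if "v \<in> carrier M \<and> w \<in> carrier M" for v w
      using that g by (simp add: act_add_right)
    fix r :: "'g \<Rightarrow> 'k" and w assume rw: "r \<in> carrier (group_algebra G) \<and> w \<in> carrier M"
    then have r: "r \<in> alg" by simp
    obtain x where x: "x \<in> alg" "w = x \<cdot> u"
      using rw irreducible_cyclic[OF irr u] by (auto simp: cyclic_def)
    have "single 1 g \<cdot> r \<cdot> w = single 1 g \<cdot> (r \<star> x) \<cdot> u" using r x u by (simp add: act_conv)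
    also have "\<dots> = (r \<star> x) \<cdot> single 1 g \<cdot> u" by (rule commute) simp
    also have "\<dots> = r \<cdot> single 1 g \<cdot> w" using r x u g commute[OF x(1)] by (simp add: act_conv)
    finally show "single 1 g \<cdot> r \<cdot> w = r \<cdot> single 1 g \<cdot> w" .
  qed
  then obtain c where "\<And>w. w \<in> carrier M \<Longrightarrow> single 1 g \<cdot> w = scalar G c \<cdot> w"
    using schur_scalar[OF irr] by blast
  then show ?thesis using u by (auto simp: line_def)
qed

end

context glider_setting
begin

text \<open>Semisimplicity provides an irreducible module on which \<open>K[G]\<close> acts through \<open>K[G/G']\<close> and \<open>a\<close> does not
  act as the identity. There \<open>G\<close> acts commutatively, hence by scalars.\<close>

lemma character_separates:
  assumes a: "a \<in> carrier G" "a \<notin> derived G (carrier G)"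
  obtains \<chi> :: "'g \<Rightarrow> 'k" where "\<chi> \<in> characters" "\<chi> a \<noteq> 1"
proof -
  have x: "single 1 a - single 1 \<one> \<in> (alg :: ('g \<Rightarrow> 'k) set)" using a by simp
  obtain C u where C: "C \<in> Irr_v" and u: "u \<in> carrier (irr_rep C)"
    and kill: "\<And>y. y \<in> derived_kernel \<Longrightarrow> y \<odot>\<^bsub>irr_rep C\<^esub> u = \<zero>\<^bsub>irr_rep C\<^esub>"
    and nz: "(single 1 a - single 1 \<one>) \<odot>\<^bsub>irr_rep C\<^esub> u \<noteq> \<zero>\<^bsub>irr_rep C\<^esub>"
    using irr_rep_separates[OF left_ideal_derived_kernel x outside_derived_kernel[OF a]] by blast
  interpret C: ga_module_closed G "irr_rep C" using C by (rule irr.ga_module_closed_U)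
  have u0: "u \<noteq> \<zero>\<^bsub>irr_rep C\<^esub>" using nz x by auto
  have comm: "single 1 (g \<otimes> h) \<odot>\<^bsub>irr_rep C\<^esub> u = single 1 (h \<otimes> g) \<odot>\<^bsub>irr_rep C\<^esub> u"
    if "g \<in> carrier G" "h \<in> carrier G" for g h
    using kill[OF commutator_in_derived_kernel[OF that]] that u
    by (simp add: C.act_diff_left C.diff_eq_zero_iff)
  obtain \<chi> where \<chi>: "\<chi> \<in> characters"
    "\<And>g. g \<in> carrier G \<Longrightarrow> single 1 g \<odot>\<^bsub>irr_rep C\<^esub> u = scalar G (\<chi> g) \<odot>\<^bsub>irr_rep C\<^esub> u"
    using C.character_of_scalar_vector[OF u u0 C.commuting_vector[OF irr_rep_irreducible[OF C] u u0 comm]] by blast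
  have "\<chi> a \<noteq> 1"
    using nz a u \<chi>(2)[OF a(1)] by (auto simp: C.act_diff_left C.diff_eq_zero_iff scalar_one)
  with \<chi>(1) show thesis by (rule that)
qed

text \<open>Sum all values of all characters. By rows: a character that is not trivial has sum \<open>0\<close>, so the
  total is \<open>|G|\<close>. By columns: the sum over all characters at \<open>g \<notin> G'\<close> is \<open>0\<close>, as multiplying with a
  character \<open>\<psi>\<close> with \<open>\<psi> g \<noteq> 1\<close> permutes the characters, so the total is \<open>|G'|\<close> times their number.
  Both totals are compared in \<open>K\<close>, which has characteristic zero.\<close>

lemma card_characters: "card (characters :: ('g \<Rightarrow> 'k) set) = card (rcosets (derived G (carrier G)))"
proof -
  let ?X = "characters :: ('g \<Rightarrow> 'k) set" and ?D = "derived G (carrier G)"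
  interpret D: subgroup ?D G by (rule derived_is_subgroup) simp
  define \<epsilon> :: "'g \<Rightarrow> 'k" where "\<epsilon> g = (if g \<in> carrier G then 1 else 0)" for g
  have fin: "finite ?X" by (rule finite_characters)
  have \<epsilon>: "\<epsilon> \<in> ?X" by (auto simp: characters_def \<epsilon>_def)
  have row: "(\<Sum>g\<in>carrier G. \<chi> g) = (if \<chi> = \<epsilon> then of_nat (card (carrier G)) else 0)"
    if \<chi>: "\<chi> \<in> ?X" for \<chi>
  proof (cases "\<chi> = \<epsilon>")
    case True
    then show ?thesis by (simp add: \<epsilon>_def)
  next
    case False
    then obtain h where h: "h \<in> carrier G" "\<chi> h \<noteq> 1"
      using characterD(1)[OF \<chi>] by (auto simp: \<epsilon>_def fun_eq_iff split: if_splits)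
    have "(\<Sum>g\<in>carrier G. \<chi> g) = (\<Sum>g\<in>carrier G. \<chi> h * \<chi> g)"
      using sum_translate[OF h(1), of \<chi>] characterD(3)[OF \<chi> h(1)] by simp
    also have "\<dots> = \<chi> h * (\<Sum>g\<in>carrier G. \<chi> g)" by (rule sum_distrib_left[symmetric])
    finally show ?thesis using h(2) False by simp
  qed
  have col: "(\<Sum>\<chi>\<in>?X. \<chi> g) = (if g \<in> ?D then of_nat (card ?X) else 0)" if g: "g \<in> carrier G" for g
  proof (cases "g \<in> ?D")
    case True
    then have "(\<Sum>\<chi>\<in>?X. \<chi> g) = (\<Sum>\<chi>\<in>?X. 1)"
      by (intro sum.cong) (auto intro: character_on_derived)
    then show ?thesis using True by simp
  next
    case False
    obtain \<psi> where \<psi>: "\<psi> \<in> ?X" "\<psi> g \<noteq> 1" using character_separates[OF g False] by blast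
    have nz: "\<psi> h \<noteq> 0" if "h \<in> carrier G" for h using character_nonzero[OF \<psi>(1) that] .
    have cancel: "\<psi> h * (inverse (\<psi> h) * \<chi> h) = \<chi> h" "inverse (\<psi> h) * (\<psi> h * \<chi> h) = \<chi> h"
      if "\<chi> \<in> ?X" for \<chi> h
      using nz[of h] characterD(1)[OF that, of h] by (cases "h \<in> carrier G"; simp)+
    have "(\<Sum>\<chi>\<in>?X. \<chi> g) = (\<Sum>\<chi>\<in>?X. \<psi> g * \<chi> g)"
    proof (rule sum.reindex_bij_witness[of _ "\<lambda>\<chi> h. \<psi> h * \<chi> h" "\<lambda>\<chi> h. inverse (\<psi> h) * \<chi> h"])
      show "(\<lambda>h. \<psi> h * (inverse (\<psi> h) * \<chi> h)) = \<chi>" "(\<lambda>h. inverse (\<psi> h) * (\<psi> h * \<chi> h)) = \<chi>"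
        if "\<chi> \<in> ?X" for \<chi>
        unfolding cancel[OF that] by (rule refl)+
    qed (use \<psi>(1) nz g in \<open>auto simp: characters_def\<close>)
    also have "\<dots> = \<psi> g * (\<Sum>\<chi>\<in>?X. \<chi> g)" by (rule sum_distrib_left[symmetric])
    finally show ?thesis using \<psi>(2) False by simp
  qed
  have "of_nat (card (carrier G)) = (\<Sum>\<chi>\<in>?X. \<Sum>g\<in>carrier G. \<chi> g)"
    using fin \<epsilon> by (simp add: row)
  also have "\<dots> = (\<Sum>g\<in>carrier G. \<Sum>\<chi>\<in>?X. \<chi> g)" by (rule sum.swap)
  also have "\<dots> = (\<Sum>g\<in>carrier G. if g \<in> ?D then of_nat (card ?X) else 0)"
    using col by simp
  also have "\<dots> = (\<Sum>g\<in>?D. of_nat (card ?X))"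
    using finite_carrier D.subset by (subst sum.inter_restrict[symmetric]) (auto simp: Int_absorb1)
  also have "\<dots> = of_nat (card ?D * card ?X)" by simp
  finally have "card (carrier G) = card ?D * card ?X" by (simp only: of_nat_eq_iff)
  moreover have "card (rcosets ?D) * card ?D = card (carrier G)"
    using lagrange[OF D.subgroup_axioms] by (simp add: Coset.order_def)
  moreover have "card ?D \<noteq> 0"
    using finite_subset[OF D.subset finite_carrier] D.one_closed by (metis card_0_eq empty_iff)
  ultimately show ?thesis by (metis mult.commute mult_cancel1)
qed

lemma linear_class_character:
  assumes C: "C \<in> linear_classes"
  obtains \<chi> where "\<chi> \<in> characters"
    "\<And>x w. x \<in> alg \<Longrightarrow> w \<in> carrier (irr_rep C) \<Longrightarrow>
       x \<odot>\<^bsub>irr_rep C\<^esub> w = scalar G (character_eval \<chi> x) \<odot>\<^bsub>irr_rep C\<^esub> w"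
proof -
  have Irr: "C \<in> Irr_v" and dim: "irr_dim G C = 1" using C by (auto simp: linear_classes_def)
  interpret C: ga_module_closed G "irr_rep C" using Irr by (rule irr.ga_module_closed_U)
  note irr = irr_rep_irreducible[OF Irr]
  obtain u where u: "u \<in> carrier (irr_rep C)" "u \<noteq> \<zero>\<^bsub>irr_rep C\<^esub>" using C.irreducible_nonzero[OF irr] .
  have "C.line u \<noteq> {\<zero>\<^bsub>irr_rep C\<^esub>}" using C.generator_in_line[OF u(1)] u(2) by auto
  then have line: "C.line u = carrier (irr_rep C)"
    using nonzero_subspace_dim(2)[OF Irr C.K_subspace_line[OF u(1)]] dim by simp
  have "single 1 g \<odot>\<^bsub>irr_rep C\<^esub> u \<in> C.line u" if "g \<in> carrier G" for g
    using that u(1) line by simp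
  then obtain \<chi> where \<chi>: "\<chi> \<in> characters"
    "\<And>g. g \<in> carrier G \<Longrightarrow> single 1 g \<odot>\<^bsub>irr_rep C\<^esub> u = scalar G (\<chi> g) \<odot>\<^bsub>irr_rep C\<^esub> u"
    using C.character_of_scalar_vector[OF u] by blast
  show thesis by (rule that[OF \<chi>(1) C.scalar_vector(2)[OF irr u \<chi>(2)]])
qed

lemma character_unique:
  assumes "\<chi> \<in> characters" "\<psi> \<in> characters" "C \<in> Irr_v"
    and \<chi>: "\<And>x w. x \<in> alg \<Longrightarrow> w \<in> carrier (irr_rep C) \<Longrightarrow>
       x \<odot>\<^bsub>irr_rep C\<^esub> w = scalar G (character_eval \<chi> x) \<odot>\<^bsub>irr_rep C\<^esub> w"
    and \<psi>: "\<And>x w. x \<in> alg \<Longrightarrow> w \<in> carrier (irr_rep C) \<Longrightarrow>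
       x \<odot>\<^bsub>irr_rep C\<^esub> w = scalar G (character_eval \<psi> x) \<odot>\<^bsub>irr_rep C\<^esub> w"
  shows "\<chi> = \<psi>"
proof
  fix g
  interpret C: ga_module_closed G "irr_rep C" using assms(3) by (rule irr.ga_module_closed_U)
  obtain u where u: "u \<in> carrier (irr_rep C)" "u \<noteq> \<zero>\<^bsub>irr_rep C\<^esub>"
    using C.irreducible_nonzero[OF irr_rep_irreducible[OF assms(3)]] .
  show "\<chi> g = \<psi> g"
  proof (cases "g \<in> carrier G")
    case True
    then have "scalar G (\<chi> g) \<odot>\<^bsub>irr_rep C\<^esub> u = scalar G (\<psi> g) \<odot>\<^bsub>irr_rep C\<^esub> u"
      using \<chi>[of "single 1 g" u] \<psi>[of "single 1 g" u] u by (simp add: character_eval_single)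
    then show ?thesis by (rule C.scalar_act_cancel[OF u])
  qed (use assms(1,2) in \<open>auto simp: characterD(1)\<close>)
qed

text \<open>Generators of two such modules have the same annihilator, the kernel of the extension of \<open>\<chi>\<close> to
  \<open>K[G]\<close>.\<close>

lemma character_determines_class:
  assumes CD: "C \<in> Irr_v" "D \<in> Irr_v"
    and C: "\<And>x w. x \<in> alg \<Longrightarrow> w \<in> carrier (irr_rep C) \<Longrightarrow>
       x \<odot>\<^bsub>irr_rep C\<^esub> w = scalar G (character_eval \<chi> x) \<odot>\<^bsub>irr_rep C\<^esub> w"
    and D: "\<And>x w. x \<in> alg \<Longrightarrow> w \<in> carrier (irr_rep D) \<Longrightarrow>
       x \<odot>\<^bsub>irr_rep D\<^esub> w = scalar G (character_eval \<chi> x) \<odot>\<^bsub>irr_rep D\<^esub> w"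
  shows "C = D"
proof -
  interpret C: ga_module_closed G "irr_rep C" using CD(1) by (rule irr.ga_module_closed_U)
  interpret D: ga_module_closed G "irr_rep D" using CD(2) by (rule irr.ga_module_closed_U)
  note irrC = irr_rep_irreducible[OF CD(1)] and irrD = irr_rep_irreducible[OF CD(2)]
  obtain u where u: "u \<in> carrier (irr_rep C)" "u \<noteq> \<zero>\<^bsub>irr_rep C\<^esub>" using C.irreducible_nonzero[OF irrC] .
  obtain v where v: "v \<in> carrier (irr_rep D)" "v \<noteq> \<zero>\<^bsub>irr_rep D\<^esub>" using D.irreducible_nonzero[OF irrD] .
  have ann: "x \<odot>\<^bsub>irr_rep D\<^esub> v = \<zero>\<^bsub>irr_rep D\<^esub>" if x: "x \<in> alg" "x \<odot>\<^bsub>irr_rep C\<^esub> u = \<zero>\<^bsub>irr_rep C\<^esub>" for x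
  proof -
    have "scalar G (character_eval \<chi> x) \<odot>\<^bsub>irr_rep C\<^esub> u = scalar G 0 \<odot>\<^bsub>irr_rep C\<^esub> u"
      using C[OF x(1) u(1)] x(2) u by simp
    then have "character_eval \<chi> x = 0" by (rule C.scalar_act_cancel[OF u])
    then show ?thesis using D[OF x(1) v(1)] v by simp
  qed
  have onto: "carrier (irr_rep C) = {x \<odot>\<^bsub>irr_rep C\<^esub> u |x. x \<in> alg}"
    using C.irreducible_cyclic[OF irrC u] by (simp add: C.cyclic_def)
  obtain f where f: "f \<in> LinearCombinations.module_hom (group_algebra G) (irr_rep C) (irr_rep D)"
    "\<And>x. x \<in> alg \<Longrightarrow> f (x \<odot>\<^bsub>irr_rep C\<^esub> u) = x \<odot>\<^bsub>irr_rep D\<^esub> v"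
    using C.transfer_hom[OF D.ga_module_axioms left_ideal_alg u(1) v(1) ann onto] by blast
  have "f u = v" using f(2)[of "single 1 \<one>"] u v by simp
  then have "module_iso G (irr_rep C) (irr_rep D)"
    using C.schur_iso[OF D.ga_module_axioms irrC irrD f(1) u(1)] v(2) by simp
  then show "C = D" using irr_rep_unique CD by blast
qed

text \<open>Separate \<open>1\<close> from the kernel of the extension of \<open>\<chi>\<close> to \<open>K[G]\<close>: the vector obtained is killed by all
  \<open>g - \<chi>(g)\<close>.\<close>

lemma character_realized:
  assumes \<chi>: "\<chi> \<in> (characters :: ('g \<Rightarrow> 'k) set)"
  obtains C where "C \<in> linear_classes"
    "\<And>x w. x \<in> alg \<Longrightarrow> w \<in> carrier (irr_rep C) \<Longrightarrow>
       x \<odot>\<^bsub>irr_rep C\<^esub> w = scalar G (character_eval \<chi> x) \<odot>\<^bsub>irr_rep C\<^esub> w"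
proof -
  let ?I = "{x \<in> alg. character_eval \<chi> x = 0}"
  have one: "single 1 \<one> \<in> alg" "single 1 \<one> \<notin> ?I"
    using characterD(2)[OF \<chi>] by (auto simp: character_eval_single)
  obtain C u where C: "C \<in> Irr_v" and u: "u \<in> carrier (irr_rep C)"
    and kill: "\<And>y. y \<in> ?I \<Longrightarrow> y \<odot>\<^bsub>irr_rep C\<^esub> u = \<zero>\<^bsub>irr_rep C\<^esub>"
    and nz: "single 1 \<one> \<odot>\<^bsub>irr_rep C\<^esub> u \<noteq> \<zero>\<^bsub>irr_rep C\<^esub>"
    using irr_rep_separates[OF left_ideal_character_kernel[OF \<chi>] one] by blast
  interpret C: ga_module_closed G "irr_rep C" using C by (rule irr.ga_module_closed_U)
  note irr = irr_rep_irreducible[OF C]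
  have u0: "u \<noteq> \<zero>\<^bsub>irr_rep C\<^esub>" using nz u by simp
  have act: "single 1 g \<odot>\<^bsub>irr_rep C\<^esub> u = scalar G (\<chi> g) \<odot>\<^bsub>irr_rep C\<^esub> u" if g: "g \<in> carrier G" for g
  proof -
    have "character_eval \<chi> (single 1 g - scalar G (\<chi> g)) + character_eval \<chi> (scalar G (\<chi> g))
        = character_eval \<chi> (single 1 g)"
      by (simp flip: character_eval_add)
    then have "single 1 g - scalar G (\<chi> g) \<in> ?I"
      using g characterD(2)[OF \<chi>] by (simp add: scalar_eq_single character_eval_single)
    from kill[OF this] show ?thesis using g u by (simp add: C.act_diff_left C.diff_eq_zero_iff)
  qed
  have "irr_dim G C = 1" using C.scalar_vector(3)[OF irr u u0 act] by (simp add: irr_dim_def)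
  then have "C \<in> linear_classes" using C by (simp add: linear_classes_def)
  then show thesis using C.scalar_vector(2)[OF irr u u0 act] by (rule that)
qed

lemma linear_classes_bij: "\<exists>\<beta>. bij_betw \<beta> linear_classes (carrier (G Mod derived G (carrier G)))"
proof -
  let ?X = "characters :: ('g \<Rightarrow> 'k) set"
  let ?P = "\<lambda>C \<chi>. \<chi> \<in> ?X \<and> (\<forall>x\<in>alg. \<forall>w\<in>carrier (irr_rep C).
       x \<odot>\<^bsub>irr_rep C\<^esub> w = scalar G (character_eval \<chi> x) \<odot>\<^bsub>irr_rep C\<^esub> w)"
  have "\<forall>C\<in>linear_classes. \<exists>\<chi>. ?P C \<chi>"
  proof
    fix C assume "C \<in> linear_classes"
    then show "\<exists>\<chi>. ?P C \<chi>" by (rule linear_class_character) blast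
  qed
  then obtain \<kappa> where "\<forall>C\<in>linear_classes. ?P C (\<kappa> C)" by (rule bchoice[THEN exE])
  then have \<kappa>: "\<kappa> C \<in> ?X"
    and act: "\<And>x w. x \<in> alg \<Longrightarrow> w \<in> carrier (irr_rep C) \<Longrightarrow>
      x \<odot>\<^bsub>irr_rep C\<^esub> w = scalar G (character_eval (\<kappa> C) x) \<odot>\<^bsub>irr_rep C\<^esub> w"
    if "C \<in> linear_classes" for C
    using that by blast+
  have Irr: "C \<in> Irr_v" if "C \<in> linear_classes" for C using that by (simp add: linear_classes_def)
  have "bij_betw \<kappa> linear_classes ?X"
    unfolding bij_betw_def
  proof (intro conjI equalityI subsetI)
    show "inj_on \<kappa> linear_classes"
    proof (rule inj_onI)
      fix C D assume C: "C \<in> linear_classes" and D: "D \<in> linear_classes" and eq: "\<kappa> C = \<kappa> D"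
      show "C = D"
        by (rule character_determines_class[OF Irr[OF C] Irr[OF D] act[OF C] act[OF D, folded eq]])
    qed
    show "\<chi> \<in> ?X" if "\<chi> \<in> \<kappa> ` linear_classes" for \<chi> using that \<kappa> by blast
    fix \<chi> assume \<chi>: "\<chi> \<in> ?X"
    obtain C where C: "C \<in> linear_classes"
      "\<And>x w. x \<in> alg \<Longrightarrow> w \<in> carrier (irr_rep C) \<Longrightarrow>
         x \<odot>\<^bsub>irr_rep C\<^esub> w = scalar G (character_eval \<chi> x) \<odot>\<^bsub>irr_rep C\<^esub> w"
      using character_realized[OF \<chi>] by blast
    have "\<chi> = \<kappa> C"
      by (rule character_unique[OF \<chi> \<kappa>[OF C(1)] Irr[OF C(1)] C(2) act[OF C(1)]])
    then show "\<chi> \<in> \<kappa> ` linear_classes" using C(1) by blast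
  qed
  moreover have "\<exists>f. bij_betw f ?X (rcosets (derived G (carrier G)))"
  proof (rule finite_same_card_bij)
    show "finite (rcosets (derived G (carrier G)))"
      using finite_carrier by (simp add: RCOSETS_def)
  qed (auto simp: finite_characters card_characters)
  ultimately show ?thesis by (auto simp: FactGroup_def intro: bij_betw_trans)
qed

section \<open>Non-commutative groups\<close>

text \<open>If \<open>G\<close> acts by scalars on every irreducible module, then \<open>g h - h g\<close> acts as zero on all of them,
  so it is zero.\<close>

lemma ex_nonlinear_class:
  assumes "\<not> comm_group G"
  obtains C where "C \<in> Irr_v" "irr_dim G C > 1"
proof -
  obtain g h where gh: "g \<in> carrier G" "h \<in> carrier G" "g \<otimes> h \<noteq> h \<otimes> g"
    using assms group_comm_groupI by blast
  let ?x = "single 1 (g \<otimes> h) - single 1 (h \<otimes> g) :: 'g \<Rightarrow> 'k"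
  have "?x (g \<otimes> h) \<noteq> 0" using gh by (simp add: fun_apply single_def)
  then have x: "?x \<in> alg" "?x \<notin> {0}" using gh by (auto simp: fun_apply)
  have "left_ideal {0 :: 'g \<Rightarrow> 'k}" by (auto simp: left_ideal_def)
  then obtain C u where C: "C \<in> Irr_v" and u: "u \<in> carrier (irr_rep C)"
    and nz: "?x \<odot>\<^bsub>irr_rep C\<^esub> u \<noteq> \<zero>\<^bsub>irr_rep C\<^esub>"
    using irr_rep_separates[OF _ x] by blast
  interpret C: ga_module_closed G "irr_rep C" using C by (rule irr.ga_module_closed_U)
  have "irr_dim G C \<noteq> 1"
  proof
    assume "irr_dim G C = 1"
    then have "C \<in> linear_classes" using C by (simp add: linear_classes_def)
    then obtain \<chi> where \<chi>: "\<chi> \<in> characters"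
      and act: "\<And>x w. x \<in> alg \<Longrightarrow> w \<in> carrier (irr_rep C) \<Longrightarrow>
        x \<odot>\<^bsub>irr_rep C\<^esub> w = scalar G (character_eval \<chi> x) \<odot>\<^bsub>irr_rep C\<^esub> w"
      using linear_class_character by blast
    have "single 1 (g \<otimes> h) \<odot>\<^bsub>irr_rep C\<^esub> u = single 1 (h \<otimes> g) \<odot>\<^bsub>irr_rep C\<^esub> u"
      using act[of "single 1 (g \<otimes> h)" u] act[of "single 1 (h \<otimes> g)" u] gh u characterD(3)[OF \<chi>]
      by (simp add: character_eval_single mult.commute)
    then show False using nz gh u by (simp add: C.act_diff_left C.diff_eq_zero_iff)
  qed
  then show thesis using that C irr_dim_pos[OF C] by simp
qed

text \<open>For independent \<open>u\<close> and \<open>v\<close> in \<open>U\<close>, the lines spanned by \<open>u + c v\<close> with \<open>c \<in> K\<close> are distinct, and \<open>K\<close> is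
  infinite. The choice of one such line, and of nothing for the other classes, is an element of \<open>S_G\<close>.\<close>

lemma infinite_S_G:
  assumes C: "C \<in> Irr_v" "irr_dim G C > 1"
  shows "infinite (S_G G :: (('g, 'k, 'v) ga_module set \<times> 'v set) set set)"
proof -
  interpret C: ga_module_closed G "irr_rep C" using C(1) by (rule irr.ga_module_closed_U)
  let ?U = "irr_rep C"
  obtain u where u: "u \<in> carrier ?U" "u \<noteq> \<zero>\<^bsub>?U\<^esub>"
    using C.irreducible_nonzero[OF irr_rep_irreducible[OF C(1)]] .
  have "C.line u \<noteq> carrier ?U" using C.K_dim_line_le[OF u(1)] C(2) by (auto simp: irr_dim_def)
  then obtain v where v: "v \<in> carrier ?U" "v \<notin> C.line u"
    using C.K_subspace_subset[OF C.K_subspace_line[OF u(1)]] by blast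
  define p where "p c = u \<oplus>\<^bsub>?U\<^esub> scalar G c \<odot>\<^bsub>?U\<^esub> v" for c
  have p: "p c \<in> carrier ?U" for c using u v by (simp add: p_def)
  note L = C.K_subspace_line[OF u(1)]
  have scalar_diff: "scalar G (c - d) = scalar G c - (scalar G d :: 'g \<Rightarrow> 'k)" for c d
    by (auto simp: scalar_def fun_eq_iff fun_apply)
  have indep: "t = 0" if t: "scalar G t \<odot>\<^bsub>?U\<^esub> v \<in> C.line u" for t
  proof (rule ccontr)
    assume "t \<noteq> 0"
    moreover have "scalar G (inverse t) \<odot>\<^bsub>?U\<^esub> (scalar G t \<odot>\<^bsub>?U\<^esub> v) \<in> C.line u"
      using L t by (simp add: C.K_subspace_iff)
    ultimately show False using v by (simp add: C.scalar_inverse_act)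
  qed
  have p_nz: "p c \<noteq> \<zero>\<^bsub>?U\<^esub>" for c
  proof
    assume pc: "p c = \<zero>\<^bsub>?U\<^esub>"
    have "scalar G c \<odot>\<^bsub>?U\<^esub> v \<ominus>\<^bsub>?U\<^esub> \<zero>\<^bsub>?U\<^esub> = \<zero>\<^bsub>?U\<^esub> \<ominus>\<^bsub>?U\<^esub> u"
      using u v pc by (intro C.add_eq_imp_diff_eq) (simp_all add: p_def)
    moreover have "\<zero>\<^bsub>?U\<^esub> \<ominus>\<^bsub>?U\<^esub> u \<in> C.line u"
      using C.K_subspace_diff[OF L] L C.generator_in_line[OF u(1)] by (simp add: C.K_subspace_iff)
    moreover have "scalar G c \<odot>\<^bsub>?U\<^esub> v \<ominus>\<^bsub>?U\<^esub> \<zero>\<^bsub>?U\<^esub> = scalar G c \<odot>\<^bsub>?U\<^esub> v"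
      using v by (simp add: a_minus_def)
    ultimately have "c = 0" by (intro indep) simp
    then show False using pc u v by (simp add: p_def)
  qed
  have inj: "c = d" if eq: "C.line (p c) = C.line (p d)" for c d
  proof -
    have "p c \<in> C.line (p d)" using C.generator_in_line[OF p[of c]] eq by simp
    then obtain t where t: "p c = scalar G t \<odot>\<^bsub>?U\<^esub> p d" by (auto simp: C.line_def)
    have "u \<oplus>\<^bsub>?U\<^esub> scalar G c \<odot>\<^bsub>?U\<^esub> v = scalar G t \<odot>\<^bsub>?U\<^esub> u \<oplus>\<^bsub>?U\<^esub> scalar G (t * d) \<odot>\<^bsub>?U\<^esub> v"
      using t u v by (simp add: p_def C.act_add_right flip: scalar_conv_scalar C.act_conv)
    then have diff: "scalar G c \<odot>\<^bsub>?U\<^esub> v \<ominus>\<^bsub>?U\<^esub> scalar G (t * d) \<odot>\<^bsub>?U\<^esub> v = scalar G t \<odot>\<^bsub>?U\<^esub> u \<ominus>\<^bsub>?U\<^esub> u"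
      using u v by (intro C.add_eq_imp_diff_eq) simp_all
    moreover have "scalar G t \<odot>\<^bsub>?U\<^esub> u \<ominus>\<^bsub>?U\<^esub> u \<in> C.line u"
      using C.K_subspace_diff[OF L _ C.generator_in_line[OF u(1)]] by (auto simp: C.line_def)
    ultimately have "scalar G (c - t * d) \<odot>\<^bsub>?U\<^esub> v \<in> C.line u"
      using v by (simp add: scalar_diff C.act_diff_left)
    then have c: "c = t * d" using indep[of "c - t * d"] by simp
    have "scalar G t \<odot>\<^bsub>?U\<^esub> u \<ominus>\<^bsub>?U\<^esub> u = \<zero>\<^bsub>?U\<^esub>"
      using diff v unfolding c by (simp add: a_minus_def C.mod.M.r_neg)
    then have "scalar G t \<odot>\<^bsub>?U\<^esub> u = u" using u by (simp add: C.diff_eq_zero_iff)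
    then have "t = 1" using u by (intro C.scalar_act_cancel[OF u]) (simp add: scalar_one)
    then show "c = d" using c by simp
  qed
  define B where "B c = {(C, C.line (p c))}" for c
  have "inj B" using inj by (auto simp: B_def inj_def)
  then have inf: "infinite (range B)"
    using infinite_UNIV_char_0[where ?'a = 'k] by (simp add: finite_image_iff)
  have sub: "range B \<subseteq> S_G G"
  proof -
    have "C.line (p c) \<noteq> {\<zero>\<^bsub>?U\<^esub>}" for c using C.generator_in_line[OF p] p_nz by auto
    then have "B c \<in> S_G G" for c
      using C C.K_subspace_line[OF p] by (auto simp: S_G_iff B_def)
    then show ?thesis by blast
  qed
  show ?thesis by (rule infinite_super[OF sub inf])
qed

section \<open>The classification of irreducible gliders\<close>

lemma bij_betw_data:
  "\<exists>\<Phi>. bij_betw \<Phi> (Pow linear_classes \<times> (S_G G :: (('g, 'k, 'v) ga_module set \<times> 'v set) set set) - {({}, {})})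
     (Pow (carrier (G Mod derived G (carrier G))) \<times>
       (S_G G :: (('g, 'k, 'v) ga_module set \<times> 'v set) set set) - {({}, {})})"
proof -
  obtain \<beta> where \<beta>: "bij_betw \<beta> linear_classes (carrier (G Mod derived G (carrier G)))"
    using linear_classes_bij by blast
  let ?\<Phi> = "map_prod ((`) \<beta>) id"
  let ?S = "S_G G :: (('g, 'k, 'v) ga_module set \<times> 'v set) set set"
  have bij: "bij_betw ?\<Phi> (Pow linear_classes \<times> ?S) (Pow (carrier (G Mod derived G (carrier G))) \<times> ?S)"
    using \<beta> by (intro bij_betw_map_prod bij_betw_Pow bij_betw_id)
  have empty: "({}, {}) \<in> Pow linear_classes \<times> ?S" by (simp add: S_G_iff)
  have "?\<Phi> ` (Pow linear_classes \<times> ?S - {({}, {})}) = ?\<Phi> ` (Pow linear_classes \<times> ?S) - ?\<Phi> ` {({}, {})}"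
    using bij empty by (intro inj_on_image_set_diff[of _ "Pow linear_classes \<times> ?S"]) (auto simp: bij_betw_def)
  also have "\<dots> = Pow (carrier (G Mod derived G (carrier G))) \<times> ?S - {({}, {})}"
    using bij by (simp add: bij_betw_def)
  finally have "bij_betw ?\<Phi> (Pow linear_classes \<times> ?S - {({}, {})})
      (Pow (carrier (G Mod derived G (carrier G))) \<times> ?S - {({}, {})})"
    using bij by (auto intro: bij_betw_subset)
  then show ?thesis by blast
qed

end

theorem proposition1:
  fixes G :: "('g, 'm) monoid_scheme"
    and \<iota> :: "'k::{alg_closed_field, field_char_0} \<Rightarrow> 'v"
  assumes "group G" and "finite (carrier G)"
    and "inj \<iota>"
  shows "(\<exists>\<Phi>. bij_betw \<Phi>
            (irreducible_glider_classes G :: ('g, 'k, 'v) glider set set)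
            (Pow (carrier (G Mod derived G (carrier G))) \<times>
               (S_G G :: (('g, 'k, 'v) ga_module set \<times> 'v set) set set) - {({}, {})})) \<and>
         (\<not> comm_group G \<longrightarrow>
          (\<exists>\<Phi>. bij_betw \<Phi>
            (irreducible_glider_classes G :: ('g, 'k, 'v) glider set set)
            (Pow (carrier (G Mod derived G (carrier G))) \<times>
               (S_G G :: (('g, 'k, 'v) ga_module set \<times> 'v set) set set))))"
    (is "(\<exists>\<Phi>. bij_betw \<Phi> ?gliders (?data - {({}, {})})) \<and> _")
proof -
  interpret glider_setting G \<iota>
    using assms by (simp add: glider_setting_def glider_setting_axioms_def finite_group_def finite_group_axioms_def)
  obtain \<Phi>1 where "bij_betw \<Phi>1 ?gliders {I :: ('g \<Rightarrow> 'k) set. left_ideal I \<and> I \<noteq> alg}"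
    using bij_betw_glider_classes by blast
  note bij_betw_trans[OF this bij_betw_left_ideals]
  moreover obtain \<Phi>2 where "bij_betw \<Phi>2
      (Pow linear_classes \<times> (S_G G :: (('g, 'k, 'v) ga_module set \<times> 'v set) set set) - {({}, {})})
      (?data - {({}, {})})"
    using bij_betw_data by blast
  ultimately have "bij_betw (\<Phi>2 \<circ> ((\<lambda>I. (linear_part I, nonlinear_part I)) \<circ> \<Phi>1)) ?gliders (?data - {({}, {})})"
    by (rule bij_betw_trans)
  then have gliders: "?gliders \<approx> ?data - {({}, {})}"
    by (auto simp: eqpoll_def)
  \<comment> \<open>An infinite set is equipollent to the set with one element removed.\<close>
  have "?data - {({}, {})} \<approx> ?data" if "\<not> comm_group G"
  proof -
    have zero: "({}, {}) \<in> ?data" by (simp add: S_G_iff)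
    obtain C where "C \<in> Irr_v" "irr_dim G C > 1" using ex_nonlinear_class[OF \<open>\<not> comm_group G\<close>] by blast
    then have "infinite (S_G G :: (('g, 'k, 'v) ga_module set \<times> 'v set) set set)" by (rule infinite_S_G)
    then have "infinite ?data" by (auto dest: finite_cartesian_productD2)
    then have "infinite (?data - {({}, {})})" by simp
    then have "insert ({}, {}) (?data - {({}, {})}) \<approx> ?data - {({}, {})}" by (rule infinite_insert_eqpoll)
    then show ?thesis using zero by (simp add: insert_absorb eqpoll_sym)
  qed
  then show ?thesis
    using gliders eqpoll_trans[OF gliders] by (auto simp: eqpoll_def)
qed

end
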